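(* Let $f\in\mathbb{C}[z]$ be a polynomial of degree $d>1$, and suppose that $E(f)=\{\infty\}$. Then for every real number $$\eta>\sup_{z\in\mathbb{C}:\ \text{superattracting periodic point of }f}\ \limsup_{n\to\infty}(\deg_z(f^n))^{1/n},$$ there is a polar subset $E=E_{f,\eta}$ in $\mathbb{C}$ such that for every $a\in\mathbb{C}\setminus E$ and every $C^2$ test function $\phi$ on $\mathbb{P}^1$, $$\int_{\mathbb{P}^1}\phi\,\mathrm{d}\biggl(\frac{((f^n)')^*\delta_a}{d^n-1}-\mu_f\biggr)=o((\eta/d)^n)\quad\text{as }n\to\infty.$$
   Context: $\mathbb{P}^1=\mathbb{C}\cup\{\infty\}$ is the Riemann sphere, and $\mathbb{N}=\mathbb{Z}_{>0}$. $f^n$ is the $n$-th iterate of $f$, and $(f^n)'$ is its derivative, a polynomial of degree $d^n-1$ regarded as a rational map $\mathbb{P}^1\to\mathbb{P}^1$. $\deg_z h$ denotes the local degree of $h$ at $z$. The convention $\sup_{\emptyset}=1$ is adopted (so the supremum is $1$ when $f$ has no superattracting periodic points in $\mathbb{C}$). A periodic point $z\in\mathbb{C}$ of $f$, say $f^p(z)=z$ with $p\in\mathbb{N}$, is superattracting if $(f^p)'(z)=0$. $\delta_z$ is the Dirac measure at $z\in\mathbb{P}^1$. For a rational function $h$ of degree $>0$ and a Radon measure $\nu$ on $\mathbb{P}^1$, $h^*\nu$ is the Radon measure with $\int\phi\,\mathrm{d}(h^*\nu)=\int\big(\sum_{w\in h^{-1}(z)}(\deg_w h)\phi(w)\big)\mathrm{d}\nu(z)$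 for continuous $\phi$; in particular $h^*\delta_a=\sum_{w\in h^{-1}(a)}(\deg_w h)\,\delta_w$. The exceptional set is $E(f):=\{a\in\mathbb{P}^1:\#\bigcup_{n\in\mathbb{N}}f^{-n}(a)<\infty\}$ (it always contains $\infty$). The $f$-equilibrium (or canonical) measure $\mu_f$ is the unique probability Radon measure $\nu$ on $\mathbb{P}^1$ such that $f^*\nu=d\cdot\nu$ on $\mathbb{P}^1$ and $\nu(\{a\})=0$ for every $a\in E(f)$; it coincides with the harmonic measure with pole $\infty$ of the filled-in Julia set $K(f)=\{z\in\mathbb{C}:\limsup_{n\to\infty}|f^n(z)|<\infty\}$. "Polar" is in the sense of classical logarithmic potential theory. *)

theory Defs
  imports
    "HOL-Probability.Probability"
    "HOL-Computational_Algebra.Computational_Algebra"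
    "HOL-Library.Landau_Symbols"
begin

text \<open>The Riemann sphere, with the topology of the one-point compactification of the plane.\<close>

datatype riemann_sphere = Fin complex | Infty

instantiation riemann_sphere :: topological_space
begin

definition open_riemann_sphere :: "riemann_sphere set \<Rightarrow> bool" where
  "open U \<longleftrightarrow> open (Fin -` U) \<and> (Infty \<in> U \<longrightarrow> compact (- (Fin -` U)))"

instance
proof
  show "open (UNIV :: riemann_sphere set)"
    by (simp add: open_riemann_sphere_def)
next
  fix S T :: "riemann_sphere set"
  assume "open S" "open T"
  then show "open (S \<inter> T)"
    by (auto simp: open_riemann_sphere_def Compl_Int intro: compact_Un)
next
  fix K :: "riemann_sphere set set"
  assume K: "\<forall>S\<in>K. open S"
  have op: "open (Fin -` \<Union> K)"
    using K by (auto simp: open_riemann_sphere_def vimage_Union)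
  moreover have "compact (- (Fin -` \<Union> K))" if inf: "Infty \<in> \<Union> K"
  proof -
    obtain S where S: "S \<in> K" "Infty \<in> S"
      using inf by blast
    then have "compact (- (Fin -` S))"
      using K by (auto simp: open_riemann_sphere_def)
    moreover have "closed (- (Fin -` \<Union> K))"
      using op by (simp add: closed_def)
    moreover have "- (Fin -` \<Union> K) = - (Fin -` S) \<inter> - (Fin -` \<Union> K)"
      using S by auto
    ultimately show ?thesis
      by (metis compact_Int_closed)
  qed
  ultimately show "open (\<Union> K)"
    by (simp add: open_riemann_sphere_def)
qed

end

definition poly_iterate :: "complex poly \<Rightarrow> nat \<Rightarrow> complex poly" where
  "poly_iterate f n = (pcompose f ^^ n) [:0, 1:]"

text \<open>
  A polynomial \<open>h\<close> as a rational map of the sphere, and its local degrees (the order of vanishing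
  of \<open>h - h(z)\<close> at a finite point \<open>z\<close>; the point at infinity is totally ramified). Both are
  meant for polynomials of positive degree only.
\<close>

fun sphere_map :: "complex poly \<Rightarrow> riemann_sphere \<Rightarrow> riemann_sphere" where
  "sphere_map h (Fin z) = Fin (poly h z)"
| "sphere_map h Infty = Infty"

fun local_degree :: "complex poly \<Rightarrow> riemann_sphere \<Rightarrow> nat" where
  "local_degree h (Fin z) = order z (h - [:poly h z:])"
| "local_degree h Infty = degree h"

definition exceptional_set :: "complex poly \<Rightarrow> riemann_sphere set" where
  "exceptional_set f = {a. finite (\<Union>n\<in>{1..}. (sphere_map f ^^ n) -` {a})}"

text \<open>
  The pullback \<open>h\<^sup>*\<nu>\<close> as a functional on continuous functions:
  \<open>pullback h \<nu> \<phi>\<close> is the integral of \<open>\<phi>\<close> against \<open>h\<^sup>*\<nu>\<close>.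
\<close>

definition pullback :: "complex poly \<Rightarrow> riemann_sphere measure \<Rightarrow> (riemann_sphere \<Rightarrow> real) \<Rightarrow> real"
  where "pullback h \<nu> \<phi> =
    (\<integral>z. (\<Sum>w \<in> sphere_map h -` {z}. real (local_degree h w) * \<phi> w) \<partial>\<nu>)"

text \<open>
  The sphere is compact and metrizable, so its probability Radon measures are exactly the
  probability measures on its Borel sets. The fourth conjunct is \<open>f\<^sup>*\<mu> = d \<cdot> \<mu>\<close>.
\<close>

definition is_equilibrium_measure :: "complex poly \<Rightarrow> riemann_sphere measure \<Rightarrow> bool" where
  "is_equilibrium_measure f \<mu> \<longleftrightarrow>
     prob_space \<mu> \<and> sets \<mu> = sets borel \<and>
     (\<forall>a\<in>exceptional_set f. measure \<mu> {a} = 0) \<and>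
     (\<forall>\<phi>. continuous_on UNIV \<phi> \<longrightarrow> pullback f \<mu> \<phi> = real (degree f) * (\<integral>z. \<phi> z \<partial>\<mu>))"

definition superattracting_periodic :: "complex poly \<Rightarrow> complex \<Rightarrow> bool" where
  "superattracting_periodic f z \<longleftrightarrow>
     (\<exists>p>0. poly (poly_iterate f p) z = z \<and> poly (pderiv (poly_iterate f p)) z = 0)"

definition local_degree_growth :: "complex poly \<Rightarrow> complex \<Rightarrow> ereal" where
  "local_degree_growth f z =
     limsup (\<lambda>n. ereal (root n (real (local_degree (poly_iterate f n) (Fin z)))))"

definition superattracting_growth :: "complex poly \<Rightarrow> ereal" where
  "superattracting_growth f =
     (if \<exists>z. superattracting_periodic f z
      then (SUP z\<in>{z. superattracting_periodic f z}. local_degree_growth f z)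
      else 1)"

text \<open>
  The logarithmic energy, the double integral of \<open>log |z - w|\<close>, as the difference of the
  integrals of the positive and the negative part. It is used for measures of bounded support, where
  the positive part has finite integral. On the diagonal \<open>log |z - w|\<close> is \<open>-\<infinity>\<close>, but the
  library has \<open>ln 0 = 0\<close>, so the negative part needs a case distinction.
\<close>

definition log_energy :: "complex measure \<Rightarrow> ereal" where
  "log_energy M =
     enn2ereal (\<integral>\<^sup>+z. \<integral>\<^sup>+w. ennreal (ln (cmod (z - w))) \<partial>M \<partial>M) -
     enn2ereal (\<integral>\<^sup>+z. \<integral>\<^sup>+w. (if z = w then \<infinity> else ennreal (- ln (cmod (z - w)))) \<partial>M \<partial>M)"

definition polar :: "complex set \<Rightarrow> bool" where
  "polar E \<longleftrightarrow>
     (\<forall>M K. finite_measure M \<and> sets M = sets borel \<and> emeasure M UNIV \<noteq> 0 \<and>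
        compact K \<and> K \<subseteq> E \<and> emeasure M (- K) = 0 \<longrightarrow> log_energy M = - \<infinity>)"

definition C2 :: "(complex \<Rightarrow> real) \<Rightarrow> bool" where
  "C2 g \<longleftrightarrow>
     (\<exists>(g' :: complex \<Rightarrow> complex \<Rightarrow>\<^sub>L real) (g'' :: complex \<Rightarrow> complex \<Rightarrow>\<^sub>L complex \<Rightarrow>\<^sub>L real).
        (\<forall>z. (g has_derivative blinfun_apply (g' z)) (at z)) \<and>
        (\<forall>z. (g' has_derivative blinfun_apply (g'' z)) (at z)) \<and>
        continuous_on UNIV g'')"

text \<open>The two charts are \<open>z\<close> and \<open>1 / z\<close>.\<close>

definition C2_sphere :: "(riemann_sphere \<Rightarrow> real) \<Rightarrow> bool" where
  "C2_sphere \<phi> \<longleftrightarrow>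
     C2 (\<lambda>z. \<phi> (Fin z)) \<and> C2 (\<lambda>w. \<phi> (if w = 0 then Infty else Fin (1 / w)))"

end

theory Submission
  imports Defs "HOL-Real_Asymp.Real_Asymp"
begin

text \<open>
  For a \<open>C\<^sup>2\<close> function \<open>g\<close>, the averages of \<open>g\<close> over the zeros of two polynomials differ by at
  most a constant times the \<open>L\<^sup>1\<close> distance, on a disc, of their normalised potentials
  \<open>log |p| / deg p\<close>. So everything reduces to comparing potentials. Write \<open>f\<^sup>n\<close> for the iterates and
  \<open>F = (f\<^sup>n)'\<close>.

  The difference between \<open>log |F - a|\<close> and \<open>log\<^sup>+ |F|\<close> is controlled by \<open>log\<^sup>- |F - a|\<close>; its integrals,
  weighted by \<open>\<theta>\<^sup>-\<^sup>n\<close> with \<open>1 < \<theta> < \<eta>\<close>, sum to a potential in \<open>a\<close> which is finite off a polar set.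
  The difference between \<open>log\<^sup>+ |F|\<close> and \<open>log\<^sup>+ |f\<^sup>n|\<close> is polynomial in \<open>n\<close> outside a union of tiny
  discs around preimages of escaping critical points: an orbit about to escape stays exponentially far
  from the critical points with bounded orbit. Finally \<open>d\<^sup>-\<^sup>n log\<^sup>+ |f\<^sup>n|\<close> is Cauchy at the rate
  \<open>d\<^sup>-\<^sup>n\<close>.

  The limit is identified with \<open>\<mu>\<close> through \<open>f\<^sup>*\<mu> = d \<cdot> \<mu>\<close>: the fibres of \<open>f\<^sup>2\<^sup>m\<close> over any two finite points
  have asymptotically equal averages, because without finite exceptional points \<open>f\<^sup>2\<close> has no totally
  ramified finite point, so \<open>f\<^sup>2\<^sup>m\<close> can be close to a given value only on a very small set.
\<close>

section \<open>Zeros of complex polynomials\<close>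

text \<open>Two choices of scale shape the estimates. For derivatives, \<open>F j z\<close> counts
  as close to a critical point at distance \<open>exp (- n^3)\<close>. Pulling this back to
  \<open>z\<close> costs a factor of order \<open>exp (K n^2)\<close>, so the exceptional discs can
  have radius \<open>exp (- n^2)\<close>. Their total area, of order
  \<open>n d^n exp (- 2 n^2)\<close>, beats the trivial size \<open>d^n\<close> of the potentials
  there, while elsewhere \<open>n\<close> factors each lose order \<open>n^3\<close>, which produces
  the power \<open>n^4\<close>. For fibres, distance \<open>exp (- t)\<close> to a value pulls back
  through \<open>m\<close> steps of f^2 to a distance of order
  \<open>exp (- t / (d^2 - 1)^m)\<close>. The gap between \<open>d^2 - 1\<close> and the degree
  \<open>d^2\<close> is decisive: with \<open>t = m^2 (d^2 - 1)^m\<close> the height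
  \<open>t\<close> is negligible against \<open>d^(2 m)\<close>, and the discs still shrink like
  \<open>exp (- m^2)\<close>. The square of f is used because f itself may have a single critical
  point, as z^2 + c has. The speed of this second estimate never meets the rate of the theorem: the
  derivative of f^n is compared with f^(2 m) for fixed n, and m tends to infinity first.\<close>

lemma poly_eq_prod_proots:
  fixes p :: "complex poly"
  shows "poly p z = lead_coeff p * (\<Prod>y\<in>#proots p. z - y)"
proof -
  have "poly p z = poly (smult (lead_coeff p) (\<Prod>y\<in>#proots p. [:-y, 1:])) z"
    by (simp only: complex_poly_decompose_multiset)
  also have "\<dots> = lead_coeff p * (\<Prod>y\<in>#proots p. z - y)"
    by (simp add: poly_prod_mset algebra_simps)
  finally show ?thesis .
qed

lemma ln_cmod_prod_mset:
  assumes "\<forall>y\<in>#M. z \<noteq> y"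
  shows "ln (cmod (\<Prod>y\<in>#M. z - y)) = (\<Sum>y\<in>#M. ln (cmod (z - y)))"
  using assms
proof (induction M)
  case (add y M)
  then have "(\<Prod>y\<in>#M. z - y) \<noteq> 0" "z - y \<noteq> 0" by (auto simp: prod_mset_zero_iff)
  then show ?case using add by (simp add: norm_mult ln_mult)
qed simp

lemma ln_cmod_poly:
  fixes p :: "complex poly"
  assumes "poly p z \<noteq> 0"
  shows "ln (cmod (poly p z)) = ln (cmod (lead_coeff p)) + (\<Sum>y\<in>#proots p. ln (cmod (z - y)))"
proof -
  have p0: "p \<noteq> 0" using assms by auto
  have "(\<Prod>y\<in>#proots p. z - y) \<noteq> 0" using assms poly_eq_prod_proots[of p z] by auto
  moreover have "\<forall>y\<in>#proots p. z \<noteq> y" using assms p0 by auto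
  ultimately show ?thesis
    by (subst poly_eq_prod_proots) (use p0 in \<open>simp add: norm_mult ln_mult ln_cmod_prod_mset\<close>)
qed

lemma log_deriv_prod_mset:
  assumes "\<forall>y\<in>#M. z \<noteq> y"
  shows "poly (pderiv (\<Prod>y\<in>#M. [:-y, 1:])) z / poly (\<Prod>y\<in>#M. [:-y, 1:]) z
    = (\<Sum>y\<in>#M. 1 / (z - y :: complex))"
  using assms
proof (induction M)
  case (add y M)
  then have "poly (\<Prod>y\<in>#M. [:-y, 1:]) z \<noteq> 0" "z - y \<noteq> 0"
    by (auto simp: poly_prod_mset prod_mset_zero_iff)
  moreover define Q where "Q = (\<Prod>y\<in>#M. [:-y, 1:])"
  moreover have "poly (pderiv Q) z / poly Q z = (\<Sum>y\<in>#M. 1 / (z - y))"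
    using add by (simp add: Q_def)
  moreover have "poly (pderiv ([:-y, 1:] * Q)) z / poly ([:-y, 1:] * Q) z
      = 1 / (z - y) + poly (pderiv Q) z / poly Q z" if "poly Q z \<noteq> 0" "z - y \<noteq> 0"
  proof -
    have e1: "poly (pderiv ([:-y, 1:] * Q)) z = poly Q z + (z - y) * poly (pderiv Q) z"
      by (subst pderiv_mult) (simp add: pderiv_pCons algebra_simps)
    have e2: "poly ([:-y, 1:] * Q) z = (z - y) * poly Q z"
      by (simp add: algebra_simps)
    show ?thesis unfolding e1 e2 add_divide_distrib using that by simp
  qed
  ultimately show ?case by simp
qed simp

lemma log_deriv_poly:
  fixes p :: "complex poly"
  assumes "poly p z \<noteq> 0"
  shows "poly (pderiv p) z / poly p z = (\<Sum>y\<in>#proots p. 1 / (z - y))"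
proof -
  have p0: "p \<noteq> 0" using assms by auto
  define q where "q = (\<Prod>y\<in>#proots p. [:-y, 1:])"
  have pq: "p = smult (lead_coeff p) q"
    unfolding q_def by (simp only: complex_poly_decompose_multiset)
  have "poly (pderiv p) z / poly p z
      = poly (pderiv (smult (lead_coeff p) q)) z / poly (smult (lead_coeff p) q) z"
    using pq by metis
  also have "\<dots> = poly (pderiv q) z / poly q z"
    using p0 by (simp add: pderiv_smult)
  also have "\<dots> = (\<Sum>y\<in>#proots p. 1 / (z - y))"
    unfolding q_def by (rule log_deriv_prod_mset) (use assms p0 in auto)
  finally show ?thesis .
qed

section \<open>Distance from a point to the nearest zero\<close>

lemma norm_sum_mset_le:
  fixes c :: real and g :: "'a \<Rightarrow> complex"
  assumes "\<And>y. y \<in># M \<Longrightarrow> norm (g y) \<le> c"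
  shows "norm (\<Sum>y\<in>#M. g y) \<le> size M * c"
  using assms
proof (induction M)
  case (add x M)
  have "norm (\<Sum>y\<in>#add_mset x M. g y) \<le> norm (g x) + norm (\<Sum>y\<in>#M. g y)"
    by (simp add: norm_triangle_ineq)
  also have "\<dots> \<le> c + size M * c" using add by (intro add_mono) auto
  finally show ?case by (simp add: algebra_simps)
qed simp

text \<open>If \<open>y\<close> is the zero nearest to \<open>z\<close>, each of the
  \<open>degree p\<close> terms \<open>1 / (z - x)\<close> of the logarithmic derivative has modulus
  at most \<open>1 / cmod (z - y)\<close>. The bound is linear in \<open>cmod (poly p z)\<close>,
  which pays off when the derivative is under control.\<close>

lemma root_near_newton:
  fixes p :: "complex poly"
  assumes "degree p > 0"
  shows "\<exists>y. poly p y = 0 \<and> cmod (z - y) * cmod (poly (pderiv p) z) \<le> degree p * cmod (poly p z)"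
proof (cases "poly p z = 0")
  case True
  then show ?thesis by (intro exI[of _ z]) auto
next
  case False
  have p0: "p \<noteq> 0" using assms by auto
  let ?S = "{y. poly p y = 0}"
  have fin: "finite ?S" using p0 poly_roots_finite by blast
  have ne: "?S \<noteq> {}" using assms
    by (metis (mono_tags) constant_degree empty_Collect_eq fundamental_theorem_of_algebra gr_implies_not0)
  obtain y where y: "y \<in> ?S" "\<forall>x\<in>?S. cmod (z - y) \<le> cmod (z - x)"
    using ex_min_if_finite[of "(\<lambda>x. cmod (z - x)) ` ?S"] fin ne by (auto simp: not_less)
  have pos: "cmod (z - y) > 0" using False y(1) by auto
  have "cmod (poly (pderiv p) z / poly p z) \<le> size (proots p) * (1 / cmod (z - y))"
    unfolding log_deriv_poly[OF False]
  proof (rule norm_sum_mset_le)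
    fix x assume "x \<in># proots p"
    then have "x \<in> ?S" using p0 by auto
    then have "cmod (z - y) \<le> cmod (z - x)" using y by blast
    then show "cmod (1 / (z - x)) \<le> 1 / cmod (z - y)"
      using pos by (simp add: norm_divide frac_le)
  qed
  then have "cmod (z - y) * cmod (poly (pderiv p) z) \<le> degree p * cmod (poly p z)"
    using pos False by (simp add: size_proots_complex norm_divide field_simps)
  then show ?thesis using y(1) by auto
qed

lemma prod_mset_lower_bound:
  fixes M :: "complex multiset"
  assumes "\<And>y. y \<in># M \<Longrightarrow> r \<le> cmod (z - y)" "0 \<le> r"
  shows "r ^ size M \<le> cmod (\<Prod>y\<in>#M. z - y)"
  using assms
proof (induction M)
  case (add x M)
  have "r * r ^ size M \<le> cmod (z - x) * cmod (\<Prod>y\<in>#M. z - y)"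
    using add by (intro mult_mono) auto
  then show ?case by (simp add: norm_mult)
qed simp

lemma near_mset_element:
  fixes M :: "complex multiset"
  assumes "M \<noteq> {#}"
  shows "\<exists>y\<in>#M. cmod (z - y) ^ size M \<le> cmod (\<Prod>y\<in>#M. z - y)"
proof -
  obtain y where y: "y \<in># M" "\<forall>x\<in>#M. cmod (z - y) \<le> cmod (z - x)"
    using ex_min_if_finite[of "(\<lambda>x. cmod (z - x)) ` set_mset M"] assms by (auto simp: not_less)
  then show ?thesis by (intro bexI[of _ y] prod_mset_lower_bound) auto
qed

text \<open>The distance to the nearest zero is at most the geometric mean of all distances. This
  serves where no lower bound for the derivative is at hand; the price is a root of order
  \<open>degree p\<close>.\<close>

lemma root_near_power:
  fixes p :: "complex poly"
  assumes "degree p > 0"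
  shows "\<exists>y. poly p y = 0 \<and> cmod (lead_coeff p) * cmod (z - y) ^ degree p \<le> cmod (poly p z)"
proof -
  have p0: "p \<noteq> 0" using assms by auto
  have "size (proots p) > 0" using assms by (simp add: size_proots_complex)
  then have "proots p \<noteq> {#}" by auto
  then obtain y where "y \<in># proots p"
    "cmod (z - y) ^ size (proots p) \<le> cmod (\<Prod>y\<in>#proots p. z - y)"
    using near_mset_element by blast
  then show ?thesis using p0 poly_eq_prod_proots[of p z]
    by (intro exI[of _ y]) (auto simp: size_proots_complex norm_mult mult_left_mono)
qed

section \<open>Critical points and the spread of fibres\<close>

lemma sum_mset_Re: "Re (\<Sum>y\<in>#M. g y) = (\<Sum>y\<in>#M. Re (g y))"
  by (induction M) auto

lemma sum_mset_pos:
  assumes "M \<noteq> {#}" "\<And>y. y \<in># M \<Longrightarrow> (g y :: real) > 0"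
  shows "(\<Sum>y\<in>#M. g y) > 0"
  using assms
proof (induction M)
  case (add x M)
  then show ?case by (cases "M = {#}") (auto intro: add_pos_pos)
qed simp

text \<open>Gauss-Lucas for discs. If \<open>c\<close> lay outside a disc containing all zeros,
  every \<open>1 / (c - y)\<close> times \<open>c - z\<close> would have positive real part, so the
  logarithmic derivative could not vanish at \<open>c\<close>.\<close>

lemma gauss_lucas_disc:
  fixes p :: "complex poly"
  assumes "degree p > 0" "poly (pderiv p) c = 0" "\<And>y. poly p y = 0 \<Longrightarrow> cmod (z - y) < r"
  shows "cmod (z - c) < r"
proof (rule ccontr)
  assume "\<not> cmod (z - c) < r"
  then have far: "r \<le> cmod (z - c)" by simp
  have p0: "p \<noteq> 0" using assms by auto
  have pc: "poly p c \<noteq> 0" using assms(3) far by force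
  have ne: "proots p \<noteq> {#}" using assms(1) size_proots_complex[of p] by auto
  have "0 = (\<Sum>y\<in>#proots p. 1 / (c - y))"
    using log_deriv_poly[OF pc] assms(2) by simp
  then have "0 = (\<Sum>y\<in>#proots p. (c - z) * (1 / (c - y)))"
    by (metis mult_zero_right sum_mset_distrib_left)
  then have "0 = (\<Sum>y\<in>#proots p. Re ((c - z) * (1 / (c - y))))"
    by (metis sum_mset_Re zero_complex.sel(1))
  moreover have "(\<Sum>y\<in>#proots p. Re ((c - z) * (1 / (c - y)))) > 0"
  proof (rule sum_mset_pos[OF ne])
    fix y assume "y \<in># proots p"
    then have y: "poly p y = 0" using p0 by auto
    then have "cmod (z - y) < cmod (c - z)" using assms(3) far by (force simp: norm_minus_commute)
    moreover have "c \<noteq> y" using y pc by auto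
    moreover define u where "u = c - y"
    moreover define v where "v = z - y"
    ultimately have uv: "cmod v < cmod (u - v)" "u \<noteq> 0" by (auto simp: algebra_simps)
    \<comment> \<open>Expanding the squares shows that twice the inner product of \<open>u\<close>
      and \<open>v\<close> is less than \<open>|u|^2\<close>, which makes the real part of
      \<open>(u - v) / u\<close> positive.\<close>
    have "(cmod v)\<^sup>2 < (cmod (u - v))\<^sup>2" using uv(1) by (intro power_strict_mono) auto
    then have "2 * (Re u * Re v + Im u * Im v) < (Re u)\<^sup>2 + (Im u)\<^sup>2"
      by (simp add: cmod_power2 power2_diff algebra_simps)
    moreover have "0 < (Re u)\<^sup>2 + (Im u)\<^sup>2" using uv(2)
      by (metis complex_neq_0)
    ultimately have "0 < ((Re u - Re v) * Re u + (Im u - Im v) * Im u) / ((Re u)\<^sup>2 + (Im u)\<^sup>2)"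
      by (intro divide_pos_pos) (auto simp: algebra_simps power2_eq_square)
    moreover have "(c - z) * (1 / (c - y)) = (u - v) / u" by (simp add: u_def v_def)
    ultimately show "Re ((c - z) * (1 / (c - y))) > 0"
      by (simp add: Re_divide)
  qed
  ultimately show False by simp
qed

text \<open>If the derivative has two distinct zeros, every fibre spreads out, so near a fibre point at
  most \<open>degree p - 1\<close> of the factors of \<open>p - v\<close> can be small at once.\<close>

lemma root_near_two_critical_points:
  fixes p :: "complex poly"
  assumes deg: "degree p > 1" and c: "poly (pderiv p) c1 = 0" "poly (pderiv p) c2 = 0" "c1 \<noteq> c2"
  obtains C where "C > 0"
    "\<And>v z. \<exists>y. poly p y = v \<and> cmod (z - y) ^ (degree p - 1) \<le> C * cmod (poly p z - v)"
proof -
  define r where "r = cmod (c1 - c2) / 2"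
  define A where "A = cmod (lead_coeff p)"
  have p0: "p \<noteq> 0" using deg by auto
  have r: "r > 0" using c(3) by (simp add: r_def)
  have A: "A > 0" using p0 by (simp add: A_def)
  have main: "\<exists>y. poly p y = v \<and> cmod (z - y) ^ (degree p - 1) \<le> (1 / (A * r)) * cmod (poly p z - v)" for v z
  proof -
    define q where "q = p - [:v:]"
    have dq: "degree q = degree p" "lead_coeff q = lead_coeff p" "pderiv q = pderiv p"
    proof -
      have "degree (-[:v:]) < degree p" using deg by simp
      then show d: "degree q = degree p"
        unfolding q_def diff_conv_add_uminus by (rule degree_add_eq_left)
      have "coeff [:v:] (degree p) = 0" using deg by (intro coeff_eq_0) simp
      then show "lead_coeff q = lead_coeff p" unfolding d by (simp add: q_def)
      show "pderiv q = pderiv p" unfolding q_def by (simp add: pderiv_diff pderiv_pCons)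
    qed
    have q0: "q \<noteq> 0" using dq deg by auto
    \<comment> \<open>Otherwise all zeros of \<open>q\<close> would lie within \<open>r\<close> of
      \<open>z\<close>, and by Gauss-Lucas so would \<open>c1\<close> and \<open>c2\<close>, which
      are \<open>2 r\<close> apart.\<close>
    have "\<exists>y. poly q y = 0 \<and> cmod (z - y) \<ge> r"
    proof (rule ccontr)
      assume "\<not> ?thesis"
      then have "\<And>y. poly q y = 0 \<Longrightarrow> cmod (z - y) < r" by force
      then have "cmod (z - c1) < r" "cmod (z - c2) < r"
        using gauss_lucas_disc[of q] dq deg c by auto
      moreover have "cmod (c1 - c2) \<le> cmod (z - c1) + cmod (z - c2)"
        by (metis norm_minus_commute norm_triangle_ineq diff_add_eq diff_add_cancel add.commute add_diff_eq)
      ultimately show False by (simp add: r_def)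
    qed
    then obtain y0 where y0: "poly q y0 = 0" "cmod (z - y0) \<ge> r" by blast
    \<comment> \<open>The far factor \<open>z - y0\<close> has modulus at least \<open>r\<close> and
      is split off; the nearest of the remaining \<open>degree p - 1\<close> zeros then satisfies
      the bound with the smaller exponent.\<close>
    then obtain M where M: "proots q = add_mset y0 M"
      using q0 by (metis mem_Collect_eq multi_member_split set_count_proots)
    have "size (proots q) = degree p" by (simp add: size_proots_complex dq)
    then have sM: "size M = degree p - 1" using M by simp
    then have "M \<noteq> {#}" using deg by auto
    then obtain y where y: "y \<in># M" "cmod (z - y) ^ size M \<le> cmod (\<Prod>y\<in>#M. z - y)"
      using near_mset_element by blast
    have "y \<in># proots q" using y M by simp
    then have "poly q y = 0" using q0 by simp
    then have yv: "poly p y = v" by (simp add: q_def)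
    have "cmod (poly q z) = A * (cmod (z - y0) * cmod (\<Prod>y\<in>#M. z - y))"
    proof -
      have "poly q z = lead_coeff p * ((z - y0) * (\<Prod>y\<in>#M. z - y))"
        using poly_eq_prod_proots[of q z] by (simp only: dq(2) M image_mset_add_mset prod_mset.add_mset)
      then show ?thesis by (simp add: A_def norm_mult)
    qed
    also have "\<dots> \<ge> A * (r * cmod (z - y) ^ size M)"
      using y y0 A r by (intro mult_left_mono mult_mono) auto
    finally have "A * r * cmod (z - y) ^ (degree p - 1) \<le> cmod (poly p z - v)"
      by (simp add: q_def sM mult_ac)
    then show ?thesis using yv A r by (intro exI[of _ y]) (auto simp: field_simps)
  qed
  show thesis by (rule that[of "1 / (A * r)"]) (use A r main in auto)
qed

section \<open>The negative part of the logarithm\<close>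

text \<open>As \<open>ln 0 = 0\<close> in the library, \<open>ln_minus 0 = 0\<close>; this affects null sets only.\<close>

definition ln_minus :: "complex \<Rightarrow> real" where "ln_minus x = max 0 (- ln (cmod x))"

definition ln_plus :: "complex \<Rightarrow> real" where "ln_plus x = max 0 (ln (cmod x))"

lemma ln_minus_nonneg [simp]: "0 \<le> ln_minus x" by (simp add: ln_minus_def)
lemma ln_plus_nonneg [simp]: "0 \<le> ln_plus x" by (simp add: ln_plus_def)

lemma ln_cmod_eq: "ln (cmod x) = ln_plus x - ln_minus x"
  by (simp add: ln_minus_def ln_plus_def)

lemma ln_minus_measurable [measurable]: "ln_minus \<in> borel_measurable borel"
  unfolding ln_minus_def by measurable

lemma ln_plus_measurable [measurable]: "ln_plus \<in> borel_measurable borel"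
  unfolding ln_plus_def by measurable

lemma emeasure_cball_complex:
  "r \<ge> 0 \<Longrightarrow> emeasure lborel (cball (c::complex) r) = ennreal (pi * r\<^sup>2)"
  by (simp add: emeasure_cball unit_ball_vol_2)

text \<open>Layer cake: the discs of radius \<open>exp (- (k + j))\<close> that contain
  \<open>x\<close> are at least as many as the excess rounded up.\<close>

lemma ln_minus_excess_le_layers:
  "ennreal (max 0 (ln_minus x - real k)) \<le> (\<Sum>j. indicator (cball 0 (exp (- real (k + j)))) x)"
proof (cases "ln_minus x \<le> real k")
  case False
  define n where "n = nat \<lceil>ln_minus x - real k\<rceil>"
  have n: "ln_minus x - real k \<le> real n" "real n < ln_minus x - real k + 1"
    using False unfolding n_def by linarith+
  have x0: "x \<noteq> 0" using False by (auto simp: ln_minus_def)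
  have "ln_minus x > 0" using False by linarith
  then have lm: "ln_minus x = - ln (cmod x)" by (auto simp: ln_minus_def)
  have ind: "indicator (cball 0 (exp (- real (k + j)))) x = (1::ennreal)" if "j < n" for j
  proof -
    have "real (j + 1) \<le> real n" using that by (intro of_nat_mono) simp
    then have "ln (cmod x) \<le> - real (k + j)" using n(2) lm by simp
    then have "cmod x \<le> exp (- real (k + j))" using x0 by (metis exp_ln exp_le_cancel_iff zero_less_norm_iff)
    then show ?thesis by (simp add: indicator_def)
  qed
  have "ennreal (max 0 (ln_minus x - real k)) \<le> of_nat n"
    using n(1) by (simp add: ennreal_of_nat_eq_real_of_nat ennreal_leI)
  also have "of_nat n = (\<Sum>j<n. indicator (cball 0 (exp (- real (k + j)))) x :: ennreal)"
    using ind by simp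
  also have "\<dots> \<le> (\<Sum>j. indicator (cball 0 (exp (- real (k + j)))) x)"
    by (rule sum_le_suminf) auto
  finally show ?thesis .
qed (simp add: max_absorb1)

text \<open>The areas of the layers form a geometric series with sum
  \<open>pi exp (- 2 k) / (1 - exp (- 2))\<close>; the constant 8 comes from \<open>pi < 4\<close>
  and \<open>exp (- 2) \<le> 1/2\<close>.\<close>

lemma nn_integral_ln_minus_excess:
  "(\<integral>\<^sup>+z. ennreal (max 0 (ln_minus (z - y) - real k)) \<partial>lborel) \<le> ennreal (8 * exp (- 2 * real k))"
proof -
  have "(\<integral>\<^sup>+z. ennreal (max 0 (ln_minus (z - y) - real k)) \<partial>lborel)
    \<le> (\<integral>\<^sup>+z. (\<Sum>j. indicator (cball y (exp (- real (k + j)))) z) \<partial>lborel)"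
  proof (rule nn_integral_mono)
    fix z
    have "indicator (cball 0 (exp (- real (k + j)))) (z - y)
      = (indicator (cball y (exp (- real (k + j)))) z :: ennreal)" for j
      by (auto simp: indicator_def dist_norm norm_minus_commute)
    then show "ennreal (max 0 (ln_minus (z - y) - real k))
      \<le> (\<Sum>j. indicator (cball y (exp (- real (k + j)))) z)"
      using ln_minus_excess_le_layers[of "z - y" k] by simp
  qed
  also have "\<dots> = (\<Sum>j. emeasure lborel (cball y (exp (- real (k + j)))))"
    by (subst nn_integral_suminf) (auto intro!: borel_measurable_indicator)
  also have "\<dots> = (\<Sum>j. ennreal (pi * exp (- 2 * real k) * (exp (-2)) ^ j))"
    by (intro suminf_cong)
       (simp add: emeasure_cball_complex power2_eq_square exp_of_nat_mult[symmetric] mult.assoc flip: exp_add exp_of_nat_mult)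
  also have "\<dots> = ennreal (\<Sum>j. pi * exp (- 2 * real k) * (exp (-2)) ^ j)"
    by (rule suminf_ennreal2) (auto intro!: summable_mult summable_geometric)
  also have "(\<Sum>j. pi * exp (- 2 * real k) * (exp (-2)) ^ j) = pi * exp (- 2 * real k) * (1 / (1 - exp (-2)))"
    by (subst suminf_mult) (auto intro!: summable_geometric simp: suminf_geometric)
  also have "\<dots> \<le> 8 * exp (- 2 * real k)"
  proof -
    have "exp (-2::real) \<le> 1/2"
      using exp_ge_add_one_self[of "2::real"] by (simp add: exp_minus field_simps)
    then have "1 / (1 - exp (-2)) \<le> (2::real)" by (simp add: field_simps)
    then have "pi * (1 / (1 - exp (-2))) \<le> 4 * 2"
      using pi_less_4 by (intro mult_mono) auto
    then have "pi * (1 / (1 - exp (-2))) * exp (- 2 * real k) \<le> 8 * exp (- 2 * real k)"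
      by (intro mult_right_mono) auto
    then show ?thesis by (simp only: mult_ac)
  qed
  finally show ?thesis by (simp add: ennreal_leI)
qed

text \<open>Truncation at height \<open>k\<close> costs \<open>k\<close> times the area of
  \<open>S\<close>, and the part above \<open>k\<close> is small uniformly in \<open>y\<close>. The
  height is free: it is taken large when \<open>S\<close> is tiny, and \<open>k = 0\<close> with
  \<open>S = UNIV\<close> gives finiteness of the full integral.\<close>

lemma nn_integral_ln_minus_set:
  assumes [measurable]: "S \<in> sets lborel"
  shows "(\<integral>\<^sup>+z. ennreal (ln_minus (z - y)) * indicator S z \<partial>lborel)
    \<le> ennreal (real k) * emeasure lborel S + ennreal (8 * exp (- 2 * real k))"
proof -
  have "(\<integral>\<^sup>+z. ennreal (ln_minus (z - y)) * indicator S z \<partial>lborel)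
    \<le> (\<integral>\<^sup>+z. ennreal (real k) * indicator S z + ennreal (max 0 (ln_minus (z - y) - real k)) \<partial>lborel)"
  proof (rule nn_integral_mono)
    fix z
    have "ennreal (ln_minus (z - y)) \<le> ennreal (real k + max 0 (ln_minus (z - y) - real k))"
      by (intro ennreal_leI) simp
    also have "\<dots> = ennreal (real k) + ennreal (max 0 (ln_minus (z - y) - real k))"
      by (rule ennreal_plus) auto
    finally show "ennreal (ln_minus (z - y)) * indicator S z
      \<le> ennreal (real k) * indicator S z + ennreal (max 0 (ln_minus (z - y) - real k))"
      by (simp add: indicator_def)
  qed
  also have "\<dots> = ennreal (real k) * emeasure lborel S + (\<integral>\<^sup>+z. ennreal (max 0 (ln_minus (z - y) - real k)) \<partial>lborel)"
    by (subst nn_integral_add) (simp_all add: nn_integral_cmult_indicator[OF assms])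
  also have "\<dots> \<le> ennreal (real k) * emeasure lborel S + ennreal (8 * exp (- 2 * real k))"
    by (intro add_left_mono nn_integral_ln_minus_excess)
  finally show ?thesis .
qed

section \<open>A regularised logarithm\<close>

text \<open>
  The four-point difference of \<open>log \<surd>(|x|\<^sup>2 + 1)\<close> is positive and integrable, so its rescalings form an
  approximate identity. Moving the difference onto the test function turns this into an elementary
  substitute for \<open>\<Delta> log |x| = 2 \<pi> \<delta>\<^sub>0\<close>; the value of the mass is never needed.
\<close>

definition four_point_diff :: "real \<Rightarrow> (complex \<Rightarrow> real) \<Rightarrow> complex \<Rightarrow> real" where
  "four_point_diff e g z =
     (g (z + of_real e) + g (z - of_real e) + g (z + \<i> * of_real e) + g (z - \<i> * of_real e)) / 4 - g z"

definition reg_ln :: "real \<Rightarrow> complex \<Rightarrow> real" where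
  "reg_ln e x = ln ((cmod x)\<^sup>2 + e\<^sup>2) / 2"

definition reg_kernel :: "complex \<Rightarrow> real" where
  "reg_kernel = four_point_diff 1 (reg_ln 1)"

text \<open>The additive constant \<open>ln e\<close> disappears in four-point differences, so that
  all scales share one kernel.\<close>

lemma reg_ln_scale:
  assumes "e > 0" shows "reg_ln e (of_real e * x) = ln e + reg_ln 1 x"
proof -
  have "(cmod (of_real e * x))\<^sup>2 + e\<^sup>2 = e\<^sup>2 * ((cmod x)\<^sup>2 + 1)"
    using assms by (simp add: norm_mult power_mult_distrib algebra_simps)
  moreover have "(cmod x)\<^sup>2 + 1 > 0" by (simp add: add_nonneg_pos)
  ultimately show ?thesis using assms by (simp add: reg_ln_def ln_mult ln_realpow)
qed

lemma four_point_diff_reg_ln_scale: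
  assumes "e > 0" shows "four_point_diff e (reg_ln e) (of_real e * x) = reg_kernel x"
proof -
  have "of_real e * x + of_real e = of_real e * (x + 1)" "of_real e * x - of_real e = of_real e * (x - 1)"
    "of_real e * x + \<i> * of_real e = of_real e * (x + \<i>)" "of_real e * x - \<i> * of_real e = of_real e * (x - \<i>)"
    by (auto simp: algebra_simps)
  then have "four_point_diff e (reg_ln e) (of_real e * x) = ((ln e + reg_ln 1 (x + 1)) + (ln e + reg_ln 1 (x - 1))
      + (ln e + reg_ln 1 (x + \<i>)) + (ln e + reg_ln 1 (x - \<i>))) / 4 - (ln e + reg_ln 1 x)"
    unfolding four_point_diff_def by (simp only: reg_ln_scale[OF assms])
  also have "\<dots> = reg_kernel x" unfolding reg_kernel_def four_point_diff_def by (simp add: add_divide_distrib)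
  finally show ?thesis .
qed

text \<open>With \<open>a\<close> and \<open>b\<close> the real and imaginary parts, the four
  shifted arguments multiply to \<open>(s^2 - 4 a^2) (s^2 - 4 b^2)\<close>. Since
  \<open>a^2 + b^2 = s - 2\<close>, the terms in \<open>s^4\<close> and \<open>s^3\<close> agree
  with those of \<open>(s - 1)^4\<close>, and the quotient displays both the sign and the decay of
  the kernel.\<close>

lemma reg_kernel_eq:
  fixes x :: complex
  defines "s \<equiv> (cmod x)\<^sup>2 + 2"
  shows "reg_kernel x = ln (1 + (2 * s\<^sup>2 + 4 * s - 1 + 16 * (Re x)\<^sup>2 * (Im x)\<^sup>2) / (s - 1) ^ 4) / 8"
proof -
  define a b where "a = Re x" and "b = Im x"
  have s: "s = a\<^sup>2 + b\<^sup>2 + 2" by (simp add: s_def a_def b_def cmod_power2)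
  have n: "(cmod (x + 1))\<^sup>2 + 1 = s + 2 * a" "(cmod (x - 1))\<^sup>2 + 1 = s - 2 * a"
    "(cmod (x + \<i>))\<^sup>2 + 1 = s + 2 * b" "(cmod (x - \<i>))\<^sup>2 + 1 = s - 2 * b"
    by (simp_all add: s a_def b_def cmod_power2 power2_sum power2_diff)
  have pos: "s + 2 * a > 0" "s - 2 * a > 0" "s + 2 * b > 0" "s - 2 * b > 0" "s - 1 > 0"
  proof -
    have eqs: "s + 2 * a = (a + 1)\<^sup>2 + b\<^sup>2 + 1" "s - 2 * a = (a - 1)\<^sup>2 + b\<^sup>2 + 1"
      "s + 2 * b = a\<^sup>2 + (b + 1)\<^sup>2 + 1" "s - 2 * b = a\<^sup>2 + (b - 1)\<^sup>2 + 1" "s - 1 = a\<^sup>2 + b\<^sup>2 + 1"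
      unfolding s by (simp_all add: power2_sum power2_diff)
    show "s + 2 * a > 0" "s - 2 * a > 0" "s + 2 * b > 0" "s - 2 * b > 0" "s - 1 > 0"
      unfolding eqs by (auto intro!: add_nonneg_pos)
  qed
  have "reg_kernel x = (ln (s + 2 * a) + ln (s - 2 * a) + ln (s + 2 * b) + ln (s - 2 * b)) / 8 - ln (s - 1) / 2"
  proof -
    have "(cmod x)\<^sup>2 + 1 = s - 1" by (simp add: s_def)
    then show ?thesis unfolding reg_kernel_def four_point_diff_def reg_ln_def power_one using n
      by (simp only:) (simp add: add_divide_distrib)
  qed
  also have "\<dots> = ln ((s + 2 * a) * (s - 2 * a) * (s + 2 * b) * (s - 2 * b) / (s - 1) ^ 4) / 8"
    using pos by (simp add: ln_mult ln_div ln_realpow)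
  also have "(s + 2 * a) * (s - 2 * a) * (s + 2 * b) * (s - 2 * b)
      = (s - 1) ^ 4 + (2 * s\<^sup>2 + 4 * s - 1 + 16 * a\<^sup>2 * b\<^sup>2)"
    unfolding s by algebra
  also have "\<dots> / (s - 1) ^ 4 = 1 + (2 * s\<^sup>2 + 4 * s - 1 + 16 * a\<^sup>2 * b\<^sup>2) / (s - 1) ^ 4"
    using pos(5) by (simp add: add_divide_distrib)
  finally show ?thesis by (simp add: a_def b_def)
qed

lemma reg_kernel_pos: "reg_kernel x > 0"
proof -
  define s where "s = (cmod x)\<^sup>2 + 2"
  have s: "s \<ge> 2" by (simp add: s_def)
  have "0 \<le> 16 * (Re x)\<^sup>2 * (Im x)\<^sup>2" "0 \<le> 2 * s\<^sup>2" by simp_all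
  then have "0 < 2 * s\<^sup>2 + 4 * s - 1 + 16 * (Re x)\<^sup>2 * (Im x)\<^sup>2" using s by linarith
  then have "0 < (2 * s\<^sup>2 + 4 * s - 1 + 16 * (Re x)\<^sup>2 * (Im x)\<^sup>2) / (s - 1) ^ 4"
    using s by (intro divide_pos_pos) auto
  then show ?thesis unfolding reg_kernel_eq s_def[symmetric] by (simp add: ln_gt_zero)
qed

lemma reg_kernel_le: "reg_kernel x \<le> 4 / (1 + (cmod x)\<^sup>2)\<^sup>2"
proof -
  define s where "s = (cmod x)\<^sup>2 + 2"
  have s: "s \<ge> 2" by (simp add: s_def)
  define t where "t = (2 * s\<^sup>2 + 4 * s - 1 + 16 * (Re x)\<^sup>2 * (Im x)\<^sup>2) / (s - 1) ^ 4"
  have "0 \<le> 16 * (Re x)\<^sup>2 * (Im x)\<^sup>2" "0 \<le> 2 * s\<^sup>2" by simp_all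
  then have "0 < 2 * s\<^sup>2 + 4 * s - 1 + 16 * (Re x)\<^sup>2 * (Im x)\<^sup>2" using s by linarith
  then have t0: "t > 0" using s unfolding t_def by simp
  have sx: "s = (Re x)\<^sup>2 + (Im x)\<^sup>2 + 2" by (simp add: s_def cmod_power2)
  have "((Re x)\<^sup>2 + (Im x)\<^sup>2)\<^sup>2 - 4 * (Re x)\<^sup>2 * (Im x)\<^sup>2 = ((Re x)\<^sup>2 - (Im x)\<^sup>2)\<^sup>2" by algebra
  then have "4 * (Re x)\<^sup>2 * (Im x)\<^sup>2 \<le> ((Re x)\<^sup>2 + (Im x)\<^sup>2)\<^sup>2"
    by (metis diff_ge_0_iff_ge zero_le_power2)
  also have "\<dots> \<le> s\<^sup>2" unfolding sx by (intro power_mono) auto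
  finally have "2 * s\<^sup>2 + 4 * s - 1 + 16 * (Re x)\<^sup>2 * (Im x)\<^sup>2 \<le> 6 * s\<^sup>2 + 4 * s" by simp
  \<comment> \<open>From \<open>s \<ge> 2\<close> come \<open>4 s \<le> 2 s^2\<close> and
    \<open>s \<le> 2 (s - 1)\<close>, hence the bound \<open>8 s^2 \<le> 32 (s - 1)^2\<close>. The
    prefactor \<open>1/8\<close> of the logarithm later turns 32 into the 4 of the
    statement.\<close>
  also have "\<dots> \<le> 32 * (s - 1)\<^sup>2"
  proof -
    have "s \<le> 2 * (s - 1)" using s by simp
    then have "s\<^sup>2 \<le> (2 * (s - 1))\<^sup>2" using s by (intro power_mono) auto
    moreover have "2 * s \<le> s\<^sup>2" using s by (simp add: power2_eq_square)
    ultimately have "6 * s\<^sup>2 + 4 * s \<le> 8 * (2 * (s - 1))\<^sup>2" by linarith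
    then show ?thesis by (simp only: power_mult_distrib) simp
  qed
  finally have "t \<le> 32 * (s - 1)\<^sup>2 / (s - 1) ^ 4" unfolding t_def using s by (intro divide_right_mono) auto
  also have "\<dots> = 32 / (s - 1)\<^sup>2"
  proof -
    define u where "u = s - 1"
    have "u > 0" using s by (simp add: u_def)
    then show ?thesis unfolding u_def[symmetric] by (simp add: field_simps flip: power_add)
  qed
  finally have t: "t \<le> 32 / (s - 1)\<^sup>2" .
  have "reg_kernel x = ln (1 + t) / 8" unfolding reg_kernel_eq t_def s_def ..
  also have "\<dots> \<le> t / 8" using t0 by (intro divide_right_mono ln_add_one_self_le_self) auto
  also have "\<dots> \<le> 4 / (s - 1)\<^sup>2" using t by simp
  finally show ?thesis by (simp add: s_def add.commute)
qed

text \<open>Only the term with the least \<open>k\<close> such that \<open>cmod x \<le> 2^k\<close>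
  is used: there the left side is at most \<open>16 / 16^k\<close>. The discs have area of order
  \<open>4^k\<close>, so the layers have a finite total integral.\<close>

lemma inverse_quartic_le_layers:
  "ennreal (1 / (1 + (cmod x)\<^sup>2)\<^sup>2) \<le> (\<Sum>k. ennreal (16 * (1/16) ^ k) * indicator (cball 0 (2 ^ k)) x)"
proof -
  define k where "k = (LEAST k. cmod x \<le> 2 ^ k)"
  have ex: "\<exists>k. cmod x \<le> 2 ^ k" using real_arch_pow[of 2 "cmod x"] less_imp_le by auto
  have k: "cmod x \<le> 2 ^ k" unfolding k_def by (rule LeastI_ex[OF ex])
  have "1 / (1 + (cmod x)\<^sup>2)\<^sup>2 \<le> 16 * (1/16) ^ k"
  proof (cases k)
    case 0
    have "1 \<le> (1 + (cmod x)\<^sup>2)\<^sup>2" by simp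
    then have "1 / (1 + (cmod x)\<^sup>2)\<^sup>2 \<le> 1" unfolding divide_le_eq_1 by linarith
    then show ?thesis using 0 by simp
  next
    case (Suc m)
    have "\<not> cmod x \<le> 2 ^ m" using not_less_Least[of m "\<lambda>k. cmod x \<le> 2 ^ k"] Suc k_def by simp
    then have "(2 ^ m)\<^sup>2 \<le> (cmod x)\<^sup>2" by (intro power_mono) auto
    then have "(2 ^ m)\<^sup>2 \<le> 1 + (cmod x)\<^sup>2" by linarith
    then have "((2 ^ m)\<^sup>2)\<^sup>2 \<le> (1 + (cmod x)\<^sup>2)\<^sup>2" by (rule power_mono) auto
    moreover have "((2 ^ m)\<^sup>2)\<^sup>2 = (16::real) ^ m"
      by (simp add: power_mult[symmetric] mult.commute[of m]) (simp add: power_mult)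
    ultimately have "16 ^ m \<le> (1 + (cmod x)\<^sup>2)\<^sup>2" by simp
    moreover have "(1 + (cmod x)\<^sup>2)\<^sup>2 > 0" using \<open>16 ^ m \<le> (1 + (cmod x)\<^sup>2)\<^sup>2\<close>
      by (rule order_less_le_trans[rotated]) simp
    ultimately have "1 / (1 + (cmod x)\<^sup>2)\<^sup>2 \<le> 1 / 16 ^ m" by (intro divide_left_mono) auto
    then show ?thesis using Suc by (simp add: power_one_over)
  qed
  then have "ennreal (1 / (1 + (cmod x)\<^sup>2)\<^sup>2) \<le> ennreal (16 * (1/16) ^ k) * indicator (cball 0 (2 ^ k)) x"
    using k by (simp add: indicator_def ennreal_leI)
  also have "\<dots> = (\<Sum>i\<in>{k}. ennreal (16 * (1/16) ^ i) * indicator (cball 0 (2 ^ i)) x)"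
    by (simp only: sum.insert sum.empty finite.emptyI empty_iff not_False_eq_True add_0_right)
  also have "\<dots> \<le> (\<Sum>i. ennreal (16 * (1/16) ^ i) * indicator (cball 0 (2 ^ i)) x)"
    by (rule sum_le_suminf) auto
  finally show ?thesis .
qed

lemma nn_integral_inverse_quartic:
  "(\<integral>\<^sup>+x. ennreal (1 / (1 + (cmod x)\<^sup>2)\<^sup>2) \<partial>lborel) < \<infinity>"
proof -
  have "(\<integral>\<^sup>+x. ennreal (1 / (1 + (cmod x)\<^sup>2)\<^sup>2) \<partial>lborel)
    \<le> (\<integral>\<^sup>+x. (\<Sum>k. ennreal (16 * (1/16) ^ k) * indicator (cball 0 (2 ^ k)) (x::complex)) \<partial>lborel)"
    by (intro nn_integral_mono inverse_quartic_le_layers)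
  also have "\<dots> = (\<Sum>k. \<integral>\<^sup>+x. ennreal (16 * (1/16) ^ k) * indicator (cball 0 (2 ^ k)) (x::complex) \<partial>lborel)"
    by (rule nn_integral_suminf) (auto intro!: borel_measurable_times_ennreal borel_measurable_indicator)
  also have "\<dots> = (\<Sum>k. ennreal (16 * pi * (1/4) ^ k))"
  proof (rule suminf_cong)
    fix k
    have "(\<integral>\<^sup>+x. ennreal (16 * (1/16) ^ k) * indicator (cball 0 (2 ^ k)) (x::complex) \<partial>lborel)
      = ennreal (16 * (1/16) ^ k) * emeasure lborel (cball (0::complex) (2 ^ k))"
      by (rule nn_integral_cmult_indicator) auto
    also have "\<dots> = ennreal (16 * (1/16) ^ k * (pi * (2 ^ k)\<^sup>2))"
      by (simp add: emeasure_cball unit_ball_vol_2 ennreal_mult)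
    also have "16 * (1/16) ^ k * (pi * (2 ^ k)\<^sup>2) = 16 * pi * ((1/16) ^ k * 4 ^ k)"
      by (simp add: power_mult[symmetric] mult.commute[of k]) (simp add: power_mult)
    also have "(1/16) ^ k * 4 ^ k = (1/4::real) ^ k" by (simp add: power_mult_distrib[symmetric])
    finally show "(\<integral>\<^sup>+x. ennreal (16 * (1/16) ^ k) * indicator (cball 0 (2 ^ k)) (x::complex) \<partial>lborel)
      = ennreal (16 * pi * (1/4) ^ k)" .
  qed
  also have "\<dots> = ennreal (\<Sum>k. 16 * pi * (1/4) ^ k)"
    by (rule suminf_ennreal2) (auto intro!: summable_mult summable_geometric)
  also have "\<dots> < \<infinity>" by simp
  finally show ?thesis .
qed

lemma reg_ln_continuous [continuous_intros]:
  assumes "e \<noteq> 0" "continuous_on S f" shows "continuous_on S (\<lambda>z. reg_ln e (f z))"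
proof -
  have "(cmod x)\<^sup>2 + e\<^sup>2 \<noteq> 0" for x using assms(1)
    by (metis add_nonneg_eq_0_iff power_eq_0_iff zero_le_power2 pos2)
  then show ?thesis unfolding reg_ln_def using assms(2) by (auto intro!: continuous_intros)
qed

lemma reg_kernel_measurable [measurable]: "reg_kernel \<in> borel_measurable borel"
proof -
  have "continuous_on UNIV reg_kernel"
    unfolding reg_kernel_def four_point_diff_def by (auto intro!: continuous_intros)
  then show ?thesis by (rule borel_measurable_continuous_onI)
qed

lemma reg_kernel_integrable: "integrable lborel reg_kernel"
proof (rule integrableI_bounded)
  have "(\<integral>\<^sup>+x. ennreal (norm (reg_kernel x)) \<partial>lborel) \<le> (\<integral>\<^sup>+x. ennreal 4 * ennreal (1 / (1 + (cmod x)\<^sup>2)\<^sup>2) \<partial>lborel)"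
  proof (rule nn_integral_mono)
    fix x
    have "ennreal (norm (reg_kernel x)) \<le> ennreal (4 * (1 / (1 + (cmod x)\<^sup>2)\<^sup>2))"
      using reg_kernel_pos[of x] reg_kernel_le[of x] by (intro ennreal_leI) simp
    then show "ennreal (norm (reg_kernel x)) \<le> ennreal 4 * ennreal (1 / (1 + (cmod x)\<^sup>2)\<^sup>2)"
      by (subst (asm) ennreal_mult) auto
  qed
  also have "\<dots> = ennreal 4 * (\<integral>\<^sup>+x. ennreal (1 / (1 + (cmod x)\<^sup>2)\<^sup>2) \<partial>lborel)"
    by (rule nn_integral_cmult) auto
  also have "\<dots> < \<infinity>" using nn_integral_inverse_quartic by (simp add: ennreal_mult_less_top)
  finally show "(\<integral>\<^sup>+x. ennreal (norm (reg_kernel x)) \<partial>lborel) < \<infinity>" .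
qed simp

definition reg_mass :: real where "reg_mass = (\<integral>x. reg_kernel x \<partial>lborel)"

lemma reg_mass_pos: "reg_mass > 0"
proof -
  have "reg_mass \<ge> 0" unfolding reg_mass_def using reg_kernel_pos by (intro integral_nonneg_AE) (auto simp: less_imp_le)
  moreover have "reg_mass \<noteq> 0"
  proof
    assume "reg_mass = 0"
    then have "AE x in lborel. reg_kernel x = 0"
      unfolding reg_mass_def using reg_kernel_integrable reg_kernel_pos
      by (subst (asm) integral_nonneg_eq_0_iff_AE) (auto simp: less_imp_le)
    then have "AE x in (lborel :: complex measure). False"
      using reg_kernel_pos by (auto elim!: eventually_mono simp: less_le)
    then have "emeasure (lborel :: complex measure) (space lborel) = 0"
      using AE_iff_measurable[of "space lborel" "lborel :: complex measure" "\<lambda>_. False"] by auto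
    then show False by (simp add: emeasure_lborel_UNIV)
  qed
  ultimately show ?thesis by simp
qed

section \<open>Comparison of potentials\<close>

lemma integral_lborel_translate:
  fixes F :: "complex \<Rightarrow> real"
  assumes [measurable]: "F \<in> borel_measurable borel"
  shows "(\<integral>z. F (h + z) \<partial>lborel) = (\<integral>z. F z \<partial>lborel)"
proof -
  have "(\<integral>z. F z \<partial>lborel) = (\<integral>z. F z \<partial>distr lborel borel ((+) h))"
    by (simp add: lborel_distr_plus)
  also have "\<dots> = (\<integral>z. F (h + z) \<partial>lborel)" by (rule integral_distr) auto
  finally show ?thesis ..
qed

lemma integral_lborel_affine:
  fixes F :: "complex \<Rightarrow> real"
  assumes [measurable]: "F \<in> borel_measurable borel" and "e > 0"
  shows "(\<integral>z. F z \<partial>lborel) = e\<^sup>2 * (\<integral>x. F (y + of_real e * x) \<partial>lborel)"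
proof -
  have "(\<integral>z. F z \<partial>lborel) = (\<integral>z. F z \<partial>density (distr lborel borel (\<lambda>x. y + e *\<^sub>R x)) (\<lambda>_. \<bar>e\<bar>^DIM(complex)))"
    using assms(2) lborel_affine[of e y] by simp
  also have "\<dots> = (\<integral>z. e\<^sup>2 *\<^sub>R F z \<partial>distr lborel borel (\<lambda>x. y + e *\<^sub>R x))"
    by (subst integral_density) auto
  also have "\<dots> = (\<integral>x. e\<^sup>2 *\<^sub>R F (y + e *\<^sub>R x) \<partial>lborel)"
    by (subst integral_distr) auto
  finally show ?thesis by (simp add: scaleR_conv_of_real)
qed

lemma integrable_continuous_compact_support:
  fixes F :: "complex \<Rightarrow> real"
  assumes "continuous_on UNIV F" "\<forall>z. cmod z > R \<longrightarrow> F z = 0"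
  shows "integrable lborel F"
proof -
  have "integrable lborel (\<lambda>x. indicator (cball 0 R) x *\<^sub>R F x)"
    using assms(1) by (intro borel_integrable_compact) (auto intro: continuous_on_subset)
  moreover have "(\<lambda>x. indicator (cball 0 R) x *\<^sub>R F x) = F"
    using assms(2) by (auto simp: indicator_def fun_eq_iff)
  ultimately show ?thesis by simp
qed

lemma four_point_diff_continuous:
  assumes "continuous_on UNIV g" shows "continuous_on UNIV (four_point_diff e g)"
  unfolding four_point_diff_def by (auto intro!: continuous_intros continuous_on_compose2[OF assms])

lemma four_point_diff_support:
  assumes "\<forall>z. cmod z > R \<longrightarrow> g z = 0" "0 \<le> e" "cmod z > R + e"
  shows "four_point_diff e g z = 0"
proof -
  have "cmod (z + h) > R" if "cmod h = e" for h
    using norm_diff_ineq[of z h] that assms(3) by linarith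
  from this[of "of_real e"] this[of "- of_real e"] this[of "\<i> * of_real e"] this[of "- \<i> * of_real e"]
  show ?thesis using assms by (simp add: four_point_diff_def norm_mult)
qed

text \<open>The set of the four shifts is closed under negation, so translation invariance moves the
  difference from one factor to the other. Compact support of \<open>g\<close> makes the integrals
  finite, so \<open>\<psi>\<close> may grow at infinity as the logarithm does.\<close>

lemma integral_four_point_diff_swap:
  fixes g \<psi> :: "complex \<Rightarrow> real"
  assumes g: "continuous_on UNIV g" "\<forall>z. cmod z > R \<longrightarrow> g z = 0" and \<psi>: "continuous_on UNIV \<psi>"
  shows "(\<integral>z. four_point_diff e g z * \<psi> (z - y) \<partial>lborel) = (\<integral>z. g z * four_point_diff e \<psi> (z - y) \<partial>lborel)"
proof -
  define I where "I h = (\<integral>z. g (h + z) * \<psi> (z - y) \<partial>lborel)" for h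
  have int1: "integrable lborel (\<lambda>z. g (h + z) * \<psi> (z - y))" for h
  proof (rule integrable_continuous_compact_support[where R = "R + cmod h"])
    show "continuous_on UNIV (\<lambda>z. g (h + z) * \<psi> (z - y))"
      by (intro continuous_intros continuous_on_compose2[OF g(1)] continuous_on_compose2[OF \<psi>]) auto
    have "cmod (h + z) > R" if "cmod z > R + cmod h" for z
      using norm_diff_ineq[of z h] that by (simp add: add.commute)
    then show "\<forall>z. cmod z > R + cmod h \<longrightarrow> g (h + z) * \<psi> (z - y) = 0" using g(2) by simp
  qed
  have int2: "integrable lborel (\<lambda>z. g z * \<psi> (z - y - h))" for h
  proof (rule integrable_continuous_compact_support[where R = R])
    show "continuous_on UNIV (\<lambda>z. g z * \<psi> (z - y - h))"
      by (intro continuous_intros continuous_on_compose2[OF g(1)] continuous_on_compose2[OF \<psi>]) auto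
  qed (use g(2) in auto)
  have I2: "(\<integral>z. g z * \<psi> (z - y - h) \<partial>lborel) = I h" for h
  proof -
    have meas: "(\<lambda>z. g z * \<psi> (z - y - h)) \<in> borel_measurable borel"
      by (intro borel_measurable_continuous_onI continuous_intros
          continuous_on_compose2[OF g(1)] continuous_on_compose2[OF \<psi>]) auto
    show ?thesis
      using integral_lborel_translate[OF meas, of h, symmetric]
      by (simp add: I_def diff_diff_add add.commute)
  qed
  have lin: "(\<integral>z. (F1 z + F2 z + F3 z + F4 z) / 4 - F5 z \<partial>lborel)
    = ((\<integral>z. F1 z \<partial>lborel) + (\<integral>z. F2 z \<partial>lborel) + (\<integral>z. F3 z \<partial>lborel) + (\<integral>z. F4 z \<partial>lborel)) / 4
      - (\<integral>z. F5 z \<partial>lborel)"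
    if "integrable lborel F1" "integrable lborel F2" "integrable lborel F3" "integrable lborel F4" "integrable lborel F5"
    for F1 F2 F3 F4 F5 :: "complex \<Rightarrow> real"
    using that by simp
  have "(\<integral>z. four_point_diff e g z * \<psi> (z - y) \<partial>lborel)
    = (\<integral>z. (g (of_real e + z) * \<psi> (z - y) + g (- of_real e + z) * \<psi> (z - y) + g (\<i> * of_real e + z) * \<psi> (z - y)
        + g (- (\<i> * of_real e) + z) * \<psi> (z - y)) / 4 - g (0 + z) * \<psi> (z - y) \<partial>lborel)"
    by (intro Bochner_Integration.integral_cong refl) (simp add: four_point_diff_def algebra_simps add_divide_distrib)
  also have "\<dots> = (I (of_real e) + I (- of_real e) + I (\<i> * of_real e) + I (- (\<i> * of_real e))) / 4 - I 0"
    unfolding I_def by (rule lin[OF int1 int1 int1 int1 int1])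
  also have "\<dots> = (I (- of_real e) + I (of_real e) + I (- (\<i> * of_real e)) + I (\<i> * of_real e)) / 4 - I 0" by simp
  also have "\<dots> = (\<integral>z. (g z * \<psi> (z - y - (- of_real e)) + g z * \<psi> (z - y - of_real e) + g z * \<psi> (z - y - (- (\<i> * of_real e)))
        + g z * \<psi> (z - y - \<i> * of_real e)) / 4 - g z * \<psi> (z - y - 0) \<partial>lborel)"
    unfolding I2[symmetric]
    by (rule lin[OF int2[of "- of_real e"] int2[of "of_real e"] int2[of "- (\<i> * of_real e)"]
          int2[of "\<i> * of_real e"] int2[of 0], symmetric])
  also have "\<dots> = (\<integral>z. g z * four_point_diff e \<psi> (z - y) \<partial>lborel)"
    by (intro Bochner_Integration.integral_cong refl) (simp add: four_point_diff_def algebra_simps add_divide_distrib)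
  finally show ?thesis .
qed

lemma compact_support_bounded:
  fixes g :: "complex \<Rightarrow> real"
  assumes "continuous_on UNIV g" "\<forall>z. cmod z > R \<longrightarrow> g z = 0"
  obtains C where "C \<ge> 0" "\<And>z. \<bar>g z\<bar> \<le> C"
proof -
  have "compact (g ` cball 0 R)"
    by (intro compact_continuous_image continuous_on_subset[OF assms(1)]) auto
  then obtain C where C: "\<forall>x\<in>g ` cball 0 R. norm x \<le> C" using compact_imp_bounded bounded_iff by blast
  have "\<bar>g z\<bar> \<le> max C 0" for z
  proof (cases "cmod z \<le> R")
    case True
    then have "\<bar>g z\<bar> \<le> C" using C by simp
    then show ?thesis by simp
  qed (use assms(2) in simp)
  then show thesis by (intro that[of "max C 0"]) auto
qed

text \<open>After the swap, the substitution \<open>z = y + e x\<close> has Jacobian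
  \<open>e^2\<close>, which the division by \<open>e^2\<close> cancels. What remains is a fixed
  kernel against a dilated \<open>g\<close>, ready for dominated convergence.\<close>

lemma integral_reg_potential:
  fixes g :: "complex \<Rightarrow> real"
  assumes g: "continuous_on UNIV g" "\<forall>z. cmod z > R \<longrightarrow> g z = 0" and e: "e > 0"
  shows "(\<integral>z. four_point_diff e g z / e\<^sup>2 * reg_ln e (z - y) \<partial>lborel)
    = (\<integral>x. g (y + of_real e * x) * reg_kernel x \<partial>lborel)"
proof -
  have cont: "continuous_on UNIV (reg_ln e)" using e by (intro continuous_intros) auto
  have "(\<integral>z. four_point_diff e g z / e\<^sup>2 * reg_ln e (z - y) \<partial>lborel)
    = (\<integral>z. four_point_diff e g z * reg_ln e (z - y) \<partial>lborel) / e\<^sup>2"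
    by (subst integral_divide_zero[symmetric]) (auto intro!: Bochner_Integration.integral_cong)
  also have "\<dots> = (\<integral>z. g z * four_point_diff e (reg_ln e) (z - y) \<partial>lborel) / e\<^sup>2"
    by (subst integral_four_point_diff_swap[OF g cont]) auto
  also have "\<dots> = (\<integral>x. g (y + of_real e * x) * four_point_diff e (reg_ln e) (of_real e * x) \<partial>lborel)"
  proof (subst integral_lborel_affine[OF _ e, where y = y])
    show "(\<lambda>z. g z * four_point_diff e (reg_ln e) (z - y)) \<in> borel_measurable borel"
      by (intro borel_measurable_continuous_onI continuous_intros continuous_on_compose2[OF g(1)]
          continuous_on_compose2[OF four_point_diff_continuous[OF cont]]) auto
  qed (use e in simp)
  finally show ?thesis by (simp add: four_point_diff_reg_ln_scale[OF e])
qed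

lemma reg_potential_tendsto:
  fixes g :: "complex \<Rightarrow> real"
  assumes g: "continuous_on UNIV g" "\<forall>z. cmod z > R \<longrightarrow> g z = 0"
    and e: "\<And>n. e n > 0" "e \<longlonglongrightarrow> 0"
  shows "(\<lambda>n. \<integral>z. four_point_diff (e n) g z / (e n)\<^sup>2 * reg_ln (e n) (z - y) \<partial>lborel)
    \<longlonglongrightarrow> reg_mass * g y"
proof -
  obtain C where C: "C \<ge> 0" "\<And>z. \<bar>g z\<bar> \<le> C" using compact_support_bounded[OF g] by blast
  have [measurable]: "g \<in> borel_measurable borel" using g(1) by (rule borel_measurable_continuous_onI)
  have "(\<lambda>n. \<integral>x. g (y + of_real (e n) * x) * reg_kernel x \<partial>lborel) \<longlonglongrightarrow> (\<integral>x. g y * reg_kernel x \<partial>lborel)"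
  proof (rule integral_dominated_convergence[where w = "\<lambda>x. C * reg_kernel x"])
    show "integrable lborel (\<lambda>x. C * reg_kernel x)" using reg_kernel_integrable by simp
    show "AE x in lborel. norm (g (y + of_real (e n) * x) * reg_kernel x) \<le> C * reg_kernel x" for n
    proof (rule AE_I2)
      fix x
      show "norm (g (y + of_real (e n) * x) * reg_kernel x) \<le> C * reg_kernel x"
        using C(2)[of "y + of_real (e n) * x"] reg_kernel_pos[of x] by (simp add: abs_mult mult_right_mono)
    qed
    show "AE x in lborel. (\<lambda>n. g (y + of_real (e n) * x) * reg_kernel x) \<longlonglongrightarrow> g y * reg_kernel x"
    proof (rule AE_I2)
      fix x :: complex
      have "(\<lambda>n. y + of_real (e n) * x) \<longlonglongrightarrow> y + of_real 0 * x"
        by (intro tendsto_intros e)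
      then have "(\<lambda>n. g (y + of_real (e n) * x)) \<longlonglongrightarrow> g y"
        using g(1) by (intro isCont_tendsto_compose[of y g]) (auto simp: continuous_on_eq_continuous_at)
      then show "(\<lambda>n. g (y + of_real (e n) * x) * reg_kernel x) \<longlonglongrightarrow> g y * reg_kernel x"
        by (intro tendsto_intros)
    qed
  qed auto
  then show ?thesis
    unfolding integral_reg_potential[OF g e(1)] by (simp add: reg_mass_def mult.commute)
qed

text \<open>The swap with \<open>\<psi> = 1\<close>. It lets \<open>potential_comparison\<close>
  ignore additive constants in the potentials, in particular those coming from leading
  coefficients.\<close>

lemma integral_four_point_diff:
  fixes g :: "complex \<Rightarrow> real"
  assumes g: "continuous_on UNIV g" "\<forall>z. cmod z > R \<longrightarrow> g z = 0"
  shows "(\<integral>z. four_point_diff e g z \<partial>lborel) = 0"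
  using integral_four_point_diff_swap[OF g, where \<psi> = "\<lambda>_. 1" and y = 0] by (simp add: four_point_diff_def)

lemma reg_ln_ge:
  assumes "e > 0" "x \<noteq> 0" shows "ln (cmod x) \<le> reg_ln e x"
proof -
  have "2 * ln (cmod x) = ln ((cmod x)\<^sup>2)" using assms by (simp add: ln_realpow)
  also have "\<dots> \<le> ln ((cmod x)\<^sup>2 + e\<^sup>2)" using assms by (subst ln_le_cancel_iff) (auto simp: add_pos_pos)
  finally show ?thesis by (simp add: reg_ln_def)
qed

lemma reg_ln_le:
  assumes "0 < e" "e \<le> 1" "x \<noteq> 0" shows "reg_ln e x \<le> (cmod x)\<^sup>2"
proof -
  have "reg_ln e x \<le> ln (1 + (cmod x)\<^sup>2) / 2"
    using assms by (auto simp: reg_ln_def add.commute power_le_one add_pos_pos intro!: add_mono)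
  also have "\<dots> \<le> (cmod x)\<^sup>2 / 2" by (intro divide_right_mono ln_add_one_self_le_self) auto
  also have "\<dots> \<le> (cmod x)\<^sup>2" by simp
  finally show ?thesis .
qed

lemma reg_ln_tendsto:
  assumes "x \<noteq> 0" "e \<longlonglongrightarrow> 0" shows "(\<lambda>n. reg_ln (e n) x) \<longlonglongrightarrow> ln (cmod x)"
proof -
  have "(\<lambda>n. ln ((cmod x)\<^sup>2 + (e n)\<^sup>2) / 2) \<longlonglongrightarrow> ln ((cmod x)\<^sup>2 + 0\<^sup>2) / 2"
    using assms by (intro tendsto_intros) auto
  then show ?thesis using assms(1) by (simp add: reg_ln_def ln_realpow)
qed

lemma reg_ln_measurable [measurable]: "reg_ln e \<in> borel_measurable borel"
  unfolding reg_ln_def by measurable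

lemma reg_error_tendsto:
  assumes e: "\<And>n. 0 < e n" "\<And>n. e n \<le> 1" "e \<longlonglongrightarrow> 0"
  shows "(\<lambda>n. \<integral>\<^sup>+z\<in>cball 0 R. ennreal \<bar>reg_ln (e n) (z - y) - ln (cmod (z - y))\<bar> \<partial>lborel) \<longlonglongrightarrow> 0"
proof -
  let ?w = "\<lambda>z. ennreal (ln_minus (z - y)) + ennreal ((R + cmod y)\<^sup>2) * indicator (cball 0 R) z"
  have AEy: "AE z in lborel. z \<noteq> y" by (rule AE_lborel_singleton)
  have "(\<lambda>n. \<integral>\<^sup>+z\<in>cball 0 R. ennreal \<bar>reg_ln (e n) (z - y) - ln (cmod (z - y))\<bar> \<partial>lborel)
    \<longlonglongrightarrow> (\<integral>\<^sup>+(z::complex). 0 \<partial>lborel)"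
  proof (rule nn_integral_dominated_convergence[where w = ?w])
    show "AE z in lborel. ennreal \<bar>reg_ln (e n) (z - y) - ln (cmod (z - y))\<bar> * indicator (cball 0 R) z \<le> ?w z" for n
      using AEy
    proof eventually_elim
      case (elim z)
      show ?case
      proof (cases "z \<in> cball 0 R")
        case True
        have "z - y \<noteq> 0" using elim by simp
        \<comment> \<open>As \<open>reg_ln\<close> dominates the logarithm, the error is
          \<open>reg_ln - ln\<close> without the modulus, and this has a majorant independent of
          \<open>n\<close>.\<close>
        then have "\<bar>reg_ln (e n) (z - y) - ln (cmod (z - y))\<bar> \<le> (cmod (z - y))\<^sup>2 + ln_minus (z - y)"
          using reg_ln_ge[of "e n" "z - y"] reg_ln_le[of "e n" "z - y"] e(1,2)[of n]
          by (simp add: ln_minus_def)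
        moreover have "cmod (z - y) \<le> R + cmod y"
          using True norm_triangle_ineq4[of z y] by simp
        then have "(cmod (z - y))\<^sup>2 \<le> (R + cmod y)\<^sup>2" by (intro power_mono) auto
        ultimately have "\<bar>reg_ln (e n) (z - y) - ln (cmod (z - y))\<bar> \<le> ln_minus (z - y) + (R + cmod y)\<^sup>2"
          by linarith
        then have "ennreal \<bar>reg_ln (e n) (z - y) - ln (cmod (z - y))\<bar> \<le> ennreal (ln_minus (z - y)) + ennreal ((R + cmod y)\<^sup>2)"
          by (metis ennreal_leI ennreal_plus ln_minus_nonneg zero_le_power2)
        then show ?thesis using True by simp
      qed simp
    qed
    show "(\<integral>\<^sup>+z. ?w z \<partial>lborel) < \<infinity>"
    proof -
      have "(\<integral>\<^sup>+z. ennreal (ln_minus (z - y)) * indicator UNIV z \<partial>lborel) \<le> ennreal 8"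
        using nn_integral_ln_minus_set[of UNIV y 0] by simp
      then have "(\<integral>\<^sup>+z. ennreal (ln_minus (z - y)) \<partial>lborel) < \<infinity>"
        by (simp add: order_le_less_trans)
      moreover have "(\<integral>\<^sup>+(z::complex). ennreal ((R + cmod y)\<^sup>2) * indicator (cball 0 R) z \<partial>lborel)
          = ennreal ((R + cmod y)\<^sup>2) * emeasure lborel (cball (0::complex) R)"
        by (rule nn_integral_cmult_indicator) auto
      moreover have "emeasure lborel (cball (0::complex) R) < \<infinity>"
        using emeasure_lborel_cball_finite by blast
      ultimately show ?thesis
        by (subst nn_integral_add)
          (auto simp: ennreal_mult_less_top intro!: borel_measurable_times_ennreal borel_measurable_indicator)
    qed
    show "AE z in lborel. (\<lambda>n. ennreal \<bar>reg_ln (e n) (z - y) - ln (cmod (z - y))\<bar> * indicator (cball 0 R) z) \<longlonglongrightarrow> 0"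
      using AEy
    proof eventually_elim
      case (elim z)
      then have "(\<lambda>n. \<bar>reg_ln (e n) (z - y) - ln (cmod (z - y))\<bar>) \<longlonglongrightarrow> \<bar>ln (cmod (z - y)) - ln (cmod (z - y))\<bar>"
        by (intro tendsto_intros reg_ln_tendsto e) auto
      then have "(\<lambda>n. ennreal \<bar>reg_ln (e n) (z - y) - ln (cmod (z - y))\<bar>) \<longlonglongrightarrow> ennreal 0"
        by (intro tendsto_ennrealI) simp
      then show ?case by (cases "z \<in> cball 0 R") auto
    qed
  qed (auto intro!: borel_measurable_times_ennreal borel_measurable_indicator borel_measurable_add)
  then show ?thesis by simp
qed

lemma reg_potential_mset_tendsto:
  fixes g :: "complex \<Rightarrow> real"
  assumes g: "continuous_on UNIV g" "\<forall>z. cmod z > R \<longrightarrow> g z = 0"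
    and e: "\<And>n. e n > 0" "e \<longlonglongrightarrow> 0"
  shows "(\<lambda>n. \<integral>z. four_point_diff (e n) g z / (e n)\<^sup>2 * (\<Sum>y\<in>#M. reg_ln (e n) (z - y)) \<partial>lborel)
      \<longlonglongrightarrow> reg_mass * (\<Sum>y\<in>#M. g y)" (is ?A)
    and "integrable lborel (\<lambda>z. four_point_diff (e n) g z / (e n)\<^sup>2 * (\<Sum>y\<in>#M. reg_ln (e n) (z - y)))" (is "?B M")
proof -
  have int1: "integrable lborel (\<lambda>z. four_point_diff (e n) g z / (e n)\<^sup>2 * reg_ln (e n) (z - y))" for n y
  proof (rule integrable_continuous_compact_support[where R = "R + e n"])
    show "continuous_on UNIV (\<lambda>z. four_point_diff (e n) g z / (e n)\<^sup>2 * reg_ln (e n) (z - y))"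
      using e(1)[of n] by (intro continuous_intros four_point_diff_continuous[OF g(1)]) auto
    show "\<forall>z. cmod z > R + e n \<longrightarrow> four_point_diff (e n) g z / (e n)\<^sup>2 * reg_ln (e n) (z - y) = 0"
      using four_point_diff_support[OF g(2), of "e n"] e(1)[of n] by (simp add: less_imp_le)
  qed
  have int: "integrable lborel (\<lambda>z. four_point_diff (e n) g z / (e n)\<^sup>2 * (\<Sum>y\<in>#M. reg_ln (e n) (z - y)))" for n M
  proof (induction M)
    case (add y M)
    have "(\<lambda>z. four_point_diff (e n) g z / (e n)\<^sup>2 * (\<Sum>y\<in>#add_mset y M. reg_ln (e n) (z - y)))
      = (\<lambda>z. four_point_diff (e n) g z / (e n)\<^sup>2 * reg_ln (e n) (z - y)
          + four_point_diff (e n) g z / (e n)\<^sup>2 * (\<Sum>y\<in>#M. reg_ln (e n) (z - y)))"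
      by (simp add: fun_eq_iff distrib_left)
    then show ?case using int1[of n y] add by simp
  qed simp
  then show "?B M" .
  show ?A
  proof (induction M)
    case (add y M)
    have eq: "(\<lambda>z. four_point_diff (e n) g z / (e n)\<^sup>2 * (\<Sum>y\<in>#add_mset y M. reg_ln (e n) (z - y)))
      = (\<lambda>z. four_point_diff (e n) g z / (e n)\<^sup>2 * reg_ln (e n) (z - y)
          + four_point_diff (e n) g z / (e n)\<^sup>2 * (\<Sum>y\<in>#M. reg_ln (e n) (z - y)))" for n
      by (simp add: fun_eq_iff distrib_left)
    have "(\<lambda>n. (\<integral>z. four_point_diff (e n) g z / (e n)\<^sup>2 * reg_ln (e n) (z - y) \<partial>lborel)
       + (\<integral>z. four_point_diff (e n) g z / (e n)\<^sup>2 * (\<Sum>y\<in>#M. reg_ln (e n) (z - y)) \<partial>lborel))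
       \<longlonglongrightarrow> reg_mass * g y + reg_mass * (\<Sum>y\<in>#M. g y)"
      by (intro tendsto_add reg_potential_tendsto[OF g e] add)
    then show ?case unfolding eq using int1 int by (simp add: distrib_left)
  qed simp
qed

lemma reg_error_mset_tendsto:
  assumes e: "\<And>n. 0 < e n" "\<And>n. e n \<le> 1" "e \<longlonglongrightarrow> 0"
  shows "(\<lambda>n. \<integral>\<^sup>+z\<in>cball 0 R. ennreal \<bar>(\<Sum>y\<in>#M. reg_ln (e n) (z - y)) - (\<Sum>y\<in>#M. ln (cmod (z - y)))\<bar> \<partial>lborel) \<longlonglongrightarrow> 0"
proof (induction M)
  case (add y M)
  let ?d = "\<lambda>n z. \<bar>(\<Sum>y\<in>#M. reg_ln (e n) (z - y)) - (\<Sum>y\<in>#M. ln (cmod (z - y)))\<bar>"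
  let ?d1 = "\<lambda>n z. \<bar>reg_ln (e n) (z - y) - ln (cmod (z - y))\<bar>"
  have [measurable]: "cball (0::complex) (R::real) \<in> sets borel" by simp
  have [measurable]: "(\<lambda>z. \<Sum>y\<in>#M. reg_ln (e n) (z - y)) \<in> borel_measurable borel"
    "(\<lambda>z. \<Sum>y\<in>#M. ln (cmod (z - y))) \<in> borel_measurable borel" for n and M :: "complex multiset"
    by (induction M) auto
  show ?case
  proof (rule tendsto_sandwich[where f = "\<lambda>_. 0"])
    show "\<forall>\<^sub>F n in sequentially. (\<integral>\<^sup>+z\<in>cball 0 R. ennreal \<bar>(\<Sum>y\<in>#add_mset y M. reg_ln (e n) (z - y))
         - (\<Sum>y\<in>#add_mset y M. ln (cmod (z - y)))\<bar> \<partial>lborel)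
       \<le> (\<integral>\<^sup>+z\<in>cball 0 R. ennreal (?d1 n z) \<partial>lborel) + (\<integral>\<^sup>+z\<in>cball 0 R. ennreal (?d n z) \<partial>lborel)"
    proof (rule always_eventually, rule allI)
      fix n
      have "(\<integral>\<^sup>+z\<in>cball 0 R. ennreal \<bar>(\<Sum>y\<in>#add_mset y M. reg_ln (e n) (z - y))
         - (\<Sum>y\<in>#add_mset y M. ln (cmod (z - y)))\<bar> \<partial>lborel)
        \<le> (\<integral>\<^sup>+z. ennreal (?d1 n z) * indicator (cball 0 R) z + ennreal (?d n z) * indicator (cball 0 R) z \<partial>lborel)"
      proof (rule nn_integral_mono)
        fix z
        have "ennreal \<bar>(\<Sum>y\<in>#add_mset y M. reg_ln (e n) (z - y)) - (\<Sum>y\<in>#add_mset y M. ln (cmod (z - y)))\<bar>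
          \<le> ennreal (?d1 n z + ?d n z)" by (intro ennreal_leI) simp
        also have "\<dots> = ennreal (?d1 n z) + ennreal (?d n z)" by (rule ennreal_plus) auto
        finally show "ennreal \<bar>(\<Sum>y\<in>#add_mset y M. reg_ln (e n) (z - y)) - (\<Sum>y\<in>#add_mset y M. ln (cmod (z - y)))\<bar>
           * indicator (cball 0 R) z \<le> ennreal (?d1 n z) * indicator (cball 0 R) z + ennreal (?d n z) * indicator (cball 0 R) z"
          by (simp add: indicator_def)
      qed
      also have "\<dots> = (\<integral>\<^sup>+z\<in>cball 0 R. ennreal (?d1 n z) \<partial>lborel) + (\<integral>\<^sup>+z\<in>cball 0 R. ennreal (?d n z) \<partial>lborel)"
        by (rule nn_integral_add) (auto intro!: borel_measurable_times_ennreal borel_measurable_indicator)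
      finally show "(\<integral>\<^sup>+z\<in>cball 0 R. ennreal \<bar>(\<Sum>y\<in>#add_mset y M. reg_ln (e n) (z - y))
         - (\<Sum>y\<in>#add_mset y M. ln (cmod (z - y)))\<bar> \<partial>lborel)
       \<le> (\<integral>\<^sup>+z\<in>cball 0 R. ennreal (?d1 n z) \<partial>lborel) + (\<integral>\<^sup>+z\<in>cball 0 R. ennreal (?d n z) \<partial>lborel)" .
    qed
    show "(\<lambda>n. (\<integral>\<^sup>+z\<in>cball 0 R. ennreal (?d1 n z) \<partial>lborel) + (\<integral>\<^sup>+z\<in>cball 0 R. ennreal (?d n z) \<partial>lborel)) \<longlonglongrightarrow> 0"
      using tendsto_add[OF reg_error_tendsto[OF e, where R = R and y = y] add] by simp
  qed auto
qed simp

text \<open>The rescaled differences \<open>h n\<close> are bounded by \<open>A\<close>, live on a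
  fixed disc and integrate to zero. The averages are therefore limits of integrals of
  \<open>h n\<close> against regularised potentials; there \<open>c\<close> drops out, and replacing
  \<open>reg_ln\<close> by \<open>ln\<close> costs an error vanishing in L^1. Smoothness of
  \<open>g\<close> enters through second differences alone.\<close>

lemma potential_comparison:
  fixes g :: "complex \<Rightarrow> real" and M1 M2 :: "complex multiset"
  assumes g: "continuous_on UNIV g" "\<forall>z. cmod z > R \<longrightarrow> g z = 0"
    and A: "A \<ge> 0" "\<And>e z. 0 < e \<Longrightarrow> e \<le> 1 \<Longrightarrow> \<bar>four_point_diff e g z\<bar> \<le> A * e\<^sup>2"
    and M: "M1 \<noteq> {#}" "M2 \<noteq> {#}"
  shows "ennreal (reg_mass * \<bar>(\<Sum>y\<in>#M1. g y) / size M1 - (\<Sum>y\<in>#M2. g y) / size M2\<bar>)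
    \<le> ennreal A * (\<integral>\<^sup>+z\<in>cball 0 (R + 1). ennreal \<bar>(\<Sum>y\<in>#M1. ln (cmod (z - y))) / size M1
        - (\<Sum>y\<in>#M2. ln (cmod (z - y))) / size M2 - c\<bar> \<partial>lborel)"
proof -
  define N1 N2 where "N1 = real (size M1)" and "N2 = real (size M2)"
  have N: "N1 \<ge> 1" "N2 \<ge> 1" using M by (auto simp: N1_def N2_def Suc_le_eq nonempty_has_size)
  \<comment> \<open>\<open>Suc n\<close> keeps \<open>e n\<close> in the interval from 0 (excluded)
    to 1, so that the bound \<open>A\<close> applies and the support grows by at most 1.\<close>
  define e where "e n = 1 / real (Suc n)" for n
  have e: "\<And>n. 0 < e n" "\<And>n. e n \<le> 1" "e \<longlonglongrightarrow> 0"
    unfolding e_def using LIMSEQ_inverse_real_of_nat by (auto simp: inverse_eq_divide)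
  define h where "h n z = four_point_diff (e n) g z / (e n)\<^sup>2" for n z
  define U where "U M n z = (\<Sum>y\<in>#M. reg_ln (e n) (z - y))" for M n z
  define L where "L M z = (\<Sum>y\<in>#M. ln (cmod (z - y)))" for M and z :: complex
  define W where "W z = \<bar>L M1 z / N1 - L M2 z / N2 - c\<bar>" for z
  define E where "E M n = (\<integral>\<^sup>+z\<in>cball 0 (R + 1). ennreal \<bar>U M n z - L M z\<bar> \<partial>lborel)" for M n
  have [measurable]: "U M n \<in> borel_measurable borel" "L M \<in> borel_measurable borel" for M n
    unfolding U_def L_def by (induction M) auto
  have [measurable]: "W \<in> borel_measurable borel" unfolding W_def by measurable
  have [measurable]: "h n \<in> borel_measurable borel" for n
    unfolding h_def using g(1) by (intro borel_measurable_continuous_onI continuous_intros four_point_diff_continuous)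
      (use e(1)[of n] in auto)
  have h_bd: "\<bar>h n z\<bar> \<le> A" for n z
    using A(2)[OF e(1,2), of n z] e(1)[of n] by (simp add: h_def field_simps)
  have h_supp: "h n z = 0" if "z \<notin> cball 0 (R + 1)" for n z
    using four_point_diff_support[OF g(2), of "e n" z] e(1,2)[of n] that by (simp add: h_def)
  have hU: "integrable lborel (\<lambda>z. h n z * U M n z)" for M n
    unfolding h_def U_def by (rule reg_potential_mset_tendsto(2)[OF g e(1,3)])
  have hint: "integrable lborel (h n)" for n
    unfolding h_def
  proof (intro integrable_divide_zero impI integrable_continuous_compact_support[where R = "R + e n"])
    show "\<forall>z. cmod z > R + e n \<longrightarrow> four_point_diff (e n) g z = 0"
      using four_point_diff_support[OF g(2), of "e n"] e(1)[of n] by (simp add: less_imp_le)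
  qed (rule four_point_diff_continuous[OF g(1)])
  define I where "I n = (\<integral>z. h n z * (U M1 n z / N1 - U M2 n z / N2 - c) \<partial>lborel)" for n
  have Ieq: "(\<lambda>z. h n z * (U M1 n z / N1 - U M2 n z / N2 - c))
     = (\<lambda>z. h n z * U M1 n z / N1 - h n z * U M2 n z / N2 - h n z * c)" for n
    by (simp add: fun_eq_iff algebra_simps)
  have h0: "(\<integral>z. h n z \<partial>lborel) = 0" for n
    unfolding h_def using integral_four_point_diff[OF g, where e = "e n"] by simp
  have I: "I n = (\<integral>z. h n z * U M1 n z \<partial>lborel) / N1 - (\<integral>z. h n z * U M2 n z \<partial>lborel) / N2" for n
    unfolding I_def Ieq using hU hint h0 by simp
  have Iint: "integrable lborel (\<lambda>z. h n z * (U M1 n z / N1 - U M2 n z / N2 - c))" for n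
    unfolding Ieq using hU hint by simp
  have "I \<longlonglongrightarrow> (reg_mass * (\<Sum>y\<in>#M1. g y)) / N1 - (reg_mass * (\<Sum>y\<in>#M2. g y)) / N2"
    unfolding I h_def U_def by (intro tendsto_intros reg_potential_mset_tendsto(1)[OF g e(1,3)]) (use N in auto)
  moreover have "(reg_mass * (\<Sum>y\<in>#M1. g y)) / N1 - (reg_mass * (\<Sum>y\<in>#M2. g y)) / N2
      = reg_mass * ((\<Sum>y\<in>#M1. g y) / N1 - (\<Sum>y\<in>#M2. g y) / N2)"
    by (simp add: right_diff_distrib)
  ultimately have "I \<longlonglongrightarrow> reg_mass * ((\<Sum>y\<in>#M1. g y) / N1 - (\<Sum>y\<in>#M2. g y) / N2)" by simp
  from tendsto_rabs[OF this] have lim: "(\<lambda>n. ennreal \<bar>I n\<bar>)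
      \<longlonglongrightarrow> ennreal (reg_mass * \<bar>(\<Sum>y\<in>#M1. g y) / N1 - (\<Sum>y\<in>#M2. g y) / N2\<bar>)"
    unfolding abs_mult abs_of_pos[OF reg_mass_pos] by (rule tendsto_ennrealI)
  have bound: "ennreal \<bar>I n\<bar> \<le> ennreal A * ((\<integral>\<^sup>+z\<in>cball 0 (R + 1). ennreal (W z) \<partial>lborel) + (E M1 n + E M2 n))" for n
  proof -
    have "ennreal \<bar>I n\<bar> \<le> (\<integral>\<^sup>+z. ennreal \<bar>h n z * (U M1 n z / N1 - U M2 n z / N2 - c)\<bar> \<partial>lborel)"
      using integral_norm_bound_ennreal[OF Iint[of n]] by (simp add: I_def)
    also have "\<dots> \<le> (\<integral>\<^sup>+z. ennreal A * (ennreal (W z) * indicator (cball 0 (R + 1)) z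
        + (ennreal \<bar>U M1 n z - L M1 z\<bar> * indicator (cball 0 (R + 1)) z
         + ennreal \<bar>U M2 n z - L M2 z\<bar> * indicator (cball 0 (R + 1)) z)) \<partial>lborel)"
    proof (rule nn_integral_mono)
      fix z
      show "ennreal \<bar>h n z * (U M1 n z / N1 - U M2 n z / N2 - c)\<bar>
        \<le> ennreal A * (ennreal (W z) * indicator (cball 0 (R + 1)) z
        + (ennreal \<bar>U M1 n z - L M1 z\<bar> * indicator (cball 0 (R + 1)) z
         + ennreal \<bar>U M2 n z - L M2 z\<bar> * indicator (cball 0 (R + 1)) z))"
      proof (cases "z \<in> cball 0 (R + 1)")
        case True
        have d: "\<bar>U M n z / N - L M z / N\<bar> \<le> \<bar>U M n z - L M z\<bar>" if "N \<ge> 1" for M N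
        proof -
          have "\<bar>U M n z / N - L M z / N\<bar> = \<bar>U M n z - L M z\<bar> / N"
            using that by (simp add: diff_divide_distrib[symmetric] abs_divide)
          also have "\<dots> \<le> \<bar>U M n z - L M z\<bar> / 1" using that by (intro divide_left_mono) auto
          finally show ?thesis by simp
        qed
        have "\<bar>U M1 n z / N1 - U M2 n z / N2 - c\<bar> \<le> W z + (\<bar>U M1 n z - L M1 z\<bar> + \<bar>U M2 n z - L M2 z\<bar>)"
          using d[OF N(1), of M1] d[OF N(2), of M2] unfolding W_def by linarith
        then have "\<bar>h n z * (U M1 n z / N1 - U M2 n z / N2 - c)\<bar>
          \<le> A * (W z + (\<bar>U M1 n z - L M1 z\<bar> + \<bar>U M2 n z - L M2 z\<bar>))"
          unfolding abs_mult using h_bd A(1) by (intro mult_mono) auto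
        then have "ennreal \<bar>h n z * (U M1 n z / N1 - U M2 n z / N2 - c)\<bar>
          \<le> ennreal (A * (W z + (\<bar>U M1 n z - L M1 z\<bar> + \<bar>U M2 n z - L M2 z\<bar>)))" by (rule ennreal_leI)
        also have "\<dots> = ennreal A * (ennreal (W z) + (ennreal \<bar>U M1 n z - L M1 z\<bar> + ennreal \<bar>U M2 n z - L M2 z\<bar>))"
          using A(1) by (simp add: ennreal_mult W_def ennreal_plus del: ennreal_plus_if)
        finally show ?thesis using True by simp
      qed (simp add: h_supp)
    qed
    also have "\<dots> = ennreal A * ((\<integral>\<^sup>+z\<in>cball 0 (R + 1). ennreal (W z) \<partial>lborel) + (E M1 n + E M2 n))"
    proof -
      have m: "(\<lambda>z. ennreal (W z) * indicator (cball 0 (R + 1)) z) \<in> borel_measurable lborel"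
        "\<And>M. (\<lambda>z. ennreal \<bar>U M n z - L M z\<bar> * indicator (cball 0 (R + 1)) z) \<in> borel_measurable lborel"
        by (auto intro!: borel_measurable_times_ennreal borel_measurable_indicator)
      show ?thesis unfolding E_def
        by (simp only: nn_integral_cmult nn_integral_add m borel_measurable_add)
    qed
    finally show ?thesis .
  qed
  have E0: "E M \<longlonglongrightarrow> 0" for M
    unfolding E_def U_def L_def by (rule reg_error_mset_tendsto[OF e])
  have "(\<lambda>n. ennreal A * ((\<integral>\<^sup>+z\<in>cball 0 (R + 1). ennreal (W z) \<partial>lborel) + (E M1 n + E M2 n)))
    \<longlonglongrightarrow> ennreal A * ((\<integral>\<^sup>+z\<in>cball 0 (R + 1). ennreal (W z) \<partial>lborel) + (0 + 0))"
    by (intro ennreal_tendsto_cmult tendsto_add tendsto_const E0) simp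
  from LIMSEQ_le[OF lim this] bound show ?thesis
    by (auto simp: W_def L_def N1_def N2_def)
qed

section \<open>Averages of twice differentiable functions over zeros\<close>

text \<open>C^{1,1} regularity in terms of differences. This class contains the C^2 functions, is
  closed under products and under the square of the positive part, and carries the bound on second
  differences that \<open>potential_comparison\<close> asks for.\<close>

definition locally_C11 :: "(complex \<Rightarrow> real) \<Rightarrow> bool" where
  "locally_C11 u \<longleftrightarrow> (\<forall>M. \<exists>C\<ge>0. \<forall>z h. cmod z \<le> M \<and> cmod h \<le> 1 \<longrightarrow>
     \<bar>u z\<bar> \<le> C \<and> \<bar>u (z + h) - u z\<bar> \<le> C * cmod h \<and> \<bar>u (z + h) + u (z - h) - 2 * u z\<bar> \<le> C * (cmod h)\<^sup>2)"

lemma locally_C11D: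
  assumes "locally_C11 u"
  obtains C where "C \<ge> 0" "\<And>z. cmod z \<le> M \<Longrightarrow> \<bar>u z\<bar> \<le> C"
    "\<And>z h. cmod z \<le> M \<Longrightarrow> cmod h \<le> 1 \<Longrightarrow> \<bar>u (z + h) - u z\<bar> \<le> C * cmod h"
    "\<And>z h. cmod z \<le> M \<Longrightarrow> cmod h \<le> 1 \<Longrightarrow> \<bar>u (z + h) + u (z - h) - 2 * u z\<bar> \<le> C * (cmod h)\<^sup>2"
proof -
  obtain C where "C \<ge> 0" "\<forall>z h. cmod z \<le> M \<and> cmod h \<le> 1 \<longrightarrow>
     \<bar>u z\<bar> \<le> C \<and> \<bar>u (z + h) - u z\<bar> \<le> C * cmod h \<and> \<bar>u (z + h) + u (z - h) - 2 * u z\<bar> \<le> C * (cmod h)\<^sup>2"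
    using assms unfolding locally_C11_def by blast
  moreover from this have "\<bar>u z\<bar> \<le> C" if "cmod z \<le> M" for z
    using that by (metis norm_zero zero_le_one)
  ultimately show thesis by (intro that[of C]) blast+
qed

lemma continuous_bounded_cball:
  fixes F :: "complex \<Rightarrow> 'a::real_normed_vector"
  assumes "continuous_on UNIV F"
  obtains K where "K \<ge> 0" "\<And>z. cmod z \<le> M \<Longrightarrow> norm (F z) \<le> K"
proof -
  have "compact (F ` cball 0 M)"
    by (intro compact_continuous_image continuous_on_subset[OF assms]) auto
  then obtain K where "\<forall>x\<in>F ` cball 0 M. norm x \<le> K" using compact_imp_bounded bounded_iff by blast
  then show thesis by (intro that[of "max K 0"]) (auto simp: le_max_iff_disj)
qed

lemma C2_imp_locally_C11:
  assumes "C2 g" shows "locally_C11 g" and C2_imp_continuous: "continuous_on UNIV g"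
proof -
  from assms obtain g' :: "complex \<Rightarrow> complex \<Rightarrow>\<^sub>L real" and g'' :: "complex \<Rightarrow> complex \<Rightarrow>\<^sub>L complex \<Rightarrow>\<^sub>L real"
    where ders: "(\<forall>z. (g has_derivative blinfun_apply (g' z)) (at z)) \<and>
      (\<forall>z. (g' has_derivative blinfun_apply (g'' z)) (at z)) \<and> continuous_on UNIV g''"
    unfolding C2_def by (elim exE)
  then have d1: "(g has_derivative blinfun_apply (g' z)) (at z)"
    and d2: "(g' has_derivative blinfun_apply (g'' z)) (at z)" and c: "continuous_on UNIV g''" for z
    by auto
  show cg: "continuous_on UNIV g"
    using has_derivative_continuous[OF d1] by (simp add: continuous_on_eq_continuous_at)
  have cg': "continuous_on UNIV g'"
    using has_derivative_continuous[OF d2] by (simp add: continuous_on_eq_continuous_at)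
  show "locally_C11 g"
    unfolding locally_C11_def
  proof (intro allI)
    fix M :: real
    obtain K0 where K0: "K0 \<ge> 0" "\<And>z. cmod z \<le> M + 1 \<Longrightarrow> norm (g z) \<le> K0"
      by (rule continuous_bounded_cball[OF cg, where M = "M + 1"]) (rule that)
    obtain K1 where K1: "K1 \<ge> 0" "\<And>z. cmod z \<le> M + 1 \<Longrightarrow> norm (g' z) \<le> K1"
      by (rule continuous_bounded_cball[OF cg', where M = "M + 1"]) (rule that)
    obtain K2 where K2: "K2 \<ge> 0" "\<And>z. cmod z \<le> M + 1 \<Longrightarrow> norm (g'' z) \<le> K2"
      by (rule continuous_bounded_cball[OF c, where M = "M + 1"]) (rule that)
    have lip: "\<bar>g x - g y\<bar> \<le> K1 * cmod (x - y)" if "x \<in> cball 0 (M + 1)" "y \<in> cball 0 (M + 1)" for x y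
      using differentiable_bound[of "cball 0 (M + 1)" g "\<lambda>z. blinfun_apply (g' z)" K1 x y] that K1 d1
      by (auto simp: norm_blinfun.rep_eq[symmetric] has_derivative_at_withinI)
    have lip': "norm (g' x - g' y) \<le> K2 * cmod (x - y)" if "x \<in> cball 0 (M + 1)" "y \<in> cball 0 (M + 1)" for x y
      using differentiable_bound[of "cball 0 (M + 1)" g' "\<lambda>z. blinfun_apply (g'' z)" K2 x y] that K2 d2
      by (auto simp: norm_blinfun.rep_eq[symmetric] has_derivative_at_withinI)
    have second: "\<bar>g (z + h) + g (z - h) - 2 * g z\<bar> \<le> 2 * K2 * (cmod h)\<^sup>2"
      if zh: "cmod z \<le> M" "cmod h \<le> 1" for z h
    proof -
      \<comment> \<open>The second difference is \<open>F 1 - F 0\<close>. The derivative of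
        \<open>F\<close> applies to \<open>h\<close> the difference of \<open>g'\<close> at two
        points \<open>2 t h\<close> apart, so the Lipschitz bound for \<open>g'\<close> supplies the
        second factor \<open>cmod h\<close>.\<close>
      define F where "F t = g (z + t *\<^sub>R h) + g (z - t *\<^sub>R h)" for t :: real
      define F' where "F' t s = blinfun_apply (g' (z + t *\<^sub>R h)) (s *\<^sub>R h) - blinfun_apply (g' (z - t *\<^sub>R h)) (s *\<^sub>R h)" for t s :: real
      have "(F has_derivative F' t) (at t within {0..1})" for t
        unfolding F_def F'_def
        by (rule derivative_eq_intros has_derivative_compose[OF _ d1] refl | simp add: blinfun.bilinear_simps)+
      moreover have "onorm (F' t) \<le> 2 * K2 * (cmod h)\<^sup>2" if t: "t \<in> {0..1}" for t
      proof (rule onorm_le)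
        fix s :: real
        have th: "cmod (t *\<^sub>R h) \<le> 1" using t zh by (simp add: mult_le_one)
        have mem: "z + t *\<^sub>R h \<in> cball 0 (M + 1)" "z - t *\<^sub>R h \<in> cball 0 (M + 1)"
          using norm_triangle_ineq[of z "t *\<^sub>R h"] norm_triangle_ineq4[of z "t *\<^sub>R h"] zh th by auto
        have "norm (F' t s) = norm (blinfun_apply (g' (z + t *\<^sub>R h) - g' (z - t *\<^sub>R h)) (s *\<^sub>R h))"
          by (simp add: F'_def blinfun.diff_left)
        also have "\<dots> \<le> norm (g' (z + t *\<^sub>R h) - g' (z - t *\<^sub>R h)) * norm (s *\<^sub>R h)"
          by (rule norm_blinfun)
        also have "\<dots> \<le> (K2 * cmod ((z + t *\<^sub>R h) - (z - t *\<^sub>R h))) * norm (s *\<^sub>R h)"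
          by (intro mult_right_mono lip' mem) auto
        also have "cmod ((z + t *\<^sub>R h) - (z - t *\<^sub>R h)) = 2 * t * cmod h"
        proof -
          have "(z + t *\<^sub>R h) - (z - t *\<^sub>R h) = (2 * t) *\<^sub>R h" by (simp add: scaleR_conv_of_real)
          then show ?thesis using t by (simp only: norm_scaleR) simp
        qed
        also have "K2 * (2 * t * cmod h) * norm (s *\<^sub>R h) \<le> K2 * (2 * 1 * cmod h) * norm (s *\<^sub>R h)"
          using t K2(1) by (intro mult_right_mono mult_left_mono) auto
        finally show "norm (F' t s) \<le> 2 * K2 * (cmod h)\<^sup>2 * norm s"
          by (simp add: power2_eq_square mult_ac)
      qed
      ultimately have "norm (F 1 - F 0) \<le> 2 * K2 * (cmod h)\<^sup>2 * norm (1 - 0 :: real)"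
        by (intro differentiable_bound[of "{0..1}" F F']) auto
      then show ?thesis by (simp add: F_def)
    qed
    define C where "C = K0 + K1 + 2 * K2"
    have C: "C \<ge> 0" "K0 \<le> C" "K1 \<le> C" "2 * K2 \<le> C" using K0(1) K1(1) K2(1) by (auto simp: C_def)
    have "\<bar>g z\<bar> \<le> C \<and> \<bar>g (z + h) - g z\<bar> \<le> C * cmod h \<and> \<bar>g (z + h) + g (z - h) - 2 * g z\<bar> \<le> C * (cmod h)\<^sup>2"
      if zh: "cmod z \<le> M" "cmod h \<le> 1" for z h
    proof (intro conjI)
      show "\<bar>g z\<bar> \<le> C" using K0(2)[of z] zh C by simp
      have "z + h \<in> cball 0 (M + 1)" "z \<in> cball 0 (M + 1)"
        using norm_triangle_ineq[of z h] zh by auto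
      then have "\<bar>g (z + h) - g z\<bar> \<le> K1 * cmod h" using lip by fastforce
      also have "\<dots> \<le> C * cmod h" using C by (intro mult_right_mono) auto
      finally show "\<bar>g (z + h) - g z\<bar> \<le> C * cmod h" .
      have "2 * K2 * (cmod h)\<^sup>2 \<le> C * (cmod h)\<^sup>2" using C by (intro mult_right_mono) auto
      then show "\<bar>g (z + h) + g (z - h) - 2 * g z\<bar> \<le> C * (cmod h)\<^sup>2" using second[OF zh] by linarith
    qed
    then show "\<exists>C\<ge>0. \<forall>z h. cmod z \<le> M \<and> cmod h \<le> 1 \<longrightarrow> \<bar>g z\<bar> \<le> C \<and>
      \<bar>g (z + h) - g z\<bar> \<le> C * cmod h \<and> \<bar>g (z + h) + g (z - h) - 2 * g z\<bar> \<le> C * (cmod h)\<^sup>2"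
      using C(1) by blast
  qed
qed

lemma locally_C11_mult:
  assumes "locally_C11 u" "locally_C11 v" shows "locally_C11 (\<lambda>z. u z * v z)"
  unfolding locally_C11_def
proof (intro allI)
  fix M
  obtain A where A: "A \<ge> 0" "\<And>z. cmod z \<le> M \<Longrightarrow> \<bar>u z\<bar> \<le> A"
    "\<And>z h. cmod z \<le> M \<Longrightarrow> cmod h \<le> 1 \<Longrightarrow> \<bar>u (z + h) - u z\<bar> \<le> A * cmod h"
    "\<And>z h. cmod z \<le> M \<Longrightarrow> cmod h \<le> 1 \<Longrightarrow> \<bar>u (z + h) + u (z - h) - 2 * u z\<bar> \<le> A * (cmod h)\<^sup>2"
    by (rule locally_C11D[OF assms(1), where M = M]) (rule that)
  obtain B where B: "B \<ge> 0" "\<And>z. cmod z \<le> M \<Longrightarrow> \<bar>v z\<bar> \<le> B"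
    "\<And>z h. cmod z \<le> M \<Longrightarrow> cmod h \<le> 1 \<Longrightarrow> \<bar>v (z + h) - v z\<bar> \<le> B * cmod h"
    "\<And>z h. cmod z \<le> M \<Longrightarrow> cmod h \<le> 1 \<Longrightarrow> \<bar>v (z + h) + v (z - h) - 2 * v z\<bar> \<le> B * (cmod h)\<^sup>2"
    by (rule locally_C11D[OF assms(2), where M = M]) (rule that)
  show "\<exists>C\<ge>0. \<forall>z h. cmod z \<le> M \<and> cmod h \<le> 1 \<longrightarrow> \<bar>u z * v z\<bar> \<le> C \<and>
    \<bar>u (z + h) * v (z + h) - u z * v z\<bar> \<le> C * cmod h \<and>
    \<bar>u (z + h) * v (z + h) + u (z - h) * v (z - h) - 2 * (u z * v z)\<bar> \<le> C * (cmod h)\<^sup>2"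
  proof (intro exI[of _ "4 * (A * B)"] conjI allI impI)
    show "0 \<le> 4 * (A * B)" using A B by simp
    fix z h assume "cmod z \<le> M \<and> cmod h \<le> 1"
    then have z: "cmod z \<le> M" and h: "cmod h \<le> 1" and h': "cmod (- h) \<le> 1" by auto
    have AB: "0 \<le> A * B" using A(1) B(1) by simp
    have uv: "\<bar>u z * v z\<bar> \<le> A * B" unfolding abs_mult using A B z by (intro mult_mono) auto
    then show "\<bar>u z * v z\<bar> \<le> 4 * (A * B)" using AB by linarith
    have hh: "cmod h * cmod h \<le> cmod h" using h by (simp add: mult_left_le)
    have du: "\<bar>u (z + h) - u z\<bar> \<le> A * cmod h" "\<bar>u (z - h) - u z\<bar> \<le> A * cmod h"
      using A(3)[OF z h] A(3)[OF z h'] by auto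
    have dv: "\<bar>v (z + h) - v z\<bar> \<le> B * cmod h" "\<bar>v (z - h) - v z\<bar> \<le> B * cmod h"
      using B(3)[OF z h] B(3)[OF z h'] by auto
    have p1: "\<bar>u z * (v (z + h) - v z)\<bar> \<le> A * (B * cmod h)"
      unfolding abs_mult using A B z dv by (intro mult_mono) auto
    have p2: "\<bar>v z * (u (z + h) - u z)\<bar> \<le> B * (A * cmod h)"
      unfolding abs_mult using A B z du by (intro mult_mono) auto
    have p3: "\<bar>(u (z + h) - u z) * (v (z + h) - v z)\<bar> \<le> (A * cmod h) * (B * cmod h)"
      unfolding abs_mult using A B z du dv by (intro mult_mono) auto
    have p4: "\<bar>(u (z - h) - u z) * (v (z - h) - v z)\<bar> \<le> (A * cmod h) * (B * cmod h)"
      unfolding abs_mult using A B z du dv by (intro mult_mono) auto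
    have p5: "\<bar>u z * (v (z + h) + v (z - h) - 2 * v z)\<bar> \<le> A * (B * (cmod h)\<^sup>2)"
      unfolding abs_mult using A B z B(4)[OF z h] by (intro mult_mono) auto
    have p6: "\<bar>v z * (u (z + h) + u (z - h) - 2 * u z)\<bar> \<le> B * (A * (cmod h)\<^sup>2)"
      unfolding abs_mult using A B z A(4)[OF z h] by (intro mult_mono) auto
    have "(A * cmod h) * (B * cmod h) \<le> (A * B) * cmod h"
      using mult_left_mono[OF hh AB] by (simp add: mult_ac)
    moreover have "u (z + h) * v (z + h) - u z * v z
      = u z * (v (z + h) - v z) + v z * (u (z + h) - u z) + (u (z + h) - u z) * (v (z + h) - v z)"
      by (simp add: algebra_simps)
    moreover have "A * (B * cmod h) = (A * B) * cmod h" "B * (A * cmod h) = (A * B) * cmod h" by simp_all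
    moreover have "0 \<le> (A * B) * cmod h" using AB by simp
    ultimately show "\<bar>u (z + h) * v (z + h) - u z * v z\<bar> \<le> 4 * (A * B) * cmod h"
      using p1 p2 p3 by linarith
    \<comment> \<open>Discrete Leibniz rule: besides the two second differences only products of
      first differences at \<open>h\<close> and at \<open>- h\<close> occur, each of order
      \<open>(cmod h)^2\<close>.\<close>
    have "u (z + h) * v (z + h) + u (z - h) * v (z - h) - 2 * (u z * v z)
      = u z * (v (z + h) + v (z - h) - 2 * v z) + v z * (u (z + h) + u (z - h) - 2 * u z)
       + (u (z + h) - u z) * (v (z + h) - v z) + (u (z - h) - u z) * (v (z - h) - v z)"
      by (simp add: algebra_simps)
    moreover have "A * (B * (cmod h)\<^sup>2) = (A * B) * (cmod h)\<^sup>2" "B * (A * (cmod h)\<^sup>2) = (A * B) * (cmod h)\<^sup>2"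
      "(A * cmod h) * (B * cmod h) = (A * B) * (cmod h)\<^sup>2" by (simp_all add: power2_eq_square)
    ultimately show "\<bar>u (z + h) * v (z + h) + u (z - h) * v (z - h) - 2 * (u z * v z)\<bar> \<le> 4 * (A * B) * (cmod h)\<^sup>2"
      using p3 p4 p5 p6 by linarith
  qed
qed

section \<open>C^{1,1} cutoff functions\<close>

definition pos_square :: "real \<Rightarrow> real" where "pos_square t = (max 0 t)\<^sup>2"

text \<open>A Taylor remainder: the derivative \<open>2 max 0 m\<close> is Lipschitz with constant
  2. Adding the estimate for the values at \<open>z + h\<close> and \<open>z - h\<close> turns the
  first-order terms into a second difference.\<close>

lemma pos_square_taylor: "\<bar>pos_square a - pos_square m - 2 * max 0 m * (a - m)\<bar> \<le> (a - m)\<^sup>2"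
proof (cases "a \<ge> 0"; cases "m \<ge> 0")
  assume "a \<ge> 0" "m \<ge> 0"
  then have "pos_square a - pos_square m - 2 * max 0 m * (a - m) = (a - m)\<^sup>2"
    by (simp add: pos_square_def power2_eq_square algebra_simps)
  then show ?thesis by simp
next
  assume *: "a \<ge> 0" "\<not> m \<ge> 0"
  then have "a\<^sup>2 \<le> (a - m)\<^sup>2" by (intro power_mono) auto
  then show ?thesis using * by (simp add: pos_square_def)
next
  assume *: "\<not> a \<ge> 0" "m \<ge> 0"
  then have "pos_square a - pos_square m - 2 * max 0 m * (a - m) = m\<^sup>2 - 2 * (m * a)"
    by (simp add: pos_square_def power2_eq_square algebra_simps)
  moreover have "m * a \<le> 0" using * by (simp add: mult_nonneg_nonpos)
  moreover have "(a - m)\<^sup>2 = a\<^sup>2 + m\<^sup>2 - 2 * (m * a)" by (simp add: power2_diff)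
  moreover have "0 \<le> m\<^sup>2" "0 \<le> a\<^sup>2" by simp_all
  ultimately show ?thesis by linarith
qed (simp add: pos_square_def)

lemma locally_C11_pos_square:
  assumes "locally_C11 u" shows "locally_C11 (\<lambda>z. pos_square (u z))"
  unfolding locally_C11_def
proof (intro allI)
  fix M
  obtain A where A: "A \<ge> 0" "\<And>z. cmod z \<le> M \<Longrightarrow> \<bar>u z\<bar> \<le> A"
    "\<And>z h. cmod z \<le> M \<Longrightarrow> cmod h \<le> 1 \<Longrightarrow> \<bar>u (z + h) - u z\<bar> \<le> A * cmod h"
    "\<And>z h. cmod z \<le> M \<Longrightarrow> cmod h \<le> 1 \<Longrightarrow> \<bar>u (z + h) + u (z - h) - 2 * u z\<bar> \<le> A * (cmod h)\<^sup>2"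
    by (rule locally_C11D[OF assms(1), where M = M]) (rule that)
  show "\<exists>C\<ge>0. \<forall>z h. cmod z \<le> M \<and> cmod h \<le> 1 \<longrightarrow> \<bar>pos_square (u z)\<bar> \<le> C \<and>
    \<bar>pos_square (u (z + h)) - pos_square (u z)\<bar> \<le> C * cmod h \<and>
    \<bar>pos_square (u (z + h)) + pos_square (u (z - h)) - 2 * pos_square (u z)\<bar> \<le> C * (cmod h)\<^sup>2"
  proof (intro exI[of _ "4 * (A * A)"] conjI allI impI)
    show "0 \<le> 4 * (A * A)" using A by simp
    fix z h assume "cmod z \<le> M \<and> cmod h \<le> 1"
    then have z: "cmod z \<le> M" and h: "cmod h \<le> 1" and h': "cmod (- h) \<le> 1" by auto
    define m a b where "m = u z" and "a = u (z + h)" and "b = u (z - h)"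
    have AA: "0 \<le> A * A" by simp
    have m: "max 0 m \<le> A" "0 \<le> max 0 m" using A(2)[OF z] A(1) by (auto simp: m_def)
    have "(max 0 m) * (max 0 m) \<le> A * A" using m by (intro mult_mono) auto
    then have "pos_square m \<le> 4 * (A * A)" using AA unfolding pos_square_def power2_eq_square by linarith
    then show "\<bar>pos_square (u z)\<bar> \<le> 4 * (A * A)" by (simp add: m_def pos_square_def)
    have da: "\<bar>a - m\<bar> \<le> A * cmod h" and db: "\<bar>b - m\<bar> \<le> A * cmod h"
      using A(3)[OF z h] A(3)[OF z h'] by (auto simp: m_def a_def b_def)
    have d2: "\<bar>a + b - 2 * m\<bar> \<le> A * (cmod h)\<^sup>2" using A(4)[OF z h] by (simp add: m_def a_def b_def)
    have hh: "(cmod h)\<^sup>2 \<le> cmod h" using h by (simp add: mult_left_le power2_eq_square)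
    have sq: "(a - m)\<^sup>2 \<le> (A * A) * (cmod h)\<^sup>2" "(b - m)\<^sup>2 \<le> (A * A) * (cmod h)\<^sup>2"
      using power_mono[OF da, of 2] power_mono[OF db, of 2] by (simp_all add: power_mult_distrib power2_eq_square[of A])
    have p1: "\<bar>2 * max 0 m * (a - m)\<bar> \<le> 2 * A * (A * cmod h)"
      unfolding abs_mult using m da A(1) by (intro mult_mono) auto
    have p2: "\<bar>2 * max 0 m * (a + b - 2 * m)\<bar> \<le> 2 * A * (A * (cmod h)\<^sup>2)"
      unfolding abs_mult using m d2 A(1) by (intro mult_mono) auto
    have q: "2 * max 0 m * (a + b - 2 * m) = 2 * max 0 m * (a - m) + 2 * max 0 m * (b - m)" by (simp add: algebra_simps)
    have "(A * A) * (cmod h)\<^sup>2 \<le> (A * A) * cmod h" using hh AA by (intro mult_left_mono) auto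
    moreover have "0 \<le> (A * A) * cmod h" using AA by simp
    moreover have "2 * A * (A * cmod h) = 2 * ((A * A) * cmod h)" by simp
    ultimately have "\<bar>pos_square a - pos_square m\<bar> \<le> 4 * ((A * A) * cmod h)"
      using pos_square_taylor[of a m] sq p1 by linarith
    then show "\<bar>pos_square (u (z + h)) - pos_square (u z)\<bar> \<le> 4 * (A * A) * cmod h"
      by (simp add: a_def m_def)
    have "2 * A * (A * (cmod h)\<^sup>2) = 2 * ((A * A) * (cmod h)\<^sup>2)" by simp
    then have "\<bar>pos_square a + pos_square b - 2 * pos_square m\<bar> \<le> 4 * ((A * A) * (cmod h)\<^sup>2)"
      using pos_square_taylor[of a m] pos_square_taylor[of b m] sq p2 q by linarith
    then show "\<bar>pos_square (u (z + h)) + pos_square (u (z - h)) - 2 * pos_square (u z)\<bar> \<le> 4 * (A * A) * (cmod h)\<^sup>2"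
      by (simp add: a_def m_def b_def)
  qed
qed

lemma locally_C11_norm_square: "locally_C11 (\<lambda>z. (cmod z)\<^sup>2 - c)"
  unfolding locally_C11_def
proof (intro allI)
  fix M :: real
  define C where "C = M\<^sup>2 + \<bar>c\<bar> + 2 * \<bar>M\<bar> + 2"
  have "\<bar>(cmod z)\<^sup>2 - c\<bar> \<le> C \<and> \<bar>((cmod (z + h))\<^sup>2 - c) - ((cmod z)\<^sup>2 - c)\<bar> \<le> C * cmod h \<and>
      \<bar>((cmod (z + h))\<^sup>2 - c) + ((cmod (z - h))\<^sup>2 - c) - 2 * ((cmod z)\<^sup>2 - c)\<bar> \<le> C * (cmod h)\<^sup>2"
    if "cmod z \<le> M \<and> cmod h \<le> 1" for z h :: complex
  proof (intro conjI)
    have z: "cmod z \<le> M" and h: "cmod h \<le> 1" using that by auto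
    have z2: "(cmod z)\<^sup>2 \<le> M\<^sup>2" using z by (intro power_mono) auto
    then show "\<bar>(cmod z)\<^sup>2 - c\<bar> \<le> C" unfolding C_def abs_le_iff by (smt (verit) zero_le_power2)
    have e: "(cmod (z + h))\<^sup>2 = (cmod z)\<^sup>2 + (cmod h)\<^sup>2 + 2 * (z \<bullet> h)" "(cmod (z - h))\<^sup>2 = (cmod z)\<^sup>2 + (cmod h)\<^sup>2 - 2 * (z \<bullet> h)"
      by (simp_all add: power2_norm_eq_inner inner_add_left inner_add_right inner_diff_left inner_diff_right inner_commute)
    have "\<bar>z \<bullet> h\<bar> \<le> cmod z * cmod h" by (rule Cauchy_Schwarz_ineq2)
    also have "\<dots> \<le> \<bar>M\<bar> * cmod h" using z by (intro mult_right_mono) auto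
    finally have i: "\<bar>z \<bullet> h\<bar> \<le> \<bar>M\<bar> * cmod h" .
    have hh: "(cmod h)\<^sup>2 \<le> cmod h" using h by (simp add: mult_left_le power2_eq_square)
    have "0 \<le> (M\<^sup>2 + \<bar>c\<bar>) * cmod h" by simp
    then have "(2 * \<bar>M\<bar> + 1) * cmod h \<le> C * cmod h" unfolding C_def by (intro mult_right_mono) auto
    then show "\<bar>((cmod (z + h))\<^sup>2 - c) - ((cmod z)\<^sup>2 - c)\<bar> \<le> C * cmod h"
      unfolding e using i hh zero_le_power2[of "cmod h"] by (simp only: distrib_right abs_le_iff) linarith
    have "2 * (cmod h)\<^sup>2 \<le> C * (cmod h)\<^sup>2" unfolding C_def by (intro mult_right_mono) auto
    then show "\<bar>((cmod (z + h))\<^sup>2 - c) + ((cmod (z - h))\<^sup>2 - c) - 2 * ((cmod z)\<^sup>2 - c)\<bar> \<le> C * (cmod h)\<^sup>2"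
      unfolding e by simp
  qed
  moreover have "C \<ge> 0" unfolding C_def by simp
  ultimately show "\<exists>C\<ge>0. \<forall>z h. cmod z \<le> M \<and> cmod h \<le> 1 \<longrightarrow>
     \<bar>(cmod z)\<^sup>2 - c\<bar> \<le> C \<and> \<bar>((cmod (z + h))\<^sup>2 - c) - ((cmod z)\<^sup>2 - c)\<bar> \<le> C * cmod h \<and>
      \<bar>((cmod (z + h))\<^sup>2 - c) + ((cmod (z - h))\<^sup>2 - c) - 2 * ((cmod z)\<^sup>2 - c)\<bar> \<le> C * (cmod h)\<^sup>2"
    by blast
qed

lemma locally_C11_one_minus:
  assumes "locally_C11 u" shows "locally_C11 (\<lambda>z. 1 - u z)"
  unfolding locally_C11_def
proof (intro allI)
  fix M
  obtain A where A: "A \<ge> 0" "\<And>z. cmod z \<le> M \<Longrightarrow> \<bar>u z\<bar> \<le> A"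
    "\<And>z h. cmod z \<le> M \<Longrightarrow> cmod h \<le> 1 \<Longrightarrow> \<bar>u (z + h) - u z\<bar> \<le> A * cmod h"
    "\<And>z h. cmod z \<le> M \<Longrightarrow> cmod h \<le> 1 \<Longrightarrow> \<bar>u (z + h) + u (z - h) - 2 * u z\<bar> \<le> A * (cmod h)\<^sup>2"
    by (rule locally_C11D[OF assms(1), where M = M]) (rule that)
  have "\<bar>1 - u z\<bar> \<le> A + 1 \<and> \<bar>(1 - u (z + h)) - (1 - u z)\<bar> \<le> (A + 1) * cmod h \<and>
      \<bar>(1 - u (z + h)) + (1 - u (z - h)) - 2 * (1 - u z)\<bar> \<le> (A + 1) * (cmod h)\<^sup>2"
    if "cmod z \<le> M \<and> cmod h \<le> 1" for z h
  proof -
    have "0 \<le> cmod h" "0 \<le> (cmod h)\<^sup>2" by simp_all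
    moreover have "\<bar>u z\<bar> \<le> A" "\<bar>u (z + h) - u z\<bar> \<le> A * cmod h"
      "\<bar>u (z + h) + u (z - h) - 2 * u z\<bar> \<le> A * (cmod h)\<^sup>2"
      using A(2)[of z] A(3)[of z h] A(4)[of z h] that by auto
    moreover have "(1 - u (z + h)) + (1 - u (z - h)) - 2 * (1 - u z) = - (u (z + h) + u (z - h) - 2 * u z)" by simp
    ultimately show ?thesis unfolding distrib_right by (intro conjI; linarith)
  qed
  then show "\<exists>C\<ge>0. \<forall>z h. cmod z \<le> M \<and> cmod h \<le> 1 \<longrightarrow>
     \<bar>1 - u z\<bar> \<le> C \<and> \<bar>(1 - u (z + h)) - (1 - u z)\<bar> \<le> C * cmod h \<and>
      \<bar>(1 - u (z + h)) + (1 - u (z - h)) - 2 * (1 - u z)\<bar> \<le> C * (cmod h)\<^sup>2"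
    using A(1) by (intro exI[of _ "A + 1"]) auto
qed

text \<open>Both nested squares of positive parts preserve \<open>locally_C11\<close>. For
  \<open>R \<ge> 0\<close> the inner one vanishes when \<open>|z| \<le> R\<close> and is at least 1
  when \<open>|z| \<ge> R + 1\<close>, since then \<open>|z|^2 - R^2 \<ge> 1\<close>.\<close>

definition cutoff :: "real \<Rightarrow> complex \<Rightarrow> real" where
  "cutoff R z = pos_square (1 - pos_square ((cmod z)\<^sup>2 - R\<^sup>2))"

lemma cutoff_C11: "locally_C11 (cutoff R)"
  unfolding cutoff_def[abs_def]
  by (intro locally_C11_pos_square locally_C11_one_minus locally_C11_norm_square)

lemma cutoff_continuous: "continuous_on UNIV (cutoff R)"
  unfolding cutoff_def pos_square_def by (intro continuous_intros)

lemma cutoff_eq_1: "cmod z \<le> R \<Longrightarrow> cutoff R z = 1"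
  using power_mono[of "cmod z" R 2] by (simp add: cutoff_def pos_square_def)

lemma cutoff_eq_0:
  assumes "0 \<le> R" "R + 1 < cmod z" shows "cutoff R z = 0"
proof -
  have "(R + 1)\<^sup>2 \<le> (cmod z)\<^sup>2" using assms by (intro power_mono) auto
  then have "1 \<le> (cmod z)\<^sup>2 - R\<^sup>2" using assms(1) by (simp add: power2_sum)
  then have "1 \<le> ((cmod z)\<^sup>2 - R\<^sup>2)\<^sup>2" by (rule one_le_power)
  then show ?thesis using \<open>1 \<le> (cmod z)\<^sup>2 - R\<^sup>2\<close> by (simp add: cutoff_def pos_square_def)
qed

section \<open>Averages over the zeros of a polynomial\<close>

definition root_avg :: "complex poly \<Rightarrow> (complex \<Rightarrow> real) \<Rightarrow> real" where
  "root_avg p g = (\<Sum>y\<in>#proots p. g y) / degree p"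

text \<open>The cutoff equals 1 at all zeros, so it changes no average, and it supplies compact
  support. What matters is uniformity: \<open>C\<close> depends on \<open>g\<close> and
  \<open>R\<close> only, not on the two polynomials or their degrees.\<close>

lemma root_avg_comparison:
  assumes "C2 g" "R \<ge> 0"
  obtains C where "C > 0" "\<And>p q. degree p > 0 \<Longrightarrow> degree q > 0 \<Longrightarrow> (\<forall>y. poly p y = 0 \<longrightarrow> cmod y \<le> R) \<Longrightarrow>
    (\<forall>y. poly q y = 0 \<longrightarrow> cmod y \<le> R) \<Longrightarrow>
    ennreal \<bar>root_avg p g - root_avg q g\<bar> \<le> ennreal C * (\<integral>\<^sup>+z\<in>cball 0 (R + 2).
      ennreal \<bar>ln (cmod (poly p z)) / degree p - ln (cmod (poly q z)) / degree q\<bar> \<partial>lborel)"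
proof -
  define G where "G z = g z * cutoff R z" for z
  have C11: "locally_C11 G" unfolding G_def[abs_def]
    by (intro locally_C11_mult C2_imp_locally_C11 assms cutoff_C11)
  have cont: "continuous_on UNIV G" unfolding G_def[abs_def]
    by (intro continuous_intros C2_imp_continuous assms cutoff_continuous)
  have supp: "\<forall>z. cmod z > R + 1 \<longrightarrow> G z = 0" using cutoff_eq_0[OF assms(2)] by (simp add: G_def)
  obtain A where A: "A \<ge> 0"
    "\<And>z h. cmod z \<le> R + 2 \<Longrightarrow> cmod h \<le> 1 \<Longrightarrow> \<bar>G (z + h) + G (z - h) - 2 * G z\<bar> \<le> A * (cmod h)\<^sup>2"
    by (rule locally_C11D[OF C11, where M = "R + 2"]) (rule that)
  have fpd: "\<bar>four_point_diff e G z\<bar> \<le> A * e\<^sup>2" if e: "0 < e" "e \<le> 1" for e z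
  proof (cases "cmod z \<le> R + 2")
    case True
    have 1: "\<bar>G (z + of_real e) + G (z - of_real e) - 2 * G z\<bar> \<le> A * e\<^sup>2"
      using A(2)[OF True, of "of_real e"] e by simp
    have 2: "\<bar>G (z + \<i> * of_real e) + G (z - \<i> * of_real e) - 2 * G z\<bar> \<le> A * e\<^sup>2"
      using A(2)[OF True, of "\<i> * of_real e"] e by (simp add: norm_mult)
    have "four_point_diff e G z = ((G (z + of_real e) + G (z - of_real e) - 2 * G z)
      + (G (z + \<i> * of_real e) + G (z - \<i> * of_real e) - 2 * G z)) / 4"
      by (simp add: four_point_diff_def)
    then show ?thesis using 1 2 by (simp add: abs_le_iff)
  next
    case False
    then show ?thesis using four_point_diff_support[OF supp, of e z] e A(1) by simp
  qed
  \<comment> \<open>\<open>A + 1\<close> instead of \<open>A\<close> makes \<open>C\<close> strictly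
    positive.\<close>
  define C where "C = (A + 1) / reg_mass"
  show thesis
  proof (rule that[of C])
    show "C > 0" using A(1) reg_mass_pos by (simp add: C_def)
    fix p q :: "complex poly"
    assume deg: "degree p > 0" "degree q > 0" and p: "\<forall>y. poly p y = 0 \<longrightarrow> cmod y \<le> R"
      and q: "\<forall>y. poly q y = 0 \<longrightarrow> cmod y \<le> R"
    have p0: "p \<noteq> 0" "q \<noteq> 0" using deg by auto
    have ne: "proots p \<noteq> {#}" "proots q \<noteq> {#}"
      using deg size_proots_complex[of p] size_proots_complex[of q] by auto
    have Gg: "(\<Sum>y\<in>#proots p. G y) = (\<Sum>y\<in>#proots p. g y)" if "\<forall>y. poly p y = 0 \<longrightarrow> cmod y \<le> R" "p \<noteq> 0" for p
      by (intro arg_cong[of _ _ sum_mset] image_mset_cong) (use that in \<open>auto simp: G_def cutoff_eq_1\<close>)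
    \<comment> \<open>The leading coefficients contribute constants to the two normalised
      potentials; \<open>c\<close> is their difference, to which the comparison is
      insensitive.\<close>
    define c where "c = ln (cmod (lead_coeff q)) / degree q - ln (cmod (lead_coeff p)) / degree p"
    let ?I = "\<integral>\<^sup>+z\<in>cball 0 (R + 2). ennreal \<bar>ln (cmod (poly p z)) / degree p - ln (cmod (poly q z)) / degree q\<bar> \<partial>lborel"
    have "ennreal (reg_mass * \<bar>root_avg p g - root_avg q g\<bar>) \<le> ennreal A * (\<integral>\<^sup>+z\<in>cball 0 ((R + 1) + 1).
      ennreal \<bar>(\<Sum>y\<in>#proots p. ln (cmod (z - y))) / size (proots p)
        - (\<Sum>y\<in>#proots q. ln (cmod (z - y))) / size (proots q) - c\<bar> \<partial>lborel)"
      using potential_comparison[OF cont supp A(1) fpd ne, of c] p q p0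
      by (simp add: Gg size_proots_complex root_avg_def)
    also have "(\<integral>\<^sup>+z\<in>cball 0 ((R + 1) + 1). ennreal \<bar>(\<Sum>y\<in>#proots p. ln (cmod (z - y))) / size (proots p)
        - (\<Sum>y\<in>#proots q. ln (cmod (z - y))) / size (proots q) - c\<bar> \<partial>lborel) = ?I"
    proof (rule nn_integral_cong_AE)
      have "finite {z. poly p z = 0}" "finite {z. poly q z = 0}" using p0 poly_roots_finite by auto
      then have "{z. poly p z = 0} \<union> {z. poly q z = 0} \<in> null_sets lborel"
        by (intro finite_imp_null_set_lborel) simp
      then have "AE z in lborel. z \<notin> {z. poly p z = 0} \<union> {z. poly q z = 0}" by (rule AE_not_in)
      then show "AE z in lborel. ennreal \<bar>(\<Sum>y\<in>#proots p. ln (cmod (z - y))) / size (proots p)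
        - (\<Sum>y\<in>#proots q. ln (cmod (z - y))) / size (proots q) - c\<bar> * indicator (cball 0 ((R + 1) + 1)) z
        = ennreal \<bar>ln (cmod (poly p z)) / degree p - ln (cmod (poly q z)) / degree q\<bar> * indicator (cball 0 (R + 2)) z"
      proof eventually_elim
        case (elim z)
        then have "poly p z \<noteq> 0" "poly q z \<noteq> 0" by auto
        then show ?case
          by (simp add: ln_cmod_poly c_def size_proots_complex add_divide_distrib algebra_simps)
      qed
    qed
    also have "ennreal A * ?I \<le> ennreal (A + 1) * ?I" by (intro mult_right_mono ennreal_leI) auto
    finally have *: "ennreal (reg_mass * \<bar>root_avg p g - root_avg q g\<bar>) \<le> ennreal (A + 1) * ?I" .
    have "ennreal \<bar>root_avg p g - root_avg q g\<bar> = ennreal (1 / reg_mass) * ennreal (reg_mass * \<bar>root_avg p g - root_avg q g\<bar>)"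
      using reg_mass_pos by (subst ennreal_mult[symmetric]) auto
    also have "\<dots> \<le> ennreal (1 / reg_mass) * (ennreal (A + 1) * ?I)" by (intro mult_left_mono *) auto
    also have "\<dots> = ennreal C * ?I"
    proof -
      have "ennreal (1 / reg_mass) * ennreal (A + 1) = ennreal C"
        using A(1) reg_mass_pos unfolding C_def by (subst ennreal_mult[symmetric]) auto
      then show ?thesis by (simp only: mult.assoc[symmetric])
    qed
    finally show "ennreal \<bar>root_avg p g - root_avg q g\<bar> \<le> ennreal C * ?I" .
  qed
qed

section \<open>Growth of iterates\<close>

lemma poly_iterate_0 [simp]: "poly_iterate f 0 = [:0, 1:]"
  by (simp add: poly_iterate_def)

lemma poly_iterate_Suc: "poly_iterate f (Suc n) = pcompose f (poly_iterate f n)"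
  by (simp add: poly_iterate_def)

lemma poly_poly_iterate_Suc: "poly (poly_iterate f (Suc n)) z = poly f (poly (poly_iterate f n) z)"
  by (simp add: poly_iterate_Suc poly_pcompose)

lemma poly_poly_iterate_add:
  "poly (poly_iterate f (m + n)) z = poly (poly_iterate f m) (poly (poly_iterate f n) z)"
  by (induction m) (simp_all add: poly_poly_iterate_Suc)

lemma degree_poly_iterate: "degree (poly_iterate f n) = degree f ^ n"
  by (induction n) (simp_all add: poly_iterate_Suc degree_pcompose)

lemma pderiv_poly_iterate:
  "poly (pderiv (poly_iterate f n)) z = (\<Prod>l<n. poly (pderiv f) (poly (poly_iterate f l) z))"
  by (induction n) (simp_all add: pderiv_pCons poly_iterate_Suc pderiv_pcompose poly_pcompose)

section \<open>Logarithmic size of polynomial values\<close>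

lemma ln_plus_altdef: "ln_plus x = ln (max 1 (cmod x))"
  by (cases "x = 0") (auto simp: ln_plus_def max_def ln_ge_zero_iff)

text \<open>This rests on \<open>max 1 |a| \<le> max 1 |b| (1 + |a - b|)\<close>; the truncation at
  1 is what makes the bound independent of \<open>x\<close>.\<close>

lemma ln_plus_diff: "\<bar>ln_plus (x - w) - ln_plus x\<bar> \<le> ln (1 + cmod w)"
proof -
  have pos: "1 + cmod x > 0" for x by (simp add: add_pos_nonneg)
  have *: "ln_plus a \<le> ln_plus b + ln (1 + cmod (a - b))" for a b
  proof -
    have "cmod a \<le> cmod b + cmod (a - b)" using norm_triangle_ineq[of b "a - b"] by simp
    then have "max 1 (cmod a) \<le> max 1 (cmod b) + cmod (a - b)" by (smt (verit) norm_ge_zero)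
    also have "\<dots> \<le> max 1 (cmod b) + max 1 (cmod b) * cmod (a - b)"
      using mult_right_mono[of 1 "max 1 (cmod b)" "cmod (a - b)"] by simp
    also have "\<dots> = max 1 (cmod b) * (1 + cmod (a - b))" by (simp add: algebra_simps)
    finally have "ln_plus a \<le> ln (max 1 (cmod b) * (1 + cmod (a - b)))"
      unfolding ln_plus_altdef by (subst ln_le_cancel_iff) (auto intro!: mult_pos_pos add_pos_nonneg)
    also have "\<dots> = ln_plus b + ln (1 + cmod (a - b))"
      unfolding ln_plus_altdef using pos[of "a - b"] by (subst ln_mult) auto
    finally show ?thesis .
  qed
  show ?thesis using *[of "x - w" x] *[of x "x - w"] by simp
qed

lemma ln_le_ln_plus: "ln (cmod x) \<le> ln_plus x"
  by (simp add: ln_plus_def)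

lemma ln_cmod_poly_upper:
  fixes p :: "complex poly"
  assumes "p \<noteq> 0"
  obtains C where "C \<ge> 0" "\<And>x. poly p x \<noteq> 0 \<Longrightarrow> ln (cmod (poly p x)) \<le> degree p * ln_plus x + C"
proof -
  define C where "C = \<bar>ln (cmod (lead_coeff p))\<bar> + (\<Sum>y\<in>#proots p. ln (1 + cmod y))"
  have nn: "0 \<le> (\<Sum>y\<in>#M. ln (1 + cmod y))" for M :: "complex multiset"
    by (induction M) auto
  have "(\<Sum>y\<in>#M. ln (cmod (x - y))) \<le> size M * ln_plus x + (\<Sum>y\<in>#M. ln (1 + cmod y))" for M and x :: complex
  proof (induction M)
    case (add y M)
    have "ln (cmod (x - y)) \<le> ln_plus x + ln (1 + cmod y)"
      using ln_plus_diff[of x y] ln_le_ln_plus[of "x - y"] by linarith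
    then show ?case using add by (simp add: algebra_simps)
  qed simp
  from this[of _ "proots p"] show thesis
    by (intro that[of C]) (use nn[of "proots p"] in \<open>auto simp: ln_cmod_poly size_proots_complex C_def abs_le_iff intro: add_mono\<close>,
      smt (verit))
qed

text \<open>A factor with \<open>cmod (x - c) \<ge> \<delta>\<close> has modulus at least
  \<open>\<delta> max 1 |x| / (2 + 2 |c|)\<close>. Closeness to the zeros thus costs only a multiple
  of \<open>ln \<delta>\<close> against the full growth in \<open>ln_plus x\<close>.\<close>

lemma ln_cmod_poly_lower:
  fixes p :: "complex poly"
  assumes "p \<noteq> 0"
  obtains C where "C \<ge> 0" "\<And>x \<delta>. 0 < \<delta> \<Longrightarrow> \<delta> \<le> 1 \<Longrightarrow> (\<And>c. poly p c = 0 \<Longrightarrow> \<delta> \<le> cmod (x - c)) \<Longrightarrow>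
    degree p * (ln_plus x + ln \<delta>) - C \<le> ln (cmod (poly p x))"
proof -
  define C where "C = \<bar>ln (cmod (lead_coeff p))\<bar> + (\<Sum>y\<in>#proots p. ln (2 + 2 * cmod y))"
  have nn: "0 \<le> (\<Sum>y\<in>#M. ln (2 + 2 * cmod y))" for M :: "complex multiset"
    by (induction M) auto
  have one: "ln_plus x + ln \<delta> - ln (2 + 2 * cmod c) \<le> ln (cmod (x - c))"
    if d: "0 < \<delta>" "\<delta> \<le> 1" "\<delta> \<le> cmod (x - c)" for x c :: complex and \<delta>
  proof -
    have pos: "2 + 2 * cmod c > 0" by (simp add: add_pos_nonneg)
    \<comment> \<open>Either \<open>x\<close> is so large that \<open>cmod (x - c)\<close> is at
      least half of \<open>cmod x\<close>, or \<open>max 1 (cmod x)\<close> is already bounded by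
      \<open>2 + 2 * cmod c\<close>.\<close>
    have "\<delta> * max 1 (cmod x) \<le> cmod (x - c) * (2 + 2 * cmod c)"
    proof (cases "2 * cmod c \<le> cmod x \<and> 1 \<le> cmod x")
      case True
      then have "cmod x / 2 \<le> cmod (x - c)" using norm_triangle_ineq2[of x c] by simp
      have "\<delta> * max 1 (cmod x) \<le> 1 * cmod x" using True d by (intro mult_mono) auto
      also have "\<dots> \<le> cmod (x - c) * 2" using \<open>cmod x / 2 \<le> cmod (x - c)\<close> by simp
      also have "\<dots> \<le> cmod (x - c) * (2 + 2 * cmod c)" by (intro mult_left_mono) auto
      finally show ?thesis .
    next
      case False
      then have "max 1 (cmod x) \<le> 2 + 2 * cmod c" by (smt (verit) norm_ge_zero)
      then show ?thesis using d by (intro mult_mono) auto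
    qed
    then have "ln (\<delta> * max 1 (cmod x)) \<le> ln (cmod (x - c) * (2 + 2 * cmod c))"
      using d pos by (subst ln_le_cancel_iff) (auto intro!: mult_pos_pos)
    moreover have "ln (\<delta> * max 1 (cmod x)) = ln \<delta> + ln_plus x"
      using d by (simp add: ln_plus_altdef ln_mult)
    moreover have "ln (cmod (x - c) * (2 + 2 * cmod c)) = ln (cmod (x - c)) + ln (2 + 2 * cmod c)"
      using d pos by (subst ln_mult) auto
    ultimately show ?thesis by simp
  qed
  have sum: "size M * (ln_plus x + ln \<delta>) - (\<Sum>y\<in>#M. ln (2 + 2 * cmod y)) \<le> (\<Sum>y\<in>#M. ln (cmod (x - y)))"
    if d: "0 < \<delta>" "\<delta> \<le> 1" "\<And>c. c \<in># M \<Longrightarrow> \<delta> \<le> cmod (x - c)" for M and x :: complex and \<delta>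
    using d(3)
  proof (induction M)
    case (add y M)
    have "ln_plus x + ln \<delta> - ln (2 + 2 * cmod y) \<le> ln (cmod (x - y))"
      using one[OF d(1,2)] add by simp
    then show ?case using add by (simp add: algebra_simps)
  qed simp
  show thesis
  proof (rule that[of C])
    show "C \<ge> 0" using nn by (simp add: C_def)
    fix x \<delta> assume d: "0 < \<delta>" "\<delta> \<le> 1" "\<And>c. poly p c = 0 \<Longrightarrow> \<delta> \<le> cmod (x - c)"
    then have "poly p x \<noteq> 0" by force
    then show "degree p * (ln_plus x + ln \<delta>) - C \<le> ln (cmod (poly p x))"
      using sum[of \<delta> "proots p" x] d assms by (simp add: ln_cmod_poly C_def size_proots_complex)
  qed
qed

lemma ln_plus_poly:
  fixes p :: "complex poly"
  assumes "p \<noteq> 0"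
  obtains C where "C \<ge> 0" "\<And>x. \<bar>ln_plus (poly p x) - degree p * ln_plus x\<bar> \<le> C"
proof -
  obtain C1 where C1: "C1 \<ge> 0" "\<And>x. poly p x \<noteq> 0 \<Longrightarrow> ln (cmod (poly p x)) \<le> degree p * ln_plus x + C1"
    using ln_cmod_poly_upper[OF assms] by blast
  obtain C2 where C2: "C2 \<ge> 0" "\<And>x \<delta>. 0 < \<delta> \<Longrightarrow> \<delta> \<le> 1 \<Longrightarrow> (\<And>c. poly p c = 0 \<Longrightarrow> \<delta> \<le> cmod (x - c)) \<Longrightarrow>
    degree p * (ln_plus x + ln \<delta>) - C2 \<le> ln (cmod (poly p x))"
    using ln_cmod_poly_lower[OF assms] by metis
  obtain M where M: "M \<ge> 1" "\<And>c. poly p c = 0 \<Longrightarrow> cmod c \<le> M"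
  proof -
    have "finite (cmod ` {c. poly p c = 0})" using assms poly_roots_finite by blast
    then have "bdd_above (cmod ` {c. poly p c = 0})" by (rule bdd_above_finite)
    then obtain M where "\<forall>y\<in>cmod ` {c. poly p c = 0}. y \<le> M" unfolding bdd_above_def by blast
    then show thesis by (intro that[of "max 1 M"]) (auto simp: le_max_iff_disj)
  qed
  define C where "C = C1 + C2 + degree p * ln (1 + M)"
  have C: "C1 \<le> C" "C2 \<le> C" "degree p * ln (1 + M) \<le> C" using C1(1) C2(1) M(1) by (auto simp: C_def)
  show thesis
  proof (rule that[of C])
    show "C \<ge> 0" using C C1(1) by simp
    fix x
    have "ln_plus (poly p x) \<le> degree p * ln_plus x + C1"
    proof (cases "poly p x = 0")
      case True
      then show ?thesis using C1(1) by (simp add: ln_plus_def)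
    next
      case False
      then show ?thesis using C1(1) C1(2)[OF False] by (simp add: ln_plus_def[of "poly p x"])
    qed
    moreover have "degree p * ln_plus x - ln_plus (poly p x) \<le> C"
    \<comment> \<open>Within distance 1 of a zero \<open>ln_plus x\<close> is itself bounded;
      elsewhere the lower bound applies with \<open>\<delta> = 1\<close>, whose logarithm
      vanishes.\<close>
    proof (cases "\<exists>c. poly p c = 0 \<and> cmod (x - c) < 1")
      case True
      then obtain c where c: "poly p c = 0" "cmod (x - c) < 1" by blast
      have "cmod x \<le> cmod (x - c) + cmod c" using norm_triangle_ineq[of "x - c" c] by simp
      then have "max 1 (cmod x) \<le> 1 + M" using M(2)[OF c(1)] c(2) M(1) by simp
      then have "ln_plus x \<le> ln (1 + M)" unfolding ln_plus_altdef by (subst ln_le_cancel_iff) (use M in auto)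
      then have "degree p * ln_plus x \<le> degree p * ln (1 + M)" by (intro mult_left_mono) auto
      then show ?thesis using C(3) ln_plus_nonneg[of "poly p x"] by linarith
    next
      case False
      then have "degree p * (ln_plus x + ln 1) - C2 \<le> ln (cmod (poly p x))"
        by (intro C2(2)) (auto simp: not_less)
      then show ?thesis using C(2) ln_le_ln_plus[of "poly p x"] by simp
    qed
    ultimately show "\<bar>ln_plus (poly p x) - degree p * ln_plus x\<bar> \<le> C"
      using C(1) by (simp add: abs_le_iff)
  qed
qed

text \<open>\<open>R \<ge> 2\<close> makes \<open>2 R\<close> exceed \<open>R + 1\<close>, so a
  point outside the disc of radius \<open>R\<close> has left the slightly larger disc one step
  later. \<open>growth_deriv\<close> traps the zeros of \<open>(f^n)' - a\<close> in the disc of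
  radius \<open>R\<close> once \<open>2^n\<close> exceeds \<open>cmod a\<close>.\<close>

locale escaping_poly =
  fixes f :: "complex poly" and R :: real
  assumes deg: "degree f > 1" and R: "R \<ge> 2"
    and growth: "\<And>z. R \<le> cmod z \<Longrightarrow> 2 * cmod z \<le> cmod (poly f z)"
    and growth_deriv: "\<And>z. R \<le> cmod z \<Longrightarrow> 2 \<le> cmod (poly (pderiv f) z)"

lemma escaping_poly_exists:
  assumes "degree f > 1" obtains R where "escaping_poly f R"
proof -
  obtain a p where fp: "f = pCons a p" by (cases f) auto
  obtain b q where pq: "p = pCons b q" by (cases p) auto
  have q: "q \<noteq> 0" using assms by (auto simp: fp pq split: if_splits)
  obtain a' p' where fp': "pderiv f = pCons a' p'" by (cases "pderiv f") auto
  have "degree (pderiv f) = degree f - 1" by (rule degree_pderiv)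
  then have p': "p' \<noteq> 0" using assms by (auto simp: fp')
  obtain r1 where r1: "\<And>z. r1 \<le> cmod z \<Longrightarrow> 3 \<le> cmod (poly p z)"
    using poly_infinity[OF q, of 3 b] by (auto simp: pq)
  obtain r2 where r2: "\<And>z. r2 \<le> cmod z \<Longrightarrow> 2 \<le> cmod (poly (pderiv f) z)"
    using poly_infinity[OF p', of 2 a'] by (auto simp: fp')
  show thesis
  proof (rule that[of "max 2 (max (cmod a) (max r1 r2))"], unfold_locales)
    fix z assume z: "max 2 (max (cmod a) (max r1 r2)) \<le> cmod z"
    have "cmod z * 3 \<le> cmod z * cmod (poly p z)" using r1[of z] z by (intro mult_left_mono) auto
    also have "\<dots> = cmod (z * poly p z)" by (simp add: norm_mult)
    also have "\<dots> \<le> cmod (poly f z) + cmod a"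
      using norm_triangle_ineq4[of "poly f z" a] by (simp add: fp)
    finally show "2 * cmod z \<le> cmod (poly f z)" using z by simp
    show "2 \<le> cmod (poly (pderiv f) z)" using r2[of z] z by simp
  qed (use assms in auto)
qed

context escaping_poly
begin

abbreviation F :: "nat \<Rightarrow> complex poly" where "F n \<equiv> poly_iterate f n"

lemma f_nonzero: "f \<noteq> 0" "pderiv f \<noteq> 0"
  using deg by (auto simp: pderiv_eq_0_iff)

lemma degree_F: "degree (F n) = degree f ^ n" "degree (F n) > 0"
  using deg by (auto simp: degree_poly_iterate)

lemma F_growth: "R \<le> cmod z \<Longrightarrow> 2 ^ n * cmod z \<le> cmod (poly (F n) z)"
proof (induction n)
  case (Suc n)
  then have IH: "2 ^ n * cmod z \<le> cmod (poly (F n) z)" by simp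
  have "1 * cmod z \<le> 2 ^ n * cmod z" by (intro mult_right_mono) auto
  then have "R \<le> cmod (poly (F n) z)" using IH Suc.prems by linarith
  then have "2 * cmod (poly (F n) z) \<le> cmod (poly (F (Suc n)) z)"
    unfolding poly_poly_iterate_Suc by (rule growth)
  then show ?case using IH by simp
qed simp

lemma F_growth_ge: "R \<le> cmod z \<Longrightarrow> cmod z \<le> cmod (poly (F n) z)"
  using F_growth[of z n] mult_right_mono[of 1 "2 ^ n" "cmod z"] by simp

lemma F_deriv_growth:
  assumes "R \<le> cmod z" shows "2 ^ n \<le> cmod (poly (pderiv (F n)) z)"
proof -
  have "(\<Prod>l<n. 2) \<le> (\<Prod>l<n. cmod (poly (pderiv f) (poly (F l) z)))"
    by (intro prod_mono) (use F_growth_ge[OF assms] growth_deriv assms in \<open>auto intro: order_trans\<close>)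
  then show ?thesis by (simp add: pderiv_poly_iterate prod_norm)
qed

text \<open>One fixed bound for the one-step defect in the functional equation of the Green function
  of the filled Julia set, which is the limit of \<open>ln_plus (f^n) / d^n\<close>.\<close>

definition green_const :: real where
  "green_const = (SOME C. C \<ge> 0 \<and> (\<forall>x. \<bar>ln_plus (poly f x) - degree f * ln_plus x\<bar> \<le> C))"

lemma green_const: "green_const \<ge> 0" "\<bar>ln_plus (poly f x) - degree f * ln_plus x\<bar> \<le> green_const"
proof -
  have "\<exists>C. C \<ge> 0 \<and> (\<forall>x. \<bar>ln_plus (poly f x) - degree f * ln_plus x\<bar> \<le> C)"
    using ln_plus_poly[OF f_nonzero(1)] by metis
  from someI_ex[OF this] show "green_const \<ge> 0" "\<bar>ln_plus (poly f x) - degree f * ln_plus x\<bar> \<le> green_const"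
    unfolding green_const_def by auto
qed

text \<open>The step from time \<open>j\<close> to \<open>j + 1\<close> contributes at most
  \<open>green_const / d^(j + 1)\<close>. The factor \<open>1 - 1 / d^k\<close> is the induction
  invariant that sums this geometric series, using \<open>d \<ge> 2\<close>.\<close>

lemma green_cauchy:
  "\<bar>ln_plus (poly (F (n + k)) z) / real (degree f) ^ (n + k) - ln_plus (poly (F n) z) / real (degree f) ^ n\<bar>
    \<le> green_const * (1 - 1 / real (degree f) ^ k) / real (degree f) ^ n"
proof (induction k)
  case (Suc k)
  let ?d = "real (degree f)"
  let ?a = "\<lambda>n. ln_plus (poly (F n) z) / ?d ^ n"
  have d: "?d \<ge> 2" using deg by simp
  have "\<bar>?a (n + Suc k) - ?a (n + k)\<bar> = \<bar>ln_plus (poly f (poly (F (n + k)) z)) - ?d * ln_plus (poly (F (n + k)) z)\<bar> / ?d ^ (n + Suc k)"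
  proof -
    have 1: "?a (n + k) = ?d * ln_plus (poly (F (n + k)) z) / ?d ^ (n + Suc k)" using d by simp
    have 2: "poly (F (n + Suc k)) z = poly f (poly (F (n + k)) z)" by (simp add: poly_poly_iterate_Suc)
    show ?thesis unfolding 1 2 diff_divide_distrib[symmetric] abs_divide using d by simp
  qed
  also have "\<dots> \<le> green_const / ?d ^ (n + Suc k)" using green_const d by (intro divide_right_mono) auto
  finally have "\<bar>?a (n + Suc k) - ?a n\<bar> \<le> green_const / ?d ^ (n + Suc k) + green_const * (1 - 1 / ?d ^ k) / ?d ^ n"
    using Suc by linarith
  also have "\<dots> = green_const * (1 / ?d ^ Suc k + (1 - 1 / ?d ^ k)) / ?d ^ n"
    using d by (simp add: power_add field_simps)
  also have "\<dots> \<le> green_const * (1 - 1 / ?d ^ Suc k) / ?d ^ n"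
  proof -
    have "2 / ?d ^ Suc k \<le> ?d / ?d ^ Suc k" using d by (intro divide_right_mono) auto
    also have "\<dots> = 1 / ?d ^ k" using d by simp
    finally have "1 / ?d ^ Suc k + (1 - 1 / ?d ^ k) \<le> 1 - 1 / ?d ^ Suc k" by simp
    then show ?thesis using green_const(1) d by (intro divide_right_mono mult_left_mono) auto
  qed
  finally show ?case .
qed simp

lemma green_cauchy':
  "\<bar>ln_plus (poly (F (n + k)) z) / real (degree f) ^ (n + k) - ln_plus (poly (F n) z) / real (degree f) ^ n\<bar>
    \<le> green_const / real (degree f) ^ n"
proof -
  have "green_const * (1 - 1 / real (degree f) ^ k) \<le> green_const * 1"
    using green_const(1) by (intro mult_left_mono) auto
  then have "green_const * (1 - 1 / real (degree f) ^ k) / real (degree f) ^ n \<le> green_const / real (degree f) ^ n"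
    by (intro divide_right_mono) auto
  then show ?thesis using green_cauchy[of n k z] by linarith
qed

lemma ln_plus_F_le: "ln_plus (poly (F n) z) \<le> real (degree f) ^ n * (ln_plus z + green_const)"
  using green_cauchy'[of 0 n z] deg by (simp add: abs_le_iff field_simps)

text \<open>By the chain rule the logarithm of the derivative is a sum over the orbit. Since
  \<open>f'\<close> has degree \<open>d - 1\<close>, each summand is at most
  \<open>ln_plus (f x) - ln_plus x\<close> plus a constant, and the sum telescopes.\<close>

lemma ln_plus_deriv_F_upper:
  obtains C where "C \<ge> 0" "\<And>n z. ln_plus (poly (pderiv (F n)) z) \<le> ln_plus (poly (F n) z) + C * real n"
proof -
  obtain C1 where C1: "C1 \<ge> 0" "\<And>x. poly (pderiv f) x \<noteq> 0 \<Longrightarrow> ln (cmod (poly (pderiv f) x)) \<le> degree (pderiv f) * ln_plus x + C1"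
    using ln_cmod_poly_upper[OF f_nonzero(2)] by blast
  define C where "C = C1 + green_const"
  have dd: "real (degree (pderiv f)) = real (degree f) - 1" using deg by (simp add: degree_pderiv)
  have step: "ln (cmod (poly (pderiv f) x)) \<le> ln_plus (poly f x) - ln_plus x + C" if "poly (pderiv f) x \<noteq> 0" for x
    using C1(2)[OF that] green_const(2)[of x] unfolding dd C_def by (simp add: abs_le_iff algebra_simps)
  have "ln (cmod (poly (pderiv (F n)) z)) \<le> ln_plus (poly (F n) z) + C * real n" if "poly (pderiv (F n)) z \<noteq> 0" for n z
  proof -
    have nz: "poly (pderiv f) (poly (F l) z) \<noteq> 0" if "l < n" for l
      using \<open>poly (pderiv (F n)) z \<noteq> 0\<close> that by (auto simp: pderiv_poly_iterate)
    have "ln (cmod (poly (pderiv (F n)) z)) = (\<Sum>l<n. ln (cmod (poly (pderiv f) (poly (F l) z))))"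
      unfolding pderiv_poly_iterate prod_norm[symmetric] by (subst ln_prod) (use nz in auto)
    also have "\<dots> \<le> (\<Sum>l<n. (ln_plus (poly (F (Suc l)) z) - ln_plus (poly (F l) z)) + C)"
      unfolding poly_poly_iterate_Suc by (intro sum_mono step) (use nz in auto)
    also have "\<dots> = ln_plus (poly (F n) z) - ln_plus z + C * real n"
      using sum_lessThan_telescope[of "\<lambda>l. ln_plus (poly (F l) z)" n] by (simp add: sum.distrib)
    finally show ?thesis using ln_plus_nonneg[of z] by linarith
  qed
  then have "ln_plus (poly (pderiv (F n)) z) \<le> ln_plus (poly (F n) z) + C * real n" for n z
    using C1(1) green_const(1) by (cases "poly (pderiv (F n)) z = 0")
      (auto simp: ln_plus_def[of "poly (pderiv (F n)) z"] ln_plus_def[of 0] C_def)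
  then show thesis using C1(1) green_const(1) by (intro that[of C]) (auto simp: C_def)
qed

end

section \<open>Derivatives of iterates near escaping critical points\<close>

context escaping_poly
begin

lemma fibre_finite: "finite {y. poly (F n) y = c}" "card {y. poly (F n) y = c} \<le> degree f ^ n"
proof -
  define p where "p = F n - [:c:]"
  have eq: "{y. poly (F n) y = c} = {y. poly p y = 0}" by (auto simp: p_def)
  have dp: "degree p = degree (F n)"
    unfolding p_def diff_conv_add_uminus using degree_F(2)[of n] by (intro degree_add_eq_left) simp
  have "p \<noteq> 0" using dp degree_F(2)[of n] by auto
  then show "finite {y. poly (F n) y = c}" "card {y. poly (F n) y = c} \<le> degree f ^ n"
    unfolding eq using poly_roots_finite[of p] card_poly_roots_bound[of p] dp degree_F(1) by auto
qed

lemma degree_F_minus: "degree (F n - [:c:]) = degree f ^ n"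
proof -
  have "degree (F n - [:c:]) = degree (F n)"
    unfolding diff_conv_add_uminus using degree_F(2)[of n] by (intro degree_add_eq_left) simp
  then show ?thesis by (simp add: degree_F(1))
qed

lemma lead_coeff_F_minus: "lead_coeff (F n - [:c:]) = lead_coeff (F n)"
proof -
  have "coeff [:c:] (degree (F n)) = 0" using degree_F(2)[of n] by (intro coeff_eq_0) simp
  then show ?thesis using degree_F_minus[of n c] degree_F(1)[of n] by simp
qed

text \<open>While \<open>L^k |x - c| \<le> 1\<close> the two orbits stay within distance 1, hence in
  the disc where \<open>f\<close> has Lipschitz constant \<open>L\<close>, so the estimate
  propagates. Contrapositively, a point outside the disc of radius \<open>R + 1\<close> at time
  \<open>k\<close> started farther than \<open>L^-k\<close> from \<open>c\<close>.\<close>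

lemma bounded_orbit_neighbour:
  obtains L where "L > 1"
    "\<And>c x k. (\<And>i. cmod (poly (F i) c) \<le> R) \<Longrightarrow> L ^ k * cmod (x - c) \<le> 1 \<Longrightarrow> cmod (poly (F k) x) \<le> R + 1"
proof -
  have cont: "continuous_on UNIV (poly (pderiv f))" by (intro continuous_intros)
  obtain K where K: "K \<ge> 0" "\<And>z. cmod z \<le> R + 1 \<Longrightarrow> norm (poly (pderiv f) z) \<le> K"
    using continuous_bounded_cball[OF cont, where M = "R + 1"] by metis
  define L where "L = K + 2"
  have lip: "cmod (poly f x - poly f y) \<le> L * cmod (x - y)" if "x \<in> cball 0 (R + 1)" "y \<in> cball 0 (R + 1)" for x y
  proof -
    have "cmod (poly f x - poly f y) \<le> K * cmod (x - y)"
      by (rule field_differentiable_bound[of "cball 0 (R + 1)" "poly f" "poly (pderiv f)"])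
        (use that K in \<open>auto intro!: poly_DERIV DERIV_subset[OF poly_DERIV]\<close>)
    also have "\<dots> \<le> L * cmod (x - y)" by (intro mult_right_mono) (auto simp: L_def)
    finally show ?thesis .
  qed
  have L: "L \<ge> 1" using K(1) by (simp add: L_def)
  show thesis
  proof (rule that[of L])
    show "L > 1" using K(1) by (simp add: L_def)
    fix c x k assume c: "\<And>i. cmod (poly (F i) c) \<le> R" and x: "L ^ k * cmod (x - c) \<le> 1"
    have near: "cmod (poly (F k) x - poly (F k) c) \<le> L ^ k * cmod (x - c)" if "L ^ k * cmod (x - c) \<le> 1" for k
      using that
    proof (induction k)
      case (Suc k)
      have "L ^ k * cmod (x - c) \<le> L ^ Suc k * cmod (x - c)"
        using L by (intro mult_right_mono power_increasing) auto
      then have small: "L ^ k * cmod (x - c) \<le> 1" using Suc.prems by linarith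
      then have IH: "cmod (poly (F k) x - poly (F k) c) \<le> L ^ k * cmod (x - c)" by (rule Suc.IH)
      have "cmod (poly (F k) x) \<le> cmod (poly (F k) x - poly (F k) c) + cmod (poly (F k) c)"
        using norm_triangle_ineq[of "poly (F k) x - poly (F k) c" "poly (F k) c"] by simp
      then have "cmod (poly (F k) x) \<le> R + 1" using IH small c[of k] by linarith
      moreover have "cmod (poly (F k) c) \<le> R + 1" using c[of k] by linarith
      ultimately have "cmod (poly f (poly (F k) x) - poly f (poly (F k) c)) \<le> L * cmod (poly (F k) x - poly (F k) c)"
        by (intro lip) auto
      also have "\<dots> \<le> L * (L ^ k * cmod (x - c))" using IH L by (intro mult_left_mono) auto
      finally show ?case by (simp add: poly_poly_iterate_Suc mult.assoc)
    qed simp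
    have "cmod (poly (F k) x) \<le> cmod (poly (F k) x - poly (F k) c) + cmod (poly (F k) c)"
      using norm_triangle_ineq[of "poly (F k) x - poly (F k) c" "poly (F k) c"] by simp
    then show "cmod (poly (F k) x) \<le> R + 1" using near[OF x] x c[of k] by linarith
  qed
qed

lemma escaping_neighbourhood:
  assumes "cmod (poly (F k) c) > R"
  obtains r where "r > 0" "\<And>x i. cmod (x - c) < r \<Longrightarrow> 2 ^ i * R \<le> cmod (poly (F (i + k)) x)"
proof -
  have "open {x. cmod (poly (F k) x) > R}"
    by (intro open_Collect_less continuous_intros)
  then obtain r where r: "r > 0" "ball c r \<subseteq> {x. cmod (poly (F k) x) > R}"
    using assms open_contains_ball by blast
  have "2 ^ i * R \<le> cmod (poly (F (i + k)) x)" if "cmod (x - c) < r" for x i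
  proof -
    have "x \<in> ball c r" using that by (simp add: dist_norm norm_minus_commute)
    then have big: "R < cmod (poly (F k) x)" using r by auto
    then have "2 ^ i * R \<le> 2 ^ i * cmod (poly (F k) x)" by (intro mult_left_mono) auto
    also have "\<dots> \<le> cmod (poly (F i) (poly (F k) x))" using big by (intro F_growth) auto
    finally show ?thesis by (simp add: poly_poly_iterate_add)
  qed
  then show thesis using r that by blast
qed

text \<open>A critical point with bounded orbit is exponentially far from points about to escape,
  and an escaping one cannot be close, because its neighbours have escaped too early.\<close>

lemma critical_points_far_from_preimages:
  assumes esc: "cmod (poly (F k) c) > R"
  obtains r I K where "r > 0" "K \<ge> 0" "\<And>i x c'. I \<le> i \<Longrightarrow> cmod (poly (F i) x - c) < r \<Longrightarrow>
    poly (pderiv f) c' = 0 \<Longrightarrow> exp (- K * (real i + 1)) \<le> cmod (x - c')"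
proof -
  obtain r where r: "r > 0" "\<And>x i. cmod (x - c) < r \<Longrightarrow> 2 ^ i * R \<le> cmod (poly (F (i + k)) x)"
    using escaping_neighbourhood[OF esc] by metis
  obtain L where L: "L > 1"
    "\<And>c x k. (\<And>i. cmod (poly (F i) c) \<le> R) \<Longrightarrow> L ^ k * cmod (x - c) \<le> 1 \<Longrightarrow> cmod (poly (F k) x) \<le> R + 1"
    using bounded_orbit_neighbour by metis
  \<comment> \<open>The term \<open>(k + 1) ln L\<close> turns \<open>L^(1 + k + i)\<close> into
    \<open>exp (K (i + 1))\<close> for critical points with bounded orbit; the lower bound 1 serves
    the escaping ones.\<close>
  define K where "K = max 1 ((real k + 1) * ln L)"
  have K: "K \<ge> 1" "(real k + 1) * ln L \<le> K" by (auto simp: K_def)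
  define P where "P c' i \<longleftrightarrow> (\<forall>x. cmod (poly (F i) x - c) < r \<longrightarrow> exp (- K * (real i + 1)) \<le> cmod (x - c'))" for c' i
  have "eventually (P c') sequentially" for c'
  proof (cases "\<exists>k'. cmod (poly (F k') c') > R")
    case False
    then have bounded: "\<And>i. cmod (poly (F i) c') \<le> R" by (simp add: not_less)
    have "P c' i" for i
      unfolding P_def
    proof (intro allI impI)
      fix x assume x: "cmod (poly (F i) x - c) < r"
      \<comment> \<open>One iterate more than \<open>k\<close> brings the modulus to
        \<open>2 R\<close>, beyond the radius \<open>R + 1\<close> that a neighbour of a bounded
        orbit would respect.\<close>
      have "2 ^ 1 * R \<le> cmod (poly (F (1 + k)) (poly (F i) x))" using r(2)[OF x] .
      moreover have "poly (F (1 + k + i)) x = poly (F (1 + k)) (poly (F i) x)" by (rule poly_poly_iterate_add)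
      ultimately have "R + 1 < cmod (poly (F (1 + k + i)) x)" using R by simp
      then have "1 < L ^ (1 + k + i) * cmod (x - c')"
        using L(2)[OF bounded, of "1 + k + i" x] by fastforce
      then have "1 / L ^ (1 + k + i) < cmod (x - c')" using L(1) by (simp add: field_simps)
      moreover have "exp (- K * (real i + 1)) \<le> 1 / L ^ (1 + k + i)"
      proof -
        have "real (1 + k + i) * ln L \<le> ((real k + 1) * ln L) * (real i + 1)"
          using L(1) by (simp add: algebra_simps)
        also have "\<dots> \<le> K * (real i + 1)" using K by (intro mult_right_mono) auto
        finally have e1: "exp (real (1 + k + i) * ln L) \<le> exp (K * (real i + 1))" by simp
        have e2: "L ^ (1 + k + i) = exp (real (1 + k + i) * ln L)"
          using L(1) by (subst exp_of_nat_mult) simp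
        have "L ^ (1 + k + i) \<le> exp (K * (real i + 1))" unfolding e2 by (rule e1)
        moreover have "exp (- K * (real i + 1)) = 1 / exp (K * (real i + 1))"
          by (simp only: mult_minus_left exp_minus inverse_eq_divide)
        ultimately show ?thesis using L(1) by (simp add: frac_le del: exp_minus)
      qed
      ultimately show "exp (- K * (real i + 1)) \<le> cmod (x - c')" by linarith
    qed
    then show ?thesis by (intro always_eventually allI)
  next
    case True
    then obtain k' where "cmod (poly (F k') c') > R" by blast
    then obtain r' where r': "r' > 0" "\<And>x i. cmod (x - c') < r' \<Longrightarrow> 2 ^ i * R \<le> cmod (poly (F (i + k')) x)"
      using escaping_neighbourhood by metis
    have "eventually (\<lambda>i. exp (- (real i + 1)) \<le> r') sequentially"
    proof -
      have "(\<lambda>i. exp (- (real i + 1))) \<longlonglongrightarrow> 0" by real_asymp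
      then show ?thesis using r'(1) by (metis (mono_tags, lifting) eventually_mono less_imp_le order_tendstoD(2))
    qed
    moreover have "eventually (\<lambda>i. 2 ^ i * R > cmod c + r) sequentially"
    proof -
      have "filterlim (\<lambda>i. 2 ^ i * R) at_top sequentially" using R by real_asymp
      then show ?thesis by (simp add: filterlim_at_top_dense)
    qed
    then have "eventually (\<lambda>i. 2 ^ (i - k') * R > cmod c + r) sequentially"
      by (rule eventually_compose_filterlim) (rule filterlim_minus_const_nat_at_top)
    ultimately show ?thesis using eventually_ge_at_top[of k']
    proof eventually_elim
      case (elim i)
      show "P c' i" unfolding P_def
      proof (intro allI impI)
        fix x assume x: "cmod (poly (F i) x - c) < r"
        \<comment> \<open>A start near the escaping \<open>c'\<close> would make
          \<open>poly (F i) x\<close> larger than \<open>cmod c + r\<close>, incompatible with lying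
          within \<open>r\<close> of \<open>c\<close>.\<close>
        have "r' \<le> cmod (x - c')"
        proof (rule ccontr)
          assume "\<not> r' \<le> cmod (x - c')"
          then have "2 ^ (i - k') * R \<le> cmod (poly (F (i - k' + k')) x)" by (intro r'(2)) simp
          then have "2 ^ (i - k') * R \<le> cmod (poly (F i) x)" using elim by simp
          moreover have "cmod (poly (F i) x) \<le> cmod (poly (F i) x - c) + cmod c"
            using norm_triangle_ineq[of "poly (F i) x - c" c] by simp
          ultimately show False using x elim by linarith
        qed
        moreover have "exp (- K * (real i + 1)) \<le> exp (- (real i + 1))"
        proof -
          have "1 * (real i + 1) \<le> K * (real i + 1)" using K(1) by (intro mult_right_mono) auto
          then show ?thesis by (simp only: exp_le_cancel_iff mult_minus_left neg_le_iff_le mult_1)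
        qed
        ultimately show "exp (- K * (real i + 1)) \<le> cmod (x - c')" using elim by linarith
      qed
    qed
  qed
  moreover have "finite {c'. poly (pderiv f) c' = 0}" using f_nonzero poly_roots_finite by blast
  ultimately have "eventually (\<lambda>i. \<forall>c'\<in>{c'. poly (pderiv f) c' = 0}. P c' i) sequentially"
    by (intro eventually_ball_finite) auto
  then obtain I where I: "\<And>i c'. I \<le> i \<Longrightarrow> poly (pderiv f) c' = 0 \<Longrightarrow> P c' i"
    unfolding eventually_sequentially by blast
  show thesis
    by (rule that[of r K I]) (use r(1) K(1) I in \<open>auto simp: P_def\<close>)
qed

lemma deriv_lower_near_escaping:
  assumes esc: "cmod (poly (F k) c) > R"
  obtains r I K where "r > 0" "K \<ge> 0" "\<And>i x. I \<le> i \<Longrightarrow> cmod (poly (F i) x - c) < r \<Longrightarrow>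
    exp (- K * (real i + 1)) \<le> cmod (poly (pderiv f) x)"
proof -
  obtain r I K0 where r: "r > 0" "K0 \<ge> 0" "\<And>i x c'. I \<le> i \<Longrightarrow> cmod (poly (F i) x - c) < r \<Longrightarrow>
    poly (pderiv f) c' = 0 \<Longrightarrow> exp (- K0 * (real i + 1)) \<le> cmod (x - c')"
    using critical_points_far_from_preimages[OF esc] by metis
  obtain C where C: "C \<ge> 0" "\<And>x \<delta>. 0 < \<delta> \<Longrightarrow> \<delta> \<le> 1 \<Longrightarrow> (\<And>c. poly (pderiv f) c = 0 \<Longrightarrow> \<delta> \<le> cmod (x - c)) \<Longrightarrow>
    degree (pderiv f) * (ln_plus x + ln \<delta>) - C \<le> ln (cmod (poly (pderiv f) x))"
    using ln_cmod_poly_lower[OF f_nonzero(2)] by metis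
  define K where "K = degree (pderiv f) * K0 + C"
  show thesis
  proof (rule that[of r K I])
    show "r > 0" "K \<ge> 0" using r C by (auto simp: K_def)
    fix i x assume ix: "I \<le> i" "cmod (poly (F i) x - c) < r"
    define \<delta> where "\<delta> = exp (- K0 * (real i + 1))"
    have \<delta>: "0 < \<delta>" "\<delta> \<le> 1" using r(2) by (auto simp: \<delta>_def)
    have far: "\<delta> \<le> cmod (x - c')" if "poly (pderiv f) c' = 0" for c'
      using r(3)[OF ix that] by (simp add: \<delta>_def)
    then have nz: "poly (pderiv f) x \<noteq> 0" using \<delta>(1) by force
    have "- K * (real i + 1) \<le> degree (pderiv f) * ln \<delta> - C"
    proof -
      have "0 \<le> C * real i" using C(1) by simp
      then show ?thesis by (simp add: K_def \<delta>_def algebra_simps)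
    qed
    also have "\<dots> \<le> degree (pderiv f) * (ln_plus x + ln \<delta>) - C"
      by (intro diff_right_mono mult_left_mono) auto
    also have "\<dots> \<le> ln (cmod (poly (pderiv f) x))" by (rule C(2)[OF \<delta> far])
    finally have "exp (- K * (real i + 1)) \<le> exp (ln (cmod (poly (pderiv f) x)))" by simp
    then show "exp (- K * (real i + 1)) \<le> cmod (poly (pderiv f) x)" using nz by simp
  qed
qed

text \<open>Covers the last few iterates before reaching \<open>c\<close>, for which no derivative
  bound is available. The exponent \<open>\<beta> = d^-I\<close> is the worst over
  \<open>q \<le> I\<close>, and \<open>C \<le> t\<close> keeps \<open>C - t\<close> nonpositive, so
  that passing to this smaller exponent only weakens the bound.\<close>

lemma root_near_low_iterate:
  obtains \<beta> C where "\<beta> > 0" "C \<ge> 0" "\<And>q x c t. q \<le> I \<Longrightarrow> C \<le> t \<Longrightarrow> cmod (poly (F q) x - c) \<le> exp (- t) \<Longrightarrow>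
    \<exists>b. poly (F q) b = c \<and> cmod (x - b) \<le> exp (- \<beta> * t + C)"
proof -
  define \<alpha> where "\<alpha> = Min (insert 1 ((\<lambda>q. cmod (lead_coeff (F q))) ` {..I}))"
  have lc: "lead_coeff (F q) \<noteq> 0" for q using degree_F(2)[of q] by auto
  have \<alpha>: "\<alpha> > 0" "\<alpha> \<le> 1" "\<And>q. q \<le> I \<Longrightarrow> \<alpha> \<le> cmod (lead_coeff (F q))"
    unfolding \<alpha>_def using lc by (auto simp: Min_gr_iff intro!: min.coboundedI2 Min_le)
  define \<beta> where "\<beta> = 1 / real (degree f) ^ I"
  define C where "C = - ln \<alpha>"
  have C: "C \<ge> 0" "\<alpha> = exp (- C)" using \<alpha> by (auto simp: C_def)
  have \<beta>: "\<beta> > 0" "\<beta> \<le> 1" using deg by (auto simp: \<beta>_def)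
  show thesis
  proof (rule that[of \<beta> C])
    fix q x c t assume q: "q \<le> I" and t: "C \<le> t" and x: "cmod (poly (F q) x - c) \<le> exp (- t)"
    obtain b where b: "poly (F q - [:c:]) b = 0"
      "cmod (lead_coeff (F q - [:c:])) * cmod (x - b) ^ degree (F q - [:c:]) \<le> cmod (poly (F q - [:c:]) x)"
      using root_near_power[of "F q - [:c:]" x] deg by (auto simp: degree_F_minus)
    have "cmod (lead_coeff (F q)) * cmod (x - b) ^ (degree f ^ q) \<le> exp (- t)"
      using b(2)[unfolded lead_coeff_F_minus, unfolded degree_F_minus] x by simp
    moreover have "\<alpha> * cmod (x - b) ^ (degree f ^ q) \<le> cmod (lead_coeff (F q)) * cmod (x - b) ^ (degree f ^ q)"
      using \<alpha>(3)[OF q] by (intro mult_right_mono) auto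
    ultimately have "exp (- C) * cmod (x - b) ^ (degree f ^ q) \<le> exp (- t)" using C by simp
    then have le: "cmod (x - b) ^ (degree f ^ q) \<le> exp (C - t)"
      by (simp add: exp_diff exp_minus field_simps)
    have "cmod (x - b) \<le> exp (\<beta> * (C - t))"
    proof (rule ccontr)
      assume "\<not> cmod (x - b) \<le> exp (\<beta> * (C - t))"
      then have "exp (\<beta> * (C - t)) ^ (degree f ^ q) < cmod (x - b) ^ (degree f ^ q)"
        using deg by (intro power_strict_mono) auto
      moreover have "exp (\<beta> * (C - t)) ^ (degree f ^ q) = exp (real (degree f ^ q) * \<beta> * (C - t))"
        by (simp add: exp_of_nat_mult[symmetric] mult.assoc)
      moreover have "real (degree f ^ q) * \<beta> \<le> 1"
      proof -
        have "real (degree f) ^ q \<le> real (degree f) ^ I" using q deg by (intro power_increasing) auto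
        then show ?thesis using deg by (simp add: \<beta>_def)
      qed
      then have "1 * (C - t) \<le> real (degree f ^ q) * \<beta> * (C - t)"
        using t by (intro mult_right_mono_neg) auto
      ultimately have "exp (C - t) < cmod (x - b) ^ (degree f ^ q)" by (metis exp_le_cancel_iff mult_1 order_le_less_trans)
      then show False using le by linarith
    qed
    moreover have "\<beta> * (C - t) \<le> - \<beta> * t + C"
      using mult_right_mono[OF \<beta>(2) C(1)] by (simp add: algebra_simps)
    ultimately have "cmod (x - b) \<le> exp (- \<beta> * t + C)" by (meson exp_le_cancel_iff order_trans)
    then show "\<exists>b. poly (F q) b = c \<and> cmod (x - b) \<le> exp (- \<beta> * t + C)" using b(1) by (intro exI[of _ b]) simp
  qed (use \<beta> C in auto)
qed

text \<open>A Newton estimate. The derivative along the orbit is no smaller than an exponential of a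
  quadratic in \<open>n\<close>, so a deviation \<open>exp (- n^3)\<close> in the image becomes at
  most \<open>exp (- n^2)\<close> in the source; the cubic exponent absorbs this loss and the degree
  \<open>d^n\<close>.\<close>

lemma preimages_near_escaping:
  assumes esc: "cmod (poly (F k) c) > R"
  shows "eventually (\<lambda>n. \<forall>j\<le>n. \<forall>z. cmod (poly (F j) z - c) < exp (- (real n ^ 3)) \<longrightarrow>
    (\<exists>y. poly (F j) y = c \<and> cmod (z - y) \<le> exp (- (real n ^ 2)))) sequentially"
proof -
  obtain r I K where r: "r > 0" "K \<ge> 0" "\<And>i x. I \<le> i \<Longrightarrow> cmod (poly (F i) x - c) < r \<Longrightarrow>
    exp (- K * (real i + 1)) \<le> cmod (poly (pderiv f) x)"
    using deriv_lower_near_escaping[OF esc] by metis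
  obtain \<beta> C where \<beta>: "\<beta> > 0" "C \<ge> 0" "\<And>q x c t. q \<le> I \<Longrightarrow> C \<le> t \<Longrightarrow> cmod (poly (F q) x - c) \<le> exp (- t) \<Longrightarrow>
    \<exists>b. poly (F q) b = c \<and> cmod (x - b) \<le> exp (- \<beta> * t + C)"
    using root_near_low_iterate[of I] by metis
  define d where "d = real (degree f)"
  have d: "d \<ge> 2" using deg by (simp add: d_def)
  have "eventually (\<lambda>n. exp (- (real n ^ 3)) < r) sequentially"
  proof -
    have "(\<lambda>n. exp (- (real n ^ 3))) \<longlonglongrightarrow> 0" by real_asymp
    then show ?thesis using r(1) by (metis order_tendstoD(2))
  qed
  moreover have "eventually (\<lambda>n. C \<le> real n ^ 3) sequentially"
    by real_asymp
  moreover have "eventually (\<lambda>n. real n * ln d + (- \<beta> * real n ^ 3 + C) + K * (real n + 1) * real n \<le> - (real n ^ 2)) sequentially"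
    using \<beta>(1) by real_asymp
  ultimately show ?thesis
  proof eventually_elim
    case (elim n)
    show ?case
    proof (intro allI impI)
      fix j z assume j: "j \<le> n" and z: "cmod (poly (F j) z - c) < exp (- (real n ^ 3))"
      \<comment> \<open>\<open>F j\<close> is \<open>F q\<close> after \<open>F m\<close>. If
        \<open>m > 0\<close> then \<open>q = I\<close>, so each factor \<open>l < m\<close> in the
        derivative of \<open>F m\<close> still has at least \<open>I\<close> iterates ahead of it,
        as the derivative bound requires; \<open>F q\<close> is left to
        \<open>root_near_low_iterate\<close>.\<close>
      define q m where "q = min j I" and "m = j - q"
      have jm: "j = q + m" "q \<le> I" "m > 0 \<Longrightarrow> q = I" by (auto simp: q_def m_def)
      define w where "w = poly (F m) z"
      have "poly (F q) w = poly (F j) z" unfolding w_def jm(1) by (simp add: poly_poly_iterate_add)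
      then obtain b where b: "poly (F q) b = c" "cmod (w - b) \<le> exp (- \<beta> * real n ^ 3 + C)"
        using \<beta>(3)[OF jm(2), of "real n ^ 3" w c] elim z by auto
      have dlow: "exp (- K * (real n + 1) * real n) \<le> cmod (poly (pderiv (F m)) z)"
      proof -
        have "exp (- K * (real n + 1) * real n) \<le> exp (- K * (real n + 1)) ^ m"
        proof -
          have "real m * (K * (real n + 1)) \<le> real n * (K * (real n + 1))"
            using jm j r(2) by (intro mult_right_mono) auto
          then show ?thesis by (simp add: exp_of_nat_mult[symmetric] mult_ac)
        qed
        also have "\<dots> = (\<Prod>l<m. exp (- K * (real n + 1)))" by simp
        also have "\<dots> \<le> (\<Prod>l<m. cmod (poly (pderiv f) (poly (F l) z)))"
        proof (intro prod_mono conjI)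
          fix l assume l: "l \<in> {..<m}"
          have "poly (F (j - l)) (poly (F l) z) = poly (F j) z"
            using l jm by (simp flip: poly_poly_iterate_add)
          moreover have "I \<le> j - l" using l jm by auto
          ultimately have "exp (- K * (real (j - l) + 1)) \<le> cmod (poly (pderiv f) (poly (F l) z))"
            using r(3)[of "j - l" "poly (F l) z"] z elim by simp
          moreover have "exp (- K * (real n + 1)) \<le> exp (- K * (real (j - l) + 1))"
          proof -
            have "K * (real (j - l) + 1) \<le> K * (real n + 1)" using j r(2) by (intro mult_left_mono) auto
            then show ?thesis by simp
          qed
          ultimately show "exp (- K * (real n + 1)) \<le> cmod (poly (pderiv f) (poly (F l) z))" by linarith
        qed auto
        also have "\<dots> = cmod (poly (pderiv (F m)) z)" by (simp add: pderiv_poly_iterate prod_norm)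
        finally show ?thesis .
      qed
      \<comment> \<open>\<open>b\<close> is a point over \<open>c\<close> close to
        \<open>w = F m z\<close>; the zero of \<open>F m - b\<close> near \<open>z\<close> is the
        wanted preimage of \<open>c\<close>.\<close>
      obtain y where y: "poly (F m - [:b:]) y = 0"
        "cmod (z - y) * cmod (poly (pderiv (F m - [:b:])) z) \<le> degree (F m - [:b:]) * cmod (poly (F m - [:b:]) z)"
        using root_near_newton[of "F m - [:b:]" z] deg by (auto simp: degree_F_minus)
      have pd: "pderiv (F m - [:b:]) = pderiv (F m)" by (simp add: pderiv_diff pderiv_pCons)
      have "cmod (z - y) * exp (- K * (real n + 1) * real n) \<le> cmod (z - y) * cmod (poly (pderiv (F m)) z)"
        by (intro mult_left_mono dlow) auto
      also have "\<dots> \<le> d ^ m * cmod (w - b)"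
        using y(2) unfolding pd degree_F_minus by (simp add: w_def d_def)
      also have "\<dots> \<le> d ^ n * exp (- \<beta> * real n ^ 3 + C)"
        using b(2) d jm j by (intro mult_mono power_increasing) auto
      also have "\<dots> = exp (real n * ln d + (- \<beta> * real n ^ 3 + C))"
        using d by (simp add: exp_add exp_of_nat_mult)
      finally have "cmod (z - y) \<le> exp (real n * ln d + (- \<beta> * real n ^ 3 + C)) / exp (- K * (real n + 1) * real n)"
        by (simp add: field_simps)
      also have "\<dots> = exp (real n * ln d + (- \<beta> * real n ^ 3 + C) + K * (real n + 1) * real n)"
        by (simp add: exp_diff[symmetric])
      also have "\<dots> \<le> exp (- (real n ^ 2))" using elim by simp
      finally have "cmod (z - y) \<le> exp (- (real n ^ 2))" .
      moreover have "poly (F j) y = c"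
        using y(1) b(1) unfolding jm(1) by (simp add: poly_poly_iterate_add)
      ultimately show "\<exists>y. poly (F j) y = c \<and> cmod (z - y) \<le> exp (- (real n ^ 2))" by blast
    qed
  qed
qed

lemma emeasure_preimage_discs:
  assumes "finite A" "card A \<le> N" "r \<ge> 0"
  shows "emeasure lborel (\<Union>c\<in>A. \<Union>j<n. \<Union>y\<in>{y. poly (F j) y = c}. cball y r)
    \<le> ennreal (real N * real n * real (degree f) ^ n * (pi * r\<^sup>2))"
proof -
  have ball: "emeasure lborel (cball y r) = ennreal (pi * r\<^sup>2)" for y :: complex
    using assms(3) by (rule emeasure_cball_complex)
  have one: "emeasure lborel (\<Union>y\<in>{y. poly (F j) y = c}. cball y r) \<le> ennreal (real (degree f) ^ n * (pi * r\<^sup>2))"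
    if "j < n" for j c
  proof -
    have "emeasure lborel (\<Union>y\<in>{y. poly (F j) y = c}. cball y r) \<le> (\<Sum>y\<in>{y. poly (F j) y = c}. emeasure lborel (cball y r))"
      by (rule emeasure_subadditive_finite) (auto simp: fibre_finite)
    also have "\<dots> = ennreal (real (card {y. poly (F j) y = c}) * (pi * r\<^sup>2))"
      by (simp add: ball ennreal_of_nat_eq_real_of_nat ennreal_mult)
    also have "\<dots> \<le> ennreal (real (degree f) ^ n * (pi * r\<^sup>2))"
    proof (intro ennreal_leI mult_right_mono)
      have "real (card {y. poly (F j) y = c}) \<le> real (degree f ^ j)" using fibre_finite(2) by (simp only: of_nat_le_iff)
      also have "\<dots> \<le> real (degree f) ^ n" using that deg by (simp add: power_increasing)
      finally show "real (card {y. poly (F j) y = c}) \<le> real (degree f) ^ n" .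
    qed simp
    finally show ?thesis .
  qed
  have meas: "(\<Union>y\<in>{y. poly (F j) y = c}. cball y r) \<in> sets lborel" for j c
    by (intro sets.finite_UN fibre_finite) auto
  have two: "emeasure lborel (\<Union>j<n. \<Union>y\<in>{y. poly (F j) y = c}. cball y r)
    \<le> ennreal (real n * (real (degree f) ^ n * (pi * r\<^sup>2)))" for c
  proof -
    have "emeasure lborel (\<Union>j<n. \<Union>y\<in>{y. poly (F j) y = c}. cball y r)
      \<le> (\<Sum>j<n. emeasure lborel (\<Union>y\<in>{y. poly (F j) y = c}. cball y r))"
      by (rule emeasure_subadditive_finite) (use meas in auto)
    also have "\<dots> \<le> (\<Sum>j<n. ennreal (real (degree f) ^ n * (pi * r\<^sup>2)))" by (intro sum_mono one) auto
    finally show ?thesis by (simp add: ennreal_of_nat_eq_real_of_nat ennreal_mult)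
  qed
  have meas2: "(\<Union>j<n. \<Union>y\<in>{y. poly (F j) y = c}. cball y r) \<in> sets lborel" for c
    by (intro sets.finite_UN meas) auto
  have "emeasure lborel (\<Union>c\<in>A. \<Union>j<n. \<Union>y\<in>{y. poly (F j) y = c}. cball y r)
    \<le> (\<Sum>c\<in>A. emeasure lborel (\<Union>j<n. \<Union>y\<in>{y. poly (F j) y = c}. cball y r))"
    by (rule emeasure_subadditive_finite) (use assms(1) meas2 in auto)
  also have "\<dots> \<le> (\<Sum>c\<in>A. ennreal (real n * (real (degree f) ^ n * (pi * r\<^sup>2))))" by (intro sum_mono two)
  also have "\<dots> = ennreal (real (card A) * (real n * (real (degree f) ^ n * (pi * r\<^sup>2))))"
    by (simp add: ennreal_of_nat_eq_real_of_nat ennreal_mult)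
  also have "\<dots> \<le> ennreal (real N * (real n * (real (degree f) ^ n * (pi * r\<^sup>2))))"
    using assms(2) by (intro ennreal_leI mult_right_mono) auto
  finally show ?thesis by (simp add: mult.assoc)
qed

text \<open>Off \<open>X n\<close>, and where \<open>F n z\<close> is large, every
  \<open>F j z\<close> with \<open>j < n\<close> keeps distance \<open>exp (- n^3)\<close> from all
  critical points, so each of the \<open>n\<close> factors loses order \<open>n^3\<close>. On
  \<open>X n\<close> only the trivial bound \<open>d^n M0\<close> is available, but the area of
  \<open>X n\<close> is super-exponentially small.\<close>

lemma deriv_iterate_integral:
  obtains C where "C \<ge> 0" "eventually (\<lambda>n. (\<integral>\<^sup>+z\<in>cball 0 (R + 2). ennreal
    \<bar>ln_plus (poly (pderiv (F n)) z) - ln_plus (poly (F n) z)\<bar> \<partial>lborel) \<le> ennreal (C * real n ^ 4)) sequentially"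
proof -
  obtain Cu where Cu: "Cu \<ge> 0" "\<And>n z. ln_plus (poly (pderiv (F n)) z) \<le> ln_plus (poly (F n) z) + Cu * real n"
    using ln_plus_deriv_F_upper by metis
  obtain Cl where Cl: "Cl \<ge> 0" "\<And>x \<delta>. 0 < \<delta> \<Longrightarrow> \<delta> \<le> 1 \<Longrightarrow> (\<And>c. poly (pderiv f) c = 0 \<Longrightarrow> \<delta> \<le> cmod (x - c)) \<Longrightarrow>
    degree (pderiv f) * (ln_plus x + ln \<delta>) - Cl \<le> ln (cmod (poly (pderiv f) x))"
    using ln_cmod_poly_lower[OF f_nonzero(2)] by metis
  obtain L where L: "L > 1"
    "\<And>c x k. (\<And>i. cmod (poly (F i) c) \<le> R) \<Longrightarrow> L ^ k * cmod (x - c) \<le> 1 \<Longrightarrow> cmod (poly (F k) x) \<le> R + 1"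
    using bounded_orbit_neighbour by metis
  define d where "d = real (degree f)"
  have d: "d \<ge> 2" using deg by (simp add: d_def)
  have dd: "real (degree (pderiv f)) = d - 1" using deg by (simp add: degree_pderiv d_def)
  define A where "A = {c. poly (pderiv f) c = 0 \<and> (\<exists>k. cmod (poly (F k) c) > R)}"
  have finA: "finite A" unfolding A_def using poly_roots_finite[OF f_nonzero(2)] by (rule rev_finite_subset) auto
  define X where "X n = (\<Union>c\<in>A. \<Union>j<n. \<Union>y\<in>{y. poly (F j) y = c}. cball y (exp (- (real n ^ 2))))" for n
  have measX: "X n \<in> sets lborel" for n
    unfolding X_def by (intro sets.finite_UN finA finite_lessThan fibre_finite) auto
  define M0 where "M0 = ln (R + 2) + green_const"
  have M0: "M0 \<ge> 0" "ln (R + 2) \<ge> 0" using R green_const(1) by (auto simp: M0_def)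
  define C3 where "C3 = M0 + (d - 1) + Cl"
  have C3: "C3 \<ge> 0" using M0 d Cl by (simp add: C3_def)
  define C4 where "C4 = C3 + Cu"
  have C4: "C4 \<ge> 0" using C3 Cu by (simp add: C4_def)
  have lnz: "ln_plus z \<le> ln (R + 2)" if "z \<in> cball 0 (R + 2)" for z
    unfolding ln_plus_altdef using that R by (subst ln_le_cancel_iff) auto
  have ev1: "eventually (\<lambda>n. \<forall>c\<in>A. \<forall>j\<le>n. \<forall>z. cmod (poly (F j) z - c) < exp (- (real n ^ 3)) \<longrightarrow>
    (\<exists>y. poly (F j) y = c \<and> cmod (z - y) \<le> exp (- (real n ^ 2)))) sequentially"
    by (rule eventually_ball_finite[OF finA]) (auto simp: A_def intro: preimages_near_escaping)
  have ev2: "eventually (\<lambda>n. real n * ln L - real n ^ 3 \<le> 0) sequentially" by real_asymp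
  have ev3: "eventually (\<lambda>n. (d ^ n * M0) * (real (card A) * real n * d ^ n * (pi * (exp (- (real n ^ 2)))\<^sup>2)) \<le> 1) sequentially"
  proof -
    have "(\<lambda>n. (d ^ n * M0) * (real (card A) * real n * d ^ n * (pi * (exp (- (real n ^ 2)))\<^sup>2))) \<longlonglongrightarrow> 0"
      using d by real_asymp
    then have "eventually (\<lambda>n. (d ^ n * M0) * (real (card A) * real n * d ^ n * (pi * (exp (- (real n ^ 2)))\<^sup>2)) < 1) sequentially"
      by (rule order_tendstoD) simp
    then show ?thesis by (rule eventually_mono) simp
  qed
  define VB where "VB = pi * (R + 2)\<^sup>2"
  have VB: "VB \<ge> 0" by (simp add: VB_def)
  show thesis
  proof (rule that[of "C4 * VB + 1"])
    show "0 \<le> C4 * VB + 1" using C4 VB by simp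
    show "eventually (\<lambda>n. (\<integral>\<^sup>+z\<in>cball 0 (R + 2). ennreal
      \<bar>ln_plus (poly (pderiv (F n)) z) - ln_plus (poly (F n) z)\<bar> \<partial>lborel) \<le> ennreal ((C4 * VB + 1) * real n ^ 4)) sequentially"
      using ev1 ev2 ev3 eventually_ge_at_top[of 1]
    proof eventually_elim
      case (elim n)
      have n4: "1 \<le> real n ^ 4" "real n \<le> real n ^ 4" using elim by (auto intro: self_le_power one_le_power)
      have good: "ln_plus (poly (F n) z) - ln_plus (poly (pderiv (F n)) z) \<le> C3 * real n ^ 4"
        if z: "z \<in> cball 0 (R + 2)" "z \<notin> X n" for z
      \<comment> \<open>With \<open>F n z\<close> in the disc of radius \<open>R + 1\<close> its
        \<open>ln_plus\<close> is bounded, so nothing can be lost however small the derivative is;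
        orbits that stay close to bounded critical orbits fall into this case.\<close>
      proof (cases "cmod (poly (F n) z) \<le> R + 1")
        case True
        then have "ln_plus (poly (F n) z) \<le> ln (R + 2)" by (intro lnz) simp
        also have "\<dots> \<le> C3" using green_const(1) Cl(1) d by (simp add: C3_def M0_def)
        also have "\<dots> \<le> C3 * real n ^ 4" using mult_left_mono[OF n4(1) C3] by simp
        finally show ?thesis using ln_plus_nonneg[of "poly (pderiv (F n)) z"] by linarith
      next
        case False
        define \<delta> where "\<delta> = exp (- (real n ^ 3))"
        have \<delta>: "0 < \<delta>" "\<delta> \<le> 1" by (auto simp: \<delta>_def)
        have far: "\<delta> \<le> cmod (poly (F j) z - c)" if j: "j < n" and c: "poly (pderiv f) c = 0" for j c
        proof (rule ccontr)
          assume "\<not> \<delta> \<le> cmod (poly (F j) z - c)"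
          then have near: "cmod (poly (F j) z - c) < exp (- (real n ^ 3))" by (simp add: \<delta>_def)
          show False
          proof (cases "\<exists>k. cmod (poly (F k) c) > R")
            case True
            then have "c \<in> A" using c by (simp add: A_def)
            then obtain y where "poly (F j) y = c" "cmod (z - y) \<le> exp (- (real n ^ 2))"
              using elim(1) near j by (meson less_imp_le)
            then have "z \<in> X n" unfolding X_def using \<open>c \<in> A\<close> j
              by (auto simp: dist_norm norm_minus_commute)
            then show False using z(2) by simp
          next
            case False
            \<comment> \<open>A critical point with bounded orbit this close to \<open>F j z\<close>
              would still hold \<open>F n z\<close> in the disc of radius
              \<open>R + 1\<close>.\<close>
            have "L ^ (n - j) * cmod (poly (F j) z - c) \<le> L ^ n * exp (- (real n ^ 3))"
              using L(1) near by (intro mult_mono power_increasing) auto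
            also have "\<dots> = exp (real n * ln L - real n ^ 3)"
              using L(1) by (simp add: exp_diff exp_of_nat_mult exp_minus field_simps)
            also have "\<dots> \<le> 1" using elim(2) by simp
            finally have "cmod (poly (F (n - j)) (poly (F j) z)) \<le> R + 1"
              using False by (intro L(2)[of c]) (auto simp: not_less)
            then show False using j \<open>\<not> cmod (poly (F n) z) \<le> R + 1\<close>
              by (simp flip: poly_poly_iterate_add)
          qed
        qed
        then have nz: "poly (pderiv f) (poly (F j) z) \<noteq> 0" if "j < n" for j using that \<delta>(1) by force
        have step: "ln_plus (poly (F (Suc j)) z) - ln_plus (poly (F j) z) - (green_const + (d - 1) * real n ^ 3 + Cl)
          \<le> ln (cmod (poly (pderiv f) (poly (F j) z)))" if "j < n" for j
        proof -
          have "(d - 1) * (ln_plus (poly (F j) z) - real n ^ 3) - Cl \<le> ln (cmod (poly (pderiv f) (poly (F j) z)))"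
            using Cl(2)[OF \<delta> far[OF that]] unfolding dd by (simp add: \<delta>_def)
          then show ?thesis using green_const(2)[of "poly (F j) z"]
            unfolding poly_poly_iterate_Suc d_def[symmetric] abs_le_iff by (simp add: algebra_simps)
        qed
        have "ln_plus (poly (F n) z) - ln_plus z - real n * (green_const + (d - 1) * real n ^ 3 + Cl)
          = (\<Sum>j<n. ln_plus (poly (F (Suc j)) z) - ln_plus (poly (F j) z) - (green_const + (d - 1) * real n ^ 3 + Cl))"
          using sum_lessThan_telescope[of "\<lambda>l. ln_plus (poly (F l) z)" n] by (simp add: sum_subtractf)
        also have "\<dots> \<le> (\<Sum>j<n. ln (cmod (poly (pderiv f) (poly (F j) z))))" by (intro sum_mono step) auto
        also have "\<dots> = ln (cmod (poly (pderiv (F n)) z))"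
          unfolding pderiv_poly_iterate prod_norm[symmetric] by (subst ln_prod) (use nz in auto)
        also have "\<dots> \<le> ln_plus (poly (pderiv (F n)) z)" by (rule ln_le_ln_plus)
        finally have "ln_plus (poly (F n) z) - ln_plus (poly (pderiv (F n)) z)
          \<le> ln (R + 2) + real n * (green_const + (d - 1) * real n ^ 3 + Cl)"
          using lnz[OF z(1)] by linarith
        also have "\<dots> = ln (R + 2) * 1 + green_const * real n + (d - 1) * real n ^ 4 + Cl * real n"
          by (simp add: algebra_simps power_eq_if)
        also have "\<dots> \<le> ln (R + 2) * real n ^ 4 + green_const * real n ^ 4 + (d - 1) * real n ^ 4 + Cl * real n ^ 4"
          using n4 M0 green_const(1) Cl(1) d by (intro add_mono mult_left_mono) auto
        also have "\<dots> = C3 * real n ^ 4" by (simp add: C3_def M0_def algebra_simps)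
        finally show ?thesis .
      qed
      have Cu4: "Cu * real n \<le> C4 * real n ^ 4"
        using n4 Cu(1) C3 C4 by (intro mult_mono) (auto simp: C4_def)
      \<comment> \<open>The upper bound for the derivative holds everywhere; only the lower one
        fails on \<open>X n\<close>, where \<open>ln_plus (F n z)\<close> itself bounds the
        loss.\<close>
      have pt: "ennreal \<bar>ln_plus (poly (pderiv (F n)) z) - ln_plus (poly (F n) z)\<bar> * indicator (cball 0 (R + 2)) z
        \<le> ennreal (C4 * real n ^ 4) * indicator (cball 0 (R + 2)) z + ennreal (d ^ n * M0) * indicator (X n) z" for z
      proof (cases "z \<in> cball 0 (R + 2)")
        case True
        have up: "ln_plus (poly (pderiv (F n)) z) - ln_plus (poly (F n) z) \<le> C4 * real n ^ 4"
          using Cu(2)[of n z] Cu4 by linarith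
        show ?thesis
        proof (cases "z \<in> X n")
          case False
          have "C3 * real n ^ 4 \<le> C4 * real n ^ 4" using Cu(1) by (intro mult_right_mono) (auto simp: C4_def)
          then have "\<bar>ln_plus (poly (pderiv (F n)) z) - ln_plus (poly (F n) z)\<bar> \<le> C4 * real n ^ 4"
            using up good[OF True False] by linarith
          then show ?thesis using True False by (simp add: ennreal_leI)
        next
          case inX: True
          have "ln_plus (poly (F n) z) \<le> d ^ n * (ln_plus z + green_const)" unfolding d_def by (rule ln_plus_F_le)
          also have "\<dots> \<le> d ^ n * M0" using lnz[OF True] d by (intro mult_left_mono) (auto simp: M0_def)
          finally have "ln_plus (poly (F n) z) \<le> d ^ n * M0" .
          moreover have "0 \<le> C4 * real n ^ 4" "0 \<le> d ^ n * M0" using C4 M0(1) d by auto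
          ultimately have "\<bar>ln_plus (poly (pderiv (F n)) z) - ln_plus (poly (F n) z)\<bar> \<le> C4 * real n ^ 4 + d ^ n * M0"
            using up ln_plus_nonneg[of "poly (pderiv (F n)) z"] by linarith
          then have "ennreal \<bar>ln_plus (poly (pderiv (F n)) z) - ln_plus (poly (F n) z)\<bar> \<le> ennreal (C4 * real n ^ 4 + d ^ n * M0)"
            by (rule ennreal_leI)
          also have "\<dots> = ennreal (C4 * real n ^ 4) + ennreal (d ^ n * M0)"
            using C4 M0 d by (intro ennreal_plus) auto
          finally show ?thesis using True inX by simp
        qed
      qed simp
      have "(\<integral>\<^sup>+z\<in>cball 0 (R + 2). ennreal \<bar>ln_plus (poly (pderiv (F n)) z) - ln_plus (poly (F n) z)\<bar> \<partial>lborel)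
        \<le> (\<integral>\<^sup>+z. ennreal (C4 * real n ^ 4) * indicator (cball 0 (R + 2)) z + ennreal (d ^ n * M0) * indicator (X n) z \<partial>lborel)"
        by (intro nn_integral_mono pt)
      also have "\<dots> = ennreal (C4 * real n ^ 4) * emeasure lborel (cball (0::complex) (R + 2)) + ennreal (d ^ n * M0) * emeasure lborel (X n)"
      proof (subst nn_integral_add)
        show "(\<lambda>z::complex. ennreal (C4 * real n ^ 4) * indicator (cball 0 (R + 2)) z) \<in> borel_measurable lborel"
          "(\<lambda>z. ennreal (d ^ n * M0) * indicator (X n) z) \<in> borel_measurable lborel"
          using measX by (auto intro!: borel_measurable_times_ennreal borel_measurable_indicator)
      qed (simp only: nn_integral_cmult_indicator[OF measX] nn_integral_cmult_indicator[of "cball (0::complex) (R + 2)" lborel]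
            sets_lborel borel_closed closed_cball)
      also have "\<dots> \<le> ennreal (C4 * real n ^ 4) * ennreal VB
          + ennreal (d ^ n * M0) * ennreal (real (card A) * real n * d ^ n * (pi * (exp (- (real n ^ 2)))\<^sup>2))"
        unfolding X_def d_def VB_def using R
        by (intro add_mono mult_left_mono emeasure_preimage_discs finA) (auto simp: emeasure_cball_complex)
      also have "\<dots> = ennreal ((C4 * real n ^ 4) * VB + (d ^ n * M0) * (real (card A) * real n * d ^ n * (pi * (exp (- (real n ^ 2)))\<^sup>2)))"
        using C4 VB M0 d by (simp add: ennreal_mult[symmetric] ennreal_plus[symmetric] del: ennreal_plus)
      also have "\<dots> \<le> ennreal ((C4 * VB + 1) * real n ^ 4)"
        using elim(3) n4(1) by (intro ennreal_leI) (simp add: algebra_simps)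
      finally show ?case .
    qed
  qed
qed

end

section \<open>Equidistribution of fibres\<close>

lemma nn_integral_sum_mset:
  fixes k :: "'a \<Rightarrow> complex \<Rightarrow> real" and b :: real
  assumes "\<And>y. k y \<in> borel_measurable borel" "\<And>y z. 0 \<le> k y z" "S \<in> sets lborel"
    and "\<And>y. y \<in># M \<Longrightarrow> (\<integral>\<^sup>+z\<in>S. ennreal (k y z) \<partial>lborel) \<le> ennreal b" "b \<ge> 0"
  shows "(\<integral>\<^sup>+z\<in>S. ennreal (\<Sum>y\<in>#M. k y z) \<partial>lborel) \<le> ennreal (size M * b)"
  using assms(4)
proof (induction M)
  case (add y M)
  have [measurable]: "(\<lambda>z. \<Sum>y\<in>#M. k y z) \<in> borel_measurable borel" for M
    using assms(1) by (induction M) auto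
  have nn: "0 \<le> (\<Sum>y\<in>#M. k y z)" for M z using assms(2) by (induction M) auto
  have "(\<integral>\<^sup>+z\<in>S. ennreal (\<Sum>y\<in>#add_mset y M. k y z) \<partial>lborel)
    = (\<integral>\<^sup>+z. ennreal (k y z) * indicator S z + ennreal (\<Sum>y\<in>#M. k y z) * indicator S z \<partial>lborel)"
    by (intro nn_integral_cong)
      (simp only: image_mset_add_mset sum_mset.add_mset ennreal_plus[OF assms(2) nn] distrib_right)
  also have "\<dots> = (\<integral>\<^sup>+z\<in>S. ennreal (k y z) \<partial>lborel) + (\<integral>\<^sup>+z\<in>S. ennreal (\<Sum>y\<in>#M. k y z) \<partial>lborel)"
    using assms(1,3) by (intro nn_integral_add borel_measurable_times_ennreal borel_measurable_indicator) auto
  also have "\<dots> \<le> ennreal b + ennreal (size M * b)"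
    using add by (intro add_mono) auto
  also have "\<dots> = ennreal (size (add_mset y M) * b)"
    using assms(5) by (subst ennreal_plus[symmetric]) (auto simp: algebra_simps)
  finally show ?case .
qed simp

lemma ln_minus_poly_le:
  fixes p :: "complex poly"
  shows "ln_minus (poly p z) \<le> \<bar>ln (cmod (lead_coeff p))\<bar> + (\<Sum>y\<in>#proots p. ln_minus (z - y))"
proof -
  have nn: "0 \<le> (\<Sum>y\<in>#M. ln_minus (z - y))" for M by (induction M) auto
  show ?thesis
  proof (cases "poly p z = 0")
    case True
    then show ?thesis using nn by (simp add: ln_minus_def[of 0])
  next
    case False
    have "- (\<Sum>y\<in>#M. ln (cmod (z - y))) \<le> (\<Sum>y\<in>#M. ln_minus (z - y))" for M
      by (induction M) (auto simp: ln_minus_def)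
    from this[of "proots p"] show ?thesis
      using nn[of "proots p"] ln_cmod_poly[OF False] by (simp add: ln_minus_def[of "poly p z"])
  qed
qed

context escaping_poly
begin

text \<open>The invariant with \<open>d^n - 1\<close> in place of \<open>d^n\<close> leaves room for
  the additive term of each step, because \<open>d - 1 \<ge> 1\<close>.\<close>

lemma lead_coeff_F_bound: "\<bar>ln (cmod (lead_coeff (F n)))\<bar> \<le> \<bar>ln (cmod (lead_coeff f))\<bar> * real (degree f) ^ n"
proof -
  let ?l = "\<bar>ln (cmod (lead_coeff f))\<bar>" and ?d = "real (degree f)"
  have d: "?d \<ge> 2" using deg by simp
  have "\<bar>ln (cmod (lead_coeff (F n)))\<bar> \<le> ?l * (?d ^ n - 1)"
  proof (induction n)
    case (Suc n)
    have "lead_coeff (F n) \<noteq> 0" "lead_coeff f \<noteq> 0" using degree_F(2)[of n] f_nonzero by auto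
    moreover have "lead_coeff (F (Suc n)) = lead_coeff f * lead_coeff (F n) ^ degree f"
      unfolding poly_iterate_Suc by (rule lead_coeff_comp) (rule degree_F(2))
    ultimately have "ln (cmod (lead_coeff (F (Suc n)))) = ln (cmod (lead_coeff f)) + ?d * ln (cmod (lead_coeff (F n)))"
      by (simp only: norm_mult norm_power) (simp add: ln_mult ln_realpow)
    then have "\<bar>ln (cmod (lead_coeff (F (Suc n))))\<bar> \<le> ?l + ?d * \<bar>ln (cmod (lead_coeff (F n)))\<bar>"
      by (metis abs_mult abs_of_nat abs_triangle_ineq)
    also have "\<dots> \<le> ?l + ?d * (?l * (?d ^ n - 1))" using Suc by (intro add_left_mono mult_left_mono) auto
    also have "\<dots> = ?l * (?d ^ Suc n - (?d - 1))" by (simp add: algebra_simps)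
    also have "\<dots> \<le> ?l * (?d ^ Suc n - 1)" using d by (intro mult_left_mono) auto
    finally show ?case .
  qed simp
  also have "\<dots> \<le> ?l * ?d ^ n" by (intro mult_left_mono) auto
  finally show ?thesis .
qed

text \<open>Every critical point \<open>c\<close> of \<open>f\<close>, and every preimage of
  \<open>c\<close>, is critical for \<open>f^2\<close>. If \<open>c\<close> were the only critical
  point of \<open>f^2\<close>, it would be its own sole preimage and \<open>Fin c\<close> would be
  exceptional.\<close>

lemma F_2_two_critical_points:
  assumes "exceptional_set f = {Infty}"
  obtains c1 c2 where "c1 \<noteq> c2" "poly (pderiv (F 2)) c1 = 0" "poly (pderiv (F 2)) c2 = 0"
proof -
  have eq: "poly (pderiv (F 2)) x = poly (pderiv f) x * poly (pderiv f) (poly f x)" for x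
    by (simp add: pderiv_poly_iterate numeral_2_eq_2 poly_poly_iterate_Suc)
  have "degree (pderiv f) > 0" using deg by (simp add: degree_pderiv)
  then obtain c where c: "poly (pderiv f) c = 0"
    by (metis constant_degree fundamental_theorem_of_algebra less_irrefl)
  have "\<exists>x. poly (pderiv (F 2)) x = 0 \<and> x \<noteq> c"
  proof (rule ccontr)
    assume "\<not> ?thesis"
    then have only: "x = c" if "poly f x = c" for x using that c by (auto simp: eq)
    have "degree (f - [:c:]) > 0"
      unfolding diff_conv_add_uminus using deg by (subst degree_add_eq_left) auto
    then obtain x where "poly (f - [:c:]) x = 0"
      by (metis constant_degree fundamental_theorem_of_algebra less_irrefl)
    then have x: "poly f x = c" by simp
    have fc: "poly f c = c" using only[OF x] x by simp
    have one: "sphere_map f -` {Fin c} = {Fin c}"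
    proof (intro set_eqI)
      fix s show "s \<in> sphere_map f -` {Fin c} \<longleftrightarrow> s \<in> {Fin c}"
        using fc only by (cases s) auto
    qed
    have "(sphere_map f ^^ n) -` {Fin c} = {Fin c}" for n
    proof (induction n)
      case (Suc n)
      have "(sphere_map f ^^ Suc n) -` {Fin c} = (sphere_map f ^^ n) -` (sphere_map f -` {Fin c})" by auto
      then show ?case by (simp only: one Suc)
    qed simp
    then have "Fin c \<in> exceptional_set f" by (auto simp: exceptional_set_def)
    then show False using assms by simp
  qed
  then show thesis using that[of c] c eq by force
qed

text \<open>Thanks to the two critical points, each step through \<open>f^2\<close>, of degree
  \<open>D = d^2\<close>, takes a root of order \<open>D - 1\<close> only. After \<open>m\<close>
  steps \<open>t\<close> is divided by \<open>(D - 1)^m\<close>, which grows more slowly than the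
  degree \<open>D^m\<close>.\<close>

lemma root_near_even_iterate:
  assumes exc: "exceptional_set f = {Infty}"
  obtains K where "K \<ge> 1" "\<And>m z w t. cmod (poly (F (2 * m)) z - w) \<le> exp (- t) \<Longrightarrow>
    \<exists>y. poly (F (2 * m)) y = w \<and> cmod (z - y) \<le> K * exp (- t / (real (degree f) ^ 2 - 1) ^ m)"
proof -
  define D where "D = degree f ^ 2"
  have D: "D \<ge> 4" using power_mono[of 2 "degree f" 2] deg by (simp add: D_def)
  have degP: "degree (F 2) = D" by (simp add: degree_F(1) D_def)
  obtain c1 c2 where "c1 \<noteq> c2" "poly (pderiv (F 2)) c1 = 0" "poly (pderiv (F 2)) c2 = 0"
    using F_2_two_critical_points[OF exc] by blast
  then obtain C where C: "C > 0"
    "\<And>v z. \<exists>y. poly (F 2) y = v \<and> cmod (z - y) ^ (D - 1) \<le> C * cmod (poly (F 2) z - v)"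
    using root_near_two_critical_points[of "F 2" c1 c2] D by (auto simp: degP)
  define K where "K = max 1 C"
  have K: "K \<ge> 1" "C \<le> K" by (auto simp: K_def)
  define E where "E = real D - 1"
  have E: "E = real (D - 1)" "E > 0" using D by (auto simp: E_def)
  have "\<exists>y. poly (F (2 * m)) y = w \<and> cmod (z - y) \<le> K * exp (- t / E ^ m)"
    if "cmod (poly (F (2 * m)) z - w) \<le> exp (- t)" for m z w t
    using that
  proof (induction m arbitrary: z)
    case 0
    then have "cmod (z - w) \<le> 1 * exp (- t)" by simp
    also have "\<dots> \<le> K * exp (- t)" using K by (intro mult_right_mono) auto
    finally show ?case by (intro exI[of _ w]) simp
  next
    case (Suc m)
    have eq: "poly (F (2 * Suc m)) x = poly (F (2 * m)) (poly (F 2) x)" for x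
      using poly_poly_iterate_add[of f "2 * m" 2 x] by simp
    obtain y0 where y0: "poly (F (2 * m)) y0 = w" "cmod (poly (F 2) z - y0) \<le> K * exp (- t / E ^ m)"
      using Suc.IH[OF Suc.prems[unfolded eq]] by blast
    obtain y where y: "poly (F 2) y = y0" "cmod (z - y) ^ (D - 1) \<le> C * cmod (poly (F 2) z - y0)"
      using C(2) by blast
    have "cmod (z - y) ^ (D - 1) \<le> K * (K * exp (- t / E ^ m))"
      using y(2) mult_mono[OF K(2) y0(2)] K(1) by simp
    also have "\<dots> = K ^ 2 * exp (- t / E ^ m)" by (simp add: power2_eq_square)
    \<comment> \<open>The constant does not deteriorate with \<open>m\<close>:
      \<open>K^2 \<le> K^(D - 1)\<close> because \<open>D \<ge> 4\<close>, and the root of order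
      \<open>D - 1\<close> gives back \<open>K\<close>.\<close>
    also have "\<dots> \<le> K ^ (D - 1) * exp (- t / E ^ m)"
      using K(1) D by (intro mult_right_mono power_increasing) auto
    also have "\<dots> = (K * exp (- t / E ^ Suc m)) ^ (D - 1)"
    proof -
      have "real (D - 1) * (- t / E ^ Suc m) = - t / E ^ m" using E by simp
      then show ?thesis by (simp only: power_mult_distrib exp_of_nat_mult[symmetric])
    qed
    finally have pow: "cmod (z - y) ^ (D - 1) \<le> (K * exp (- t / E ^ Suc m)) ^ (D - 1)" .
    have "D - 1 = Suc (D - 2)" using D by simp
    from pow[unfolded this] have "cmod (z - y) \<le> K * exp (- t / E ^ Suc m)"
      by (rule power_le_imp_le_base) (use K(1) in simp)
    moreover have "poly (F (2 * Suc m)) y = w" using y(1) y0(1) eq[of y] by simp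
    ultimately show ?case by blast
  qed
  then show thesis using K(1) by (intro that[of K]) (auto simp: E_def D_def)
qed

text \<open>Uniformity in \<open>w\<close> is the point: degree, leading coefficient and root
  estimate are the same for all \<open>F (2 m) - w\<close>. Outside tiny discs about the fibre the
  negative part is at most \<open>t\<close>, which is negligible against \<open>D^m\<close>; inside,
  \<open>D^m\<close> logarithmic poles are integrated over a set of super-exponentially small
  area.\<close>

lemma even_iterate_integral:
  assumes exc: "exceptional_set f = {Infty}"
  obtains b where "b \<longlonglongrightarrow> 0" "\<And>m. b m \<ge> 0"
    "\<And>m w. (\<integral>\<^sup>+z\<in>cball 0 (R + 2). ennreal (ln_minus (poly (F (2 * m)) z - w)) \<partial>lborel)
      \<le> ennreal (real (degree f) ^ (2 * m) * b m)"
proof -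
  obtain K where K: "K \<ge> 1" "\<And>m z w t. cmod (poly (F (2 * m)) z - w) \<le> exp (- t) \<Longrightarrow>
    \<exists>y. poly (F (2 * m)) y = w \<and> cmod (z - y) \<le> K * exp (- t / (real (degree f) ^ 2 - 1) ^ m)"
    using root_near_even_iterate[OF exc] by metis
  define D where "D = real (degree f) ^ 2"
  have D: "D \<ge> 4" using power_mono[of 2 "real (degree f)" 2] deg by (simp add: D_def)
  have Dm: "real (degree f) ^ (2 * m) = D ^ m" for m by (simp add: D_def power_mult)
  define l where "l = \<bar>ln (cmod (lead_coeff f))\<bar>"
  define V where "V = pi * (R + 2)\<^sup>2"
  have V: "V \<ge> 0" by (simp add: V_def)
  define s where "s m = D ^ m * (pi * (K * exp (- (real m ^ 2)))\<^sup>2)" for m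
  \<comment> \<open>All terms are divided by \<open>D^m\<close>: the height \<open>t\<close> over
    the large disc, then the leading coefficient and the poles truncated at height \<open>m\<close>
    over the small discs, and last the poles above height \<open>m\<close>.\<close>
  define b where "b m = real m ^ 2 * ((D - 1) / D) ^ m * V + ((l + real m) * s m + 8 * exp (- 2 * real m))" for m
  have s0: "s m \<ge> 0" for m using D by (simp add: s_def)
  have b0: "b m \<ge> 0" for m using D V s0 by (auto simp: b_def l_def intro!: add_nonneg_nonneg)
  have blim: "b \<longlonglongrightarrow> 0"
  proof -
    have "(\<lambda>m. (l + real m) * s m) \<longlonglongrightarrow> 0" unfolding s_def using D K(1) by real_asymp
    moreover have "(\<lambda>m. real m ^ 2 * ((D - 1) / D) ^ m) \<longlonglongrightarrow> 0"
    proof -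
      define x where "x = ln (D / (D - 1))"
      have x: "x > 0" using D by (simp add: x_def)
      have "((D - 1) / D) ^ m = exp (- x * real m)" for m
      proof -
        have "exp (- x) = (D - 1) / D" using D by (simp add: x_def exp_minus)
        then show ?thesis using exp_of_nat_mult[of m "- x"] by (simp add: mult.commute)
      qed
      moreover have "(\<lambda>m. real m ^ 2 * exp (- x * real m)) \<longlonglongrightarrow> 0" using x by real_asymp
      ultimately show ?thesis by simp
    qed
    moreover have "(\<lambda>m. 8 * exp (- 2 * real m)) \<longlonglongrightarrow> 0" by real_asymp
    ultimately have "b \<longlonglongrightarrow> 0 * V + (0 + 0)" unfolding b_def by (intro tendsto_intros)
    then show ?thesis by simp
  qed
  have main: "(\<integral>\<^sup>+z\<in>cball 0 (R + 2). ennreal (ln_minus (poly (F (2 * m)) z - w)) \<partial>lborel) \<le> ennreal (D ^ m * b m)" for m w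
  proof -
    define Q where "Q = F (2 * m) - [:w:]"
    have Q: "poly Q z = poly (F (2 * m)) z - w" for z by (simp add: Q_def)
    have sQ: "real (size (proots Q)) = D ^ m"
      unfolding Q_def size_proots_complex degree_F_minus by (simp add: Dm)
    \<comment> \<open>Chosen so that \<open>t / (D - 1)^m = m^2\<close> gives discs of radius
      \<open>K exp (- m^2)\<close>, while \<open>t / D^m\<close> tends to 0.\<close>
    define t where "t = real m ^ 2 * (D - 1) ^ m"
    define r where "r = K * exp (- (real m ^ 2))"
    define S where "S = (\<Union>y\<in>{y. poly (F (2 * m)) y = w}. cball y r)"
    have S: "S \<in> sets lborel" unfolding S_def by (intro sets.finite_UN fibre_finite) auto
    have r0: "r \<ge> 0" using K(1) by (simp add: r_def)
    have mS: "emeasure lborel S \<le> ennreal (s m)"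
    proof -
      have "emeasure lborel S \<le> (\<Sum>y\<in>{y. poly (F (2 * m)) y = w}. emeasure lborel (cball y r))"
        unfolding S_def by (rule emeasure_subadditive_finite) (auto simp: fibre_finite)
      also have "\<dots> = ennreal (real (card {y. poly (F (2 * m)) y = w}) * (pi * r\<^sup>2))"
        using r0 by (simp add: emeasure_cball_complex ennreal_of_nat_eq_real_of_nat ennreal_mult)
      also have "\<dots> \<le> ennreal (s m)"
      proof (unfold s_def r_def[symmetric], intro ennreal_leI mult_right_mono)
        have "real (card {y. poly (F (2 * m)) y = w}) \<le> real (degree f ^ (2 * m))" using fibre_finite(2) by (simp only: of_nat_le_iff)
        then show "real (card {y. poly (F (2 * m)) y = w}) \<le> D ^ m" by (simp add: Dm)
      qed simp
      finally show ?thesis .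
    qed
    define lc where "lc = \<bar>ln (cmod (lead_coeff Q))\<bar>"
    have lc: "lc \<le> l * D ^ m" unfolding lc_def Q_def lead_coeff_F_minus l_def
      using lead_coeff_F_bound[of "2 * m"] by (simp add: Dm)
    have outside: "ln_minus (poly Q z) \<le> t" if "z \<notin> S" for z
    proof (rule ccontr)
      assume "\<not> ?thesis"
      moreover have "t \<ge> 0" using D by (simp add: t_def)
      ultimately have lm: "ln_minus (poly Q z) > t" "ln_minus (poly Q z) > 0" by auto
      then have nz: "poly Q z \<noteq> 0" by (auto simp: ln_minus_def)
      have "ln (cmod (poly Q z)) \<le> - t" using lm by (auto simp: ln_minus_def)
      then have "cmod (poly Q z) \<le> exp (- t)" using nz by (metis exp_ln exp_le_cancel_iff zero_less_norm_iff)
      then obtain y where y: "poly (F (2 * m)) y = w" "cmod (z - y) \<le> K * exp (- t / (D - 1) ^ m)"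
        using K(2)[of m z w t] by (auto simp: Q D_def)
      have "- t / (D - 1) ^ m = - (real m ^ 2)" using D by (simp add: t_def)
      then have "z \<in> cball y r" using y(2) by (simp add: r_def dist_norm norm_minus_commute)
      then show False using that y(1) by (auto simp: S_def)
    qed
    have lin: "(\<integral>\<^sup>+z\<in>S. ennreal (\<Sum>y\<in>#proots Q. ln_minus (z - y)) \<partial>lborel) \<le> ennreal (D ^ m * (real m * s m + 8 * exp (- 2 * real m)))"
      unfolding sQ[symmetric]
    proof (rule nn_integral_sum_mset[where k = "\<lambda>y z. ln_minus (z - y)"])
      fix y
      have "(\<integral>\<^sup>+z\<in>S. ennreal (ln_minus (z - y)) \<partial>lborel) \<le> ennreal (real m) * emeasure lborel S + ennreal (8 * exp (- 2 * real m))"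
        by (rule nn_integral_ln_minus_set[OF S])
      also have "\<dots> \<le> ennreal (real m) * ennreal (s m) + ennreal (8 * exp (- 2 * real m))"
        by (intro add_right_mono mult_left_mono mS) auto
      also have "\<dots> = ennreal (real m * s m + 8 * exp (- 2 * real m))"
        using s0 by (simp add: ennreal_mult[symmetric] ennreal_plus[symmetric] del: ennreal_plus)
      finally show "(\<integral>\<^sup>+z\<in>S. ennreal (ln_minus (z - y)) \<partial>lborel) \<le> ennreal (real m * s m + 8 * exp (- 2 * real m))" .
    qed (use S s0 in auto)
    have "(\<integral>\<^sup>+z\<in>cball 0 (R + 2). ennreal (ln_minus (poly Q z)) \<partial>lborel)
      \<le> (\<integral>\<^sup>+z. ennreal t * indicator (cball 0 (R + 2)) z + (ennreal lc * indicator S z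
          + ennreal (\<Sum>y\<in>#proots Q. ln_minus (z - y)) * indicator S z) \<partial>lborel)"
    proof (rule nn_integral_mono)
      fix z
      show "ennreal (ln_minus (poly Q z)) * indicator (cball 0 (R + 2)) z
        \<le> ennreal t * indicator (cball 0 (R + 2)) z + (ennreal lc * indicator S z
          + ennreal (\<Sum>y\<in>#proots Q. ln_minus (z - y)) * indicator S z)"
      proof (cases "z \<in> S")
        case True
        have nn: "0 \<le> (\<Sum>y\<in>#M. ln_minus (z - y))" for M by (induction M) auto
        have "ennreal (ln_minus (poly Q z)) \<le> ennreal (lc + (\<Sum>y\<in>#proots Q. ln_minus (z - y)))"
          unfolding lc_def by (intro ennreal_leI ln_minus_poly_le)
        also have "\<dots> = ennreal lc + ennreal (\<Sum>y\<in>#proots Q. ln_minus (z - y))"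
          by (intro ennreal_plus nn) (simp add: lc_def)
        finally show ?thesis using True
          by (cases "z \<in> cball 0 (R + 2)") (auto intro: order_trans add_increasing)
      next
        case False
        then show ?thesis using outside[OF False] by (simp add: indicator_def ennreal_leI)
      qed
    qed
    also have "\<dots> = ennreal t * emeasure lborel (cball (0::complex) (R + 2)) + (ennreal lc * emeasure lborel S
      + (\<integral>\<^sup>+z\<in>S. ennreal (\<Sum>y\<in>#proots Q. ln_minus (z - y)) \<partial>lborel))"
    proof -
      have m0: "(\<lambda>z. \<Sum>y\<in>#M. ln_minus (z - y)) \<in> borel_measurable borel" for M by (induction M) auto
      have m1: "(\<lambda>z::complex. ennreal t * indicator (cball 0 (R + 2)) z) \<in> borel_measurable lborel"
        "(\<lambda>z. ennreal lc * indicator S z) \<in> borel_measurable lborel"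
        "(\<lambda>z. ennreal (\<Sum>y\<in>#proots Q. ln_minus (z - y)) * indicator S z) \<in> borel_measurable lborel"
        using S m0[of "proots Q"] by (auto intro!: borel_measurable_times_ennreal borel_measurable_indicator)
      show ?thesis
        by (simp only: nn_integral_add m1 borel_measurable_add nn_integral_cmult_indicator[OF S]
            nn_integral_cmult_indicator[of "cball (0::complex) (R + 2)" lborel] sets_lborel borel_closed closed_cball)
    qed
    also have "\<dots> \<le> ennreal t * ennreal V + (ennreal (l * D ^ m) * ennreal (s m)
      + ennreal (D ^ m * (real m * s m + 8 * exp (- 2 * real m))))"
    proof (intro add_mono mult_mono mS lin ennreal_leI lc)
      show "emeasure lborel (cball (0::complex) (R + 2)) \<le> ennreal V"
        using R by (simp add: emeasure_cball_complex V_def)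
    qed auto
    also have "\<dots> = ennreal (t * V + (l * D ^ m * s m + D ^ m * (real m * s m + 8 * exp (- 2 * real m))))"
    proof -
      have "t \<ge> 0" "l \<ge> 0" "D ^ m \<ge> 0" using D by (auto simp: t_def l_def)
      then show ?thesis using V s0[of m] by (simp add: ennreal_mult[symmetric] ennreal_plus[symmetric] del: ennreal_plus)
    qed
    also have "t * V + (l * D ^ m * s m + D ^ m * (real m * s m + 8 * exp (- 2 * real m))) = D ^ m * b m"
    proof -
      have "t = D ^ m * (real m ^ 2 * ((D - 1) / D) ^ m)" using D by (simp add: t_def power_divide)
      then show ?thesis by (simp add: b_def algebra_simps)
    qed
    finally show ?thesis by (simp add: Q)
  qed
  show thesis by (rule that[OF blim b0]) (use main in \<open>simp add: Dm\<close>)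
qed

end

section \<open>Push-forward of test functions on the sphere\<close>

text \<open>Above height \<open>exp (- M)\<close> the logarithm has Lipschitz constant
  \<open>exp M\<close>; what is cut off below is exactly the excess of \<open>ln_minus\<close> over
  \<open>M\<close>.\<close>

lemma ln_cmod_lipschitz:
  assumes "a \<noteq> 0" "b \<noteq> 0" "M \<ge> 0"
  shows "\<bar>ln (cmod a) - ln (cmod b)\<bar> \<le> exp M * cmod (a - b) + (max 0 (ln_minus a - M) + max 0 (ln_minus b - M))"
proof -
  have trunc: "ln (cmod a) = ln (max (cmod a) (exp (- M))) - max 0 (ln_minus a - M)" if "a \<noteq> 0" for a
  proof (cases "exp (- M) \<le> cmod a")
    case True
    then have "- M \<le> ln (cmod a)" using that by (simp add: ln_ge_iff)
    then show ?thesis using True assms(3) by (simp add: ln_minus_def max_absorb1)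
  next
    case False
    then have "ln (cmod a) \<le> - M" using that by (metis ln_exp ln_le_cancel_iff exp_gt_zero less_imp_le not_le zero_less_norm_iff)
    then show ?thesis using False assms(3) by (simp add: ln_minus_def max_absorb2)
  qed
  have lip: "ln x - ln y \<le> exp M * \<bar>x - y\<bar>" if "x \<ge> exp (- M)" "y \<ge> exp (- M)" for x y :: real
  proof -
    have pos: "0 < x" "0 < y" using that by (auto intro: less_le_trans[OF exp_gt_zero])
    have "ln x - ln y = ln (x / y)" using pos by (simp add: ln_div)
    also have "\<dots> \<le> x / y - 1" using pos by (intro ln_le_minus_one) simp
    also have "\<dots> = (x - y) / y" using pos by (simp add: field_simps)
    also have "\<dots> \<le> \<bar>x - y\<bar> / exp (- M)" using pos that(2) by (intro frac_le) auto
    finally show ?thesis by (simp add: exp_minus field_simps)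
  qed
  define x y where "x = max (cmod a) (exp (- M))" and "y = max (cmod b) (exp (- M))"
  have "\<bar>x - y\<bar> \<le> \<bar>cmod a - cmod b\<bar>" by (auto simp: x_def y_def max_def)
  also have "\<dots> \<le> cmod (a - b)" by (rule norm_triangle_ineq3)
  finally have "exp M * \<bar>x - y\<bar> \<le> exp M * cmod (a - b)" by (intro mult_left_mono) auto
  moreover have "ln x - ln y \<le> exp M * \<bar>x - y\<bar>" by (rule lip) (simp_all add: x_def y_def)
  moreover have "ln y - ln x \<le> exp M * \<bar>x - y\<bar>"
    unfolding abs_minus_commute[of x y] by (rule lip) (simp_all add: x_def y_def)
  ultimately have "\<bar>ln x - ln y\<bar> \<le> exp M * cmod (a - b)" unfolding abs_le_iff by linarith
  moreover have "ln (cmod a) = ln x - max 0 (ln_minus a - M)" "ln (cmod b) = ln y - max 0 (ln_minus b - M)"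
    using trunc[OF assms(1)] trunc[OF assms(2)] by (simp_all only: x_def y_def)
  moreover have "0 \<le> max 0 (ln_minus a - M)" "0 \<le> max 0 (ln_minus b - M)" by simp_all
  ultimately show ?thesis by linarith
qed

text \<open>Granting each zero the height \<open>k\<close>, and the leading coefficient its own
  logarithm, uses up at most \<open>M\<close>; anything beyond must come from zeros closer to
  \<open>z\<close> than \<open>exp (- k)\<close>.\<close>

lemma ln_minus_poly_excess:
  fixes p :: "complex poly"
  assumes "real (degree p) * real k + \<bar>ln (cmod (lead_coeff p))\<bar> \<le> M"
  shows "max 0 (ln_minus (poly p z) - M) \<le> (\<Sum>y\<in>#proots p. max 0 (ln_minus (z - y) - real k))"
proof -
  have nn: "0 \<le> (\<Sum>y\<in>#N. max 0 (ln_minus (z - y) - real k))" for N by (induction N) auto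
  have "(\<Sum>y\<in>#N. ln_minus (z - y)) - real (size N) * real k \<le> (\<Sum>y\<in>#N. max 0 (ln_minus (z - y) - real k))" for N
    by (induction N) (auto simp: algebra_simps)
  from this[of "proots p"] show ?thesis
    using nn[of "proots p"] ln_minus_poly_le[of p z] assms by (simp add: size_proots_complex)
qed

lemma degree_diff_const: "degree (h :: complex poly) > 0 \<Longrightarrow> degree (h - [:w:]) = degree h"
  unfolding diff_conv_add_uminus by (rule degree_add_eq_left) simp

lemma lead_coeff_diff_const:
  assumes "degree (h :: complex poly) > 0" shows "lead_coeff (h - [:w:]) = lead_coeff h"
proof -
  have "coeff [:w:] (degree h) = 0" using assms by (intro coeff_eq_0) simp
  then show ?thesis unfolding degree_diff_const[OF assms] by simp
qed

lemma poly_large_outside: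
  fixes h :: "complex poly"
  assumes "degree h > 0"
  obtains r where "r \<ge> 0" "\<And>z. r \<le> cmod z \<Longrightarrow> B \<le> cmod (poly h z)"
proof -
  obtain a p where h: "h = pCons a p" by (cases h) auto
  then have "p \<noteq> 0" using assms by auto
  then obtain r where "\<And>z. r \<le> cmod z \<Longrightarrow> B \<le> cmod (poly h z)" using poly_infinity[of p B a] h by auto
  then show thesis by (intro that[of "max 0 r"]) auto
qed

lemma AE_poly_nonzero:
  fixes p :: "complex poly"
  assumes "p \<noteq> 0" shows "AE z in lborel. poly p z \<noteq> 0"
proof -
  have "{z. poly p z = 0} \<in> null_sets lborel"
    using poly_roots_finite[OF assms] by (intro finite_imp_null_set_lborel)
  then show ?thesis using AE_not_in by force
qed

text \<open>Continuous dependence of the zeros on the constant term without labelling them: the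
  potentials of \<open>h - w\<close> and \<open>h - w0\<close> are close in L^1. It makes
  push-forwards continuous, hence admissible in the pull-back invariance of \<open>\<mu>\<close>,
  which is stated for continuous functions.\<close>

lemma root_avg_continuous:
  fixes h :: "complex poly"
  assumes deg: "degree h > 0" and g: "C2 g"
  shows "continuous_on UNIV (\<lambda>w. root_avg (h - [:w:]) g)"
proof (rule continuous_at_imp_continuous_on, rule ballI)
  fix w0 :: complex
  define N where "N = degree h"
  have N: "real N \<ge> 1" using deg by (simp add: N_def)
  obtain r where r: "r \<ge> 0" "\<And>z. r \<le> cmod z \<Longrightarrow> cmod w0 + 2 \<le> cmod (poly h z)"
    using poly_large_outside[OF deg] by metis
  obtain C where C: "C > 0" "\<And>p q. degree p > 0 \<Longrightarrow> degree q > 0 \<Longrightarrow> (\<forall>y. poly p y = 0 \<longrightarrow> cmod y \<le> r) \<Longrightarrow>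
    (\<forall>y. poly q y = 0 \<longrightarrow> cmod y \<le> r) \<Longrightarrow>
    ennreal \<bar>root_avg p g - root_avg q g\<bar> \<le> ennreal C * (\<integral>\<^sup>+z\<in>cball 0 (r + 2).
      ennreal \<bar>ln (cmod (poly p z)) / degree p - ln (cmod (poly q z)) / degree q\<bar> \<partial>lborel)"
    by (rule root_avg_comparison[OF g r(1)]) (rule that)
  define V where "V = pi * (r + 2)\<^sup>2"
  define c where "c = \<bar>ln (cmod (lead_coeff h))\<bar>"
  have V: "V > 0" using r by (simp add: V_def)
  have bound: "\<bar>root_avg (h - [:w:]) g - root_avg (h - [:w0:]) g\<bar>
      \<le> C * (exp (N * real k + c) * cmod (w - w0) * V + 16 * N * exp (- 2 * real k))"
    if w: "cmod (w - w0) \<le> 1" for w k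
  proof -
    define M where "M = N * real k + c"
    have M: "M \<ge> 0" by (simp add: M_def c_def)
    have roots: "\<forall>y. poly (h - [:v:]) y = 0 \<longrightarrow> cmod y \<le> r" if "cmod (v - w0) \<le> 1" for v
    proof (intro allI impI)
      fix y assume "poly (h - [:v:]) y = 0"
      then have "poly h y = v" by simp
      moreover have "cmod v \<le> cmod (v - w0) + cmod w0" using norm_triangle_ineq[of "v - w0" w0] by simp
      ultimately show "cmod y \<le> r" using r(2)[of y] that by (cases "r \<le> cmod y") auto
    qed
    let ?e = "\<lambda>v z. \<Sum>y\<in>#proots (h - [:v:]). max 0 (ln_minus (z - y) - real k)"
    have me: "?e v \<in> borel_measurable borel" for v
    proof -
      have "(\<lambda>z. \<Sum>y\<in>#L. max 0 (ln_minus (z - y) - real k)) \<in> borel_measurable borel" for L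
        by (induction L) auto
      then show ?thesis .
    qed
    have e0: "0 \<le> ?e v z" for v z
    proof -
      have "0 \<le> (\<Sum>y\<in>#L. max 0 (ln_minus (z - y) - real k))" for L by (induction L) auto
      then show ?thesis .
    qed
    have eint: "(\<integral>\<^sup>+z\<in>UNIV. ennreal (?e v z) \<partial>lborel) \<le> ennreal (N * (8 * exp (- 2 * real k)))" for v
    proof -
      have "(\<integral>\<^sup>+z\<in>UNIV. ennreal (?e v z) \<partial>lborel) \<le> ennreal (size (proots (h - [:v:])) * (8 * exp (- 2 * real k)))"
        by (rule nn_integral_sum_mset[where k = "\<lambda>y z. max 0 (ln_minus (z - y) - real k)"])
          (use nn_integral_ln_minus_excess in auto)
      then show ?thesis unfolding size_proots_complex degree_diff_const[OF deg] N_def .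
    qed
    have nz: "h - [:v:] \<noteq> 0" for v using degree_diff_const[OF deg, of v] deg by auto
    have "(\<integral>\<^sup>+z\<in>cball 0 (r + 2). ennreal \<bar>ln (cmod (poly (h - [:w:]) z)) / degree (h - [:w:])
        - ln (cmod (poly (h - [:w0:]) z)) / degree (h - [:w0:])\<bar> \<partial>lborel)
      \<le> (\<integral>\<^sup>+z. ennreal (exp M * cmod (w - w0)) * indicator (cball 0 (r + 2)) z
          + (ennreal (?e w z) * indicator UNIV z + ennreal (?e w0 z) * indicator UNIV z) \<partial>lborel)"
    proof (rule nn_integral_mono_AE)
      show "AE z in lborel. ennreal \<bar>ln (cmod (poly (h - [:w:]) z)) / degree (h - [:w:])
        - ln (cmod (poly (h - [:w0:]) z)) / degree (h - [:w0:])\<bar> * indicator (cball 0 (r + 2)) z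
       \<le> ennreal (exp M * cmod (w - w0)) * indicator (cball 0 (r + 2)) z
          + (ennreal (?e w z) * indicator UNIV z + ennreal (?e w0 z) * indicator UNIV z)"
        using AE_poly_nonzero[OF nz[of w]] AE_poly_nonzero[OF nz[of w0]]
      proof eventually_elim
        case (elim z)
        define a b where "a = poly (h - [:w:]) z" and "b = poly (h - [:w0:]) z"
        have ex: "max 0 (ln_minus (poly (h - [:v:]) z) - M) \<le> ?e v z" for v
          by (rule ln_minus_poly_excess)
            (simp add: lead_coeff_diff_const[OF deg] M_def c_def N_def del: coeff_diff, simp add: degree_diff_const[OF deg])
        have "\<bar>ln (cmod a) - ln (cmod b)\<bar> \<le> exp M * cmod (a - b) + (max 0 (ln_minus a - M) + max 0 (ln_minus b - M))"
          using elim M by (intro ln_cmod_lipschitz) (auto simp: a_def b_def)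
        also have "cmod (a - b) = cmod (w - w0)" by (simp add: a_def b_def norm_minus_commute)
        finally have le: "\<bar>ln (cmod a) - ln (cmod b)\<bar> \<le> exp M * cmod (w - w0) + (?e w z + ?e w0 z)"
          using ex[of w] ex[of w0] unfolding a_def b_def by linarith
        have "\<bar>ln (cmod a) / N - ln (cmod b) / N\<bar> = \<bar>ln (cmod a) - ln (cmod b)\<bar> / N"
          using N by (simp add: diff_divide_distrib[symmetric])
        also have "\<dots> \<le> \<bar>ln (cmod a) - ln (cmod b)\<bar> / 1" using N by (intro divide_left_mono) auto
        finally have "\<bar>ln (cmod a) / N - ln (cmod b) / N\<bar> \<le> exp M * cmod (w - w0) + (?e w z + ?e w0 z)" using le by simp
        then have "ennreal \<bar>ln (cmod a) / N - ln (cmod b) / N\<bar> \<le> ennreal (exp M * cmod (w - w0) + (?e w z + ?e w0 z))"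
          by (rule ennreal_leI)
        also have "\<dots> = ennreal (exp M * cmod (w - w0)) + (ennreal (?e w z) + ennreal (?e w0 z))"
          using e0 by (subst ennreal_plus; simp add: ennreal_plus del: ennreal_plus_if)+
        finally show ?case unfolding degree_diff_const[OF deg] N_def[symmetric] a_def[symmetric] b_def[symmetric]
          by (simp add: indicator_def)
      qed
    qed
    also have "\<dots> = ennreal (exp M * cmod (w - w0)) * emeasure lborel (cball (0::complex) (r + 2))
      + ((\<integral>\<^sup>+z\<in>UNIV. ennreal (?e w z) \<partial>lborel) + (\<integral>\<^sup>+z\<in>UNIV. ennreal (?e w0 z) \<partial>lborel))"
    proof -
      have m1: "(\<lambda>z::complex. ennreal (exp M * cmod (w - w0)) * indicator (cball 0 (r + 2)) z) \<in> borel_measurable lborel"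
        "(\<lambda>z. ennreal (?e v z) * indicator UNIV z) \<in> borel_measurable lborel" for v
        using me[of v] by (auto intro!: borel_measurable_times_ennreal borel_measurable_indicator)
      show ?thesis
        by (simp only: nn_integral_add m1 borel_measurable_add
            nn_integral_cmult_indicator[of "cball (0::complex) (r + 2)" lborel] sets_lborel borel_closed closed_cball)
    qed
    also have "\<dots> \<le> ennreal (exp M * cmod (w - w0)) * ennreal V
      + (ennreal (N * (8 * exp (- 2 * real k))) + ennreal (N * (8 * exp (- 2 * real k))))"
      using r(1) by (intro add_mono mult_left_mono eint) (auto simp: emeasure_cball_complex V_def)
    also have "\<dots> = ennreal (exp M * cmod (w - w0) * V + 16 * N * exp (- 2 * real k))"
      using V by (simp add: ennreal_mult[symmetric] ennreal_plus[symmetric] del: ennreal_plus)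
    finally have I: "(\<integral>\<^sup>+z\<in>cball 0 (r + 2). ennreal \<bar>ln (cmod (poly (h - [:w:]) z)) / degree (h - [:w:])
        - ln (cmod (poly (h - [:w0:]) z)) / degree (h - [:w0:])\<bar> \<partial>lborel)
      \<le> ennreal (exp M * cmod (w - w0) * V + 16 * N * exp (- 2 * real k))" .
    have "ennreal \<bar>root_avg (h - [:w:]) g - root_avg (h - [:w0:]) g\<bar>
      \<le> ennreal C * ennreal (exp M * cmod (w - w0) * V + 16 * N * exp (- 2 * real k))"
      using roots[OF w] roots[of w0] deg
      by (intro order_trans[OF C(2) mult_left_mono[OF I]]) (auto simp: degree_diff_const)
    also have "\<dots> = ennreal (C * (exp M * cmod (w - w0) * V + 16 * N * exp (- 2 * real k)))"
      using C V by (intro ennreal_mult[symmetric]) auto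
    finally show ?thesis using C V unfolding M_def by (subst (asm) ennreal_le_iff) auto
  qed
  have "(\<lambda>w. root_avg (h - [:w:]) g) \<midarrow>w0\<rightarrow> root_avg (h - [:w0:]) g"
  proof (rule LIM_I)
    fix e :: real assume e: "e > 0"
    \<comment> \<open>First the truncation height \<open>k\<close> makes the excess terms small,
      then \<open>cmod (w - w0)\<close> is chosen against the large Lipschitz constant
      \<open>exp (N k + c)\<close>.\<close>
    have "(\<lambda>k. C * (16 * real N * exp (- 2 * real k))) \<longlonglongrightarrow> 0" by real_asymp
    then have "eventually (\<lambda>k. C * (16 * real N * exp (- 2 * real k)) < e / 2) sequentially"
      using e by (intro order_tendstoD) auto
    then obtain k where k: "C * (16 * real N * exp (- 2 * real k)) < e / 2"
      unfolding eventually_sequentially by blast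
    define A where "A = C * (exp (N * real k + c) * V)"
    have A: "A > 0" using C V by (simp add: A_def)
    show "\<exists>s>0. \<forall>w. w \<noteq> w0 \<and> norm (w - w0) < s \<longrightarrow> norm (root_avg (h - [:w:]) g - root_avg (h - [:w0:]) g) < e"
    proof (intro exI[of _ "min 1 (e / (2 * A))"] conjI allI impI)
      show "0 < min 1 (e / (2 * A))" using e A by simp
      fix w assume "w \<noteq> w0 \<and> norm (w - w0) < min 1 (e / (2 * A))"
      then have w: "cmod (w - w0) \<le> 1" "A * cmod (w - w0) < e / 2" using A by (auto simp: field_simps)
      have "C * (exp (N * real k + c) * cmod (w - w0) * V + 16 * N * exp (- 2 * real k))
        = A * cmod (w - w0) + C * (16 * real N * exp (- 2 * real k))"
        by (simp add: A_def algebra_simps)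
      then show "norm (root_avg (h - [:w:]) g - root_avg (h - [:w0:]) g) < e"
        using bound[OF w(1), of k] w(2) k by simp
    qed
  qed
  then show "isCont (\<lambda>w. root_avg (h - [:w:]) g) w0" by (simp add: isCont_def)
qed

text \<open>The push-forward of functions with multiplicities, adjoint to the pull-back of measures.
  Being again a function on the sphere it can be pushed forward further, which is how iterates are
  treated.\<close>

definition push_sum :: "complex poly \<Rightarrow> (riemann_sphere \<Rightarrow> real) \<Rightarrow> riemann_sphere \<Rightarrow> real" where
  "push_sum h \<phi> z = (\<Sum>w \<in> sphere_map h -` {z}. real (local_degree h w) * \<phi> w)"

lemma pullback_eq_push_sum: "pullback h \<nu> \<phi> = (\<integral>z. push_sum h \<phi> z \<partial>\<nu>)"
  by (simp add: pullback_def push_sum_def)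

lemma push_sum_Infty: "push_sum h \<phi> Infty = real (degree h) * \<phi> Infty"
proof -
  have "sphere_map h -` {Infty} = {Infty}"
  proof (rule set_eqI)
    fix s show "s \<in> sphere_map h -` {Infty} \<longleftrightarrow> s \<in> {Infty}" by (cases s) auto
  qed
  then show ?thesis by (simp add: push_sum_def)
qed

lemma sum_mset_conv_count: "(\<Sum>y\<in>#M. g y) = (\<Sum>y\<in>set_mset M. real (count M y) * g y)"
proof -
  have "(\<Sum>y\<in>#L. g y) = (\<Sum>y\<in>set_mset M. real (count L y) * g y)" if "set_mset L \<subseteq> set_mset M" for L
    using that
  proof (induction L)
    case (add x L)
    have "(\<Sum>y\<in>set_mset M. real (count (add_mset x L) y) * g y)
      = (\<Sum>y\<in>set_mset M. real (count L y) * g y + (if y = x then g y else 0))"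
      by (intro sum.cong) (auto simp: algebra_simps)
    also have "\<dots> = (\<Sum>y\<in>set_mset M. real (count L y) * g y) + g x"
      using add.prems by (simp add: sum.distrib)
    finally show ?case using add by simp
  qed simp
  then show ?thesis by simp
qed

lemma push_sum_Fin:
  assumes "degree h > 0"
  shows "push_sum h \<phi> (Fin w) = (\<Sum>y\<in>#proots (h - [:w:]). \<phi> (Fin y))"
proof -
  have nz: "h - [:w:] \<noteq> 0" using degree_diff_const[OF assms, of w] assms by auto
  have eq: "sphere_map h -` {Fin w} = Fin ` {y. poly h y = w}"
  proof (rule set_eqI)
    fix s show "s \<in> sphere_map h -` {Fin w} \<longleftrightarrow> s \<in> Fin ` {y. poly h y = w}" by (cases s) auto
  qed
  have "push_sum h \<phi> (Fin w) = (\<Sum>y\<in>{y. poly h y = w}. real (order y (h - [:w:])) * \<phi> (Fin y))"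
    unfolding push_sum_def eq by (subst sum.reindex) (auto simp: inj_on_def intro!: sum.cong)
  also have "\<dots> = (\<Sum>y\<in>set_mset (proots (h - [:w:])). real (count (proots (h - [:w:])) y) * \<phi> (Fin y))"
    using nz by (intro sum.cong) auto
  finally show ?thesis by (simp add: sum_mset_conv_count)
qed

lemma continuous_on_sphere:
  fixes u :: "riemann_sphere \<Rightarrow> real"
  assumes fin: "continuous_on UNIV (\<lambda>z. u (Fin z))" and inf: "((\<lambda>z. u (Fin z)) \<longlongrightarrow> u Infty) at_infinity"
  shows "continuous_on UNIV u"
  unfolding continuous_on_open_vimage[OF open_UNIV]
proof (intro allI impI)
  fix B :: "real set" assume B: "open B"
  have o: "open (Fin -` (u -` B))"
    using fin B unfolding continuous_on_open_vimage[OF open_UNIV] by (simp add: vimage_def)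
  moreover have "compact (- (Fin -` (u -` B)))" if "Infty \<in> u -` B"
  proof -
    have "eventually (\<lambda>z. u (Fin z) \<in> B) at_infinity" using inf B that by (auto simp: tendsto_def)
    then obtain b where "\<And>z. b \<le> cmod z \<Longrightarrow> u (Fin z) \<in> B" unfolding eventually_at_infinity by blast
    then have "- (Fin -` (u -` B)) \<subseteq> cball 0 b" 
    proof (intro subsetI)
      fix z assume "z \<in> - (Fin -` (u -` B))"
      then have "\<not> b \<le> cmod z" using \<open>\<And>z. b \<le> cmod z \<Longrightarrow> u (Fin z) \<in> B\<close> by auto
      then show "z \<in> cball 0 b" by simp
    qed
    then have "bounded (- (Fin -` (u -` B)))" using bounded_cball bounded_subset by blast
    then show ?thesis using o by (simp add: compact_eq_bounded_closed closed_def)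
  qed
  ultimately show "open (u -` B \<inter> UNIV)" by (simp add: open_riemann_sphere_def)
qed

lemma C2_sphere_tendsto_Infty:
  assumes "C2_sphere \<phi>" shows "((\<lambda>z. \<phi> (Fin z)) \<longlongrightarrow> \<phi> Infty) at_infinity"
proof -
  have "continuous_on UNIV (\<lambda>w. \<phi> (if w = 0 then Infty else Fin (1 / w)))"
    using assms C2_imp_continuous unfolding C2_sphere_def by blast
  then have "isCont (\<lambda>w. \<phi> (if w = 0 then Infty else Fin (1 / w))) 0"
    by (simp add: continuous_on_eq_continuous_at)
  then have "((\<lambda>w. \<phi> (if w = 0 then Infty else Fin (1 / w))) \<longlongrightarrow> \<phi> Infty) (at 0)"
    by (simp add: isCont_def)
  moreover have "\<forall>w. w \<noteq> 0 \<longrightarrow> \<phi> (if w = 0 then Infty else Fin (1 / w)) = \<phi> (Fin (inverse w))"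
    by (simp add: inverse_eq_divide)
  ultimately have lim: "((\<lambda>w. \<phi> (Fin (inverse w))) \<longlongrightarrow> \<phi> Infty) (at 0)"
    by (subst (asm) tendsto_cong[of _ "\<lambda>w. \<phi> (Fin (inverse w))"]) (auto simp: eventually_at_filter)
  show ?thesis
  proof (rule tendstoI)
    fix e :: real assume "e > 0"
    then have "eventually (\<lambda>w. dist (\<phi> (Fin (inverse w))) (\<phi> Infty) < e) (at 0)" using lim by (rule tendstoD[rotated])
    then obtain \<delta> where \<delta>: "\<delta> > 0" "\<And>w. w \<noteq> 0 \<Longrightarrow> dist w 0 < \<delta> \<Longrightarrow> dist (\<phi> (Fin (inverse w))) (\<phi> Infty) < e"
      unfolding eventually_at by auto
    have "dist (\<phi> (Fin z)) (\<phi> Infty) < e" if z: "2 / \<delta> \<le> cmod z" for z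
    proof -
      have "0 < 2 / \<delta>" using \<delta>(1) by simp
      then have z0: "z \<noteq> 0" using z by auto
      have "1 / cmod z < \<delta>" using z z0 \<delta>(1) by (simp add: field_simps)
      then show ?thesis using \<delta>(2)[of "inverse z"] z0 by (simp add: norm_inverse norm_divide inverse_eq_divide)
    qed
    then show "eventually (\<lambda>z. dist (\<phi> (Fin z)) (\<phi> Infty) < e) at_infinity"
      unfolding eventually_at_infinity by blast
  qed
qed

lemma C2_sphere_bounded:
  assumes "C2_sphere \<phi>" obtains B where "B \<ge> 0" "\<And>z. \<bar>\<phi> z\<bar> \<le> B"
proof -
  have c: "continuous_on UNIV (\<lambda>z. \<phi> (Fin z))"
    using assms C2_imp_continuous unfolding C2_sphere_def by blast
  have "eventually (\<lambda>z. dist (\<phi> (Fin z)) (\<phi> Infty) < 1) at_infinity"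
    using C2_sphere_tendsto_Infty[OF assms] by (rule tendstoD) simp
  then obtain b where b: "\<And>z. b \<le> cmod z \<Longrightarrow> dist (\<phi> (Fin z)) (\<phi> Infty) < 1"
    unfolding eventually_at_infinity by blast
  obtain K where K: "K \<ge> 0" "\<And>z. cmod z \<le> b \<Longrightarrow> norm (\<phi> (Fin z)) \<le> K"
    using continuous_bounded_cball[OF c, where M = b] by metis
  have "\<bar>\<phi> z\<bar> \<le> K + \<bar>\<phi> Infty\<bar> + 1" for z
  proof (cases z)
    case (Fin x)
    show ?thesis
    proof (cases "cmod x \<le> b")
      case True
      then show ?thesis using K(2)[of x] Fin by simp
    next
      case False
      then show ?thesis using b[of x] K(1) Fin by (simp add: dist_real_def)
    qed
  qed (use K in simp)
  then show thesis using K(1) by (intro that[of "K + \<bar>\<phi> Infty\<bar> + 1"]) auto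
qed

lemma abs_sum_mset_le:
  fixes g :: "'a \<Rightarrow> real"
  assumes "\<And>y. y \<in># M \<Longrightarrow> \<bar>g y\<bar> \<le> e"
  shows "\<bar>\<Sum>y\<in>#M. g y\<bar> \<le> real (size M) * e"
  using assms
proof (induction M)
  case (add x M)
  have "\<bar>g x\<bar> \<le> e" "\<bar>\<Sum>y\<in>#M. g y\<bar> \<le> real (size M) * e" using add by auto
  then show ?case by (simp add: distrib_right)
qed simp

lemma push_sum_bounded:
  fixes B :: real
  assumes "degree h > 0" "\<And>z. \<bar>\<phi> z\<bar> \<le> B" shows "\<bar>push_sum h \<phi> z\<bar> \<le> real (degree h) * B"
proof (cases z)
  case (Fin w)
  then show ?thesis
    using abs_sum_mset_le[of "proots (h - [:w:])" "\<lambda>y. \<phi> (Fin y)" B] assms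
    by (simp add: push_sum_Fin size_proots_complex degree_diff_const)
next
  case Infty
  then show ?thesis using assms(2)[of Infty] by (simp add: push_sum_Infty abs_mult mult_left_mono)
qed

lemma push_sum_continuous:
  assumes deg: "degree h > 0" and \<phi>: "C2_sphere \<phi>"
  shows "continuous_on UNIV (push_sum h \<phi>)"
proof (rule continuous_on_sphere)
  have "push_sum h \<phi> (Fin w) = degree h * root_avg (h - [:w:]) (\<lambda>z. \<phi> (Fin z))" for w
    using deg by (simp add: push_sum_Fin root_avg_def degree_diff_const)
  moreover have "continuous_on UNIV (\<lambda>w. root_avg (h - [:w:]) (\<lambda>z. \<phi> (Fin z)))"
    using \<phi> by (intro root_avg_continuous deg) (simp add: C2_sphere_def)
  ultimately show "continuous_on UNIV (\<lambda>z. push_sum h \<phi> (Fin z))" by (simp add: continuous_intros)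
  show "((\<lambda>z. push_sum h \<phi> (Fin z)) \<longlongrightarrow> push_sum h \<phi> Infty) at_infinity"
  proof (rule tendstoI)
    fix e :: real assume e: "e > 0"
    define N where "N = real (degree h)"
    have N: "N > 0" using deg by (simp add: N_def)
    have "eventually (\<lambda>z. dist (\<phi> (Fin z)) (\<phi> Infty) < e / (2 * N)) at_infinity"
      using C2_sphere_tendsto_Infty[OF \<phi>] by (rule tendstoD) (use e N in simp)
    then obtain b where b: "\<And>z. b \<le> cmod z \<Longrightarrow> dist (\<phi> (Fin z)) (\<phi> Infty) < e / (2 * N)"
      unfolding eventually_at_infinity by blast
    have ch: "continuous_on UNIV (poly h)" by (intro continuous_intros)
    obtain K where K: "K \<ge> 0" "\<And>z. cmod z \<le> b \<Longrightarrow> norm (poly h z) \<le> K"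
      using continuous_bounded_cball[OF ch, where M = b] by metis
    have "dist (push_sum h \<phi> (Fin w)) (push_sum h \<phi> Infty) < e" if w: "K + 1 \<le> cmod w" for w
    proof -
      let ?M = "proots (h - [:w:])"
      have sz: "real (size ?M) = N" by (simp add: size_proots_complex degree_diff_const[OF deg] N_def)
      have nz: "h - [:w:] \<noteq> 0" using degree_diff_const[OF deg, of w] deg by auto
      have "(\<Sum>y\<in>#L. \<phi> (Fin y) - \<phi> Infty) = (\<Sum>y\<in>#L. \<phi> (Fin y)) - real (size L) * \<phi> Infty" for L
        by (induction L) (auto simp: algebra_simps)
      then have "push_sum h \<phi> (Fin w) - push_sum h \<phi> Infty = (\<Sum>y\<in>#?M. \<phi> (Fin y) - \<phi> Infty)"
        using sz by (simp add: push_sum_Fin[OF deg] push_sum_Infty N_def)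
      also have "\<bar>\<dots>\<bar> \<le> real (size ?M) * (e / (2 * N))"
      proof (rule abs_sum_mset_le)
        fix y assume "y \<in># ?M"
        then have "poly h y = w" using nz by simp
        \<comment> \<open>Preimages of a large \<open>w\<close> are large, since \<open>h\<close> is
          bounded by \<open>K\<close> on the disc of radius \<open>b\<close>.\<close>
        then have "b \<le> cmod y" using K(2)[of y] w by (cases "cmod y \<le> b") auto
        then show "\<bar>\<phi> (Fin y) - \<phi> Infty\<bar> \<le> e / (2 * N)" using b[of y] by (simp add: dist_real_def)
      qed
      also have "\<dots> < e" using e N unfolding sz by simp
      finally show ?thesis by (simp add: dist_real_def)
    qed
    then show "eventually (\<lambda>w. dist (push_sum h \<phi> (Fin w)) (push_sum h \<phi> Infty) < e) at_infinity"
      unfolding eventually_at_infinity by blast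
  qed
qed

section \<open>Functoriality of the push-forward\<close>

lemma proots_prod_compose:
  assumes "degree (q :: complex poly) > 0"
  shows "(\<Sum>x\<in>#proots (\<Prod>y\<in>#M. q - [:y:]). g x) = (\<Sum>y\<in>#M. \<Sum>x\<in>#proots (q - [:y:]). g x :: real)"
proof (induction M)
  case (add y M)
  have nz: "q - [:v:] \<noteq> 0" for v using degree_diff_const[OF assms, of v] assms by auto
  then have "(\<Prod>y\<in>#M. q - [:y:]) \<noteq> 0" by (auto simp: prod_mset_zero_iff)
  then show ?case using add nz[of y] by (simp add: proots_mult)
qed simp

lemma pcompose_prod_mset: "pcompose (\<Prod>y\<in>#M. [:-y, 1:]) q = (\<Prod>y\<in>#M. q - [:y :: complex:])"
proof (induction M)
  case (add y M)
  have "pcompose [:-y, 1:] q = q - [:y:]" by (simp add: pcompose_pCons)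
  then show ?case by (simp only: image_mset_add_mset prod_mset.add_mset pcompose_mult add.IH)
qed (simp add: pcompose_1)

text \<open>Factoring \<open>f - v\<close> over its zeros \<open>y\<close> writes
  \<open>pcompose f q - v\<close> as a constant times the product of the \<open>q - y\<close>; its
  zeros, with multiplicity, are the fibres of \<open>q\<close> over those \<open>y\<close>.\<close>

lemma push_sum_compose:
  assumes f: "degree f > 0" and q: "degree q > 0"
  shows "push_sum f (push_sum q \<phi>) = push_sum (pcompose f q) \<phi>"
proof
  fix z
  have deg: "degree (pcompose f q) > 0" using f q by (simp add: degree_pcompose)
  show "push_sum f (push_sum q \<phi>) z = push_sum (pcompose f q) \<phi> z"
  proof (cases z)
    case Infty
    then show ?thesis by (simp add: push_sum_Infty degree_pcompose)
  next
    case (Fin v)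
    define M where "M = proots (f - [:v:])"
    have "f - [:v:] \<noteq> 0" using degree_diff_const[OF f, of v] f by auto
    then have lc: "lead_coeff (f - [:v:]) \<noteq> 0" by (rule leading_coeff_neq_0)
    have "pcompose f q - [:v:] = pcompose (f - [:v:]) q" by (simp add: pcompose_diff)
    also have "f - [:v:] = smult (lead_coeff (f - [:v:])) (\<Prod>y\<in>#M. [:-y, 1:])"
      unfolding M_def by (simp only: complex_poly_decompose_multiset)
    also have "pcompose \<dots> q = smult (lead_coeff (f - [:v:])) (\<Prod>y\<in>#M. q - [:y:])"
      by (simp only: pcompose_smult pcompose_prod_mset)
    finally have eq: "pcompose f q - [:v:] = smult (lead_coeff (f - [:v:])) (\<Prod>y\<in>#M. q - [:y:])" .
    have "proots (pcompose f q - [:v:]) = proots (\<Prod>y\<in>#M. q - [:y:])"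
      unfolding eq by (rule proots_smult[OF lc])
    then show ?thesis using proots_prod_compose[OF q, where M = M and g = "\<lambda>x. \<phi> (Fin x)"]
      by (simp add: Fin push_sum_Fin[OF f] push_sum_Fin[OF q] push_sum_Fin[OF deg] M_def)
  qed
qed

section \<open>Polar sets\<close>

text \<open>In contrast to \<open>ln_minus\<close>, infinite at \<open>0\<close>, as in \<open>log_energy\<close>.\<close>

definition log_pole :: "complex \<Rightarrow> ennreal" where
  "log_pole x = (if x = 0 then \<infinity> else ennreal (- ln (cmod x)))"

lemma log_pole_measurable [measurable]: "log_pole \<in> borel_measurable borel"
  unfolding log_pole_def by measurable

lemma ln_minus_le_log_pole: "ennreal (ln_minus x) \<le> log_pole x"
  by (cases "ln (cmod x) \<le> 0") (auto simp: log_pole_def ln_minus_def max_def)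

lemma log_pole_half:
  assumes "cmod y \<le> 2 * cmod x" shows "log_pole x \<le> log_pole y + ennreal (ln 2)"
proof (cases "x = 0 \<or> y = 0")
  case True
  then show ?thesis using assms by (auto simp: log_pole_def)
next
  case False
  have "ln (cmod y) \<le> ln (2 * cmod x)" using assms False by (subst ln_le_cancel_iff) auto
  also have "\<dots> = ln 2 + ln (cmod x)" using False by (simp add: ln_mult)
  finally have "- ln (cmod x) \<le> max 0 (- ln (cmod y)) + ln 2" by linarith
  then have "ennreal (- ln (cmod x)) \<le> ennreal (max 0 (- ln (cmod y)) + ln 2)" by (rule ennreal_leI)
  also have "\<dots> = ennreal (max 0 (- ln (cmod y))) + ennreal (ln 2)" by (rule ennreal_plus) auto
  also have "ennreal (max 0 (- ln (cmod y))) = ennreal (- ln (cmod y))" by (simp add: max_def ennreal_neg)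
  finally show ?thesis using False by (simp add: log_pole_def)
qed

text \<open>On a bounded set the positive part of the energy is finite, so an infinite negative part
  would force the difference to be \<open>- \<infinity>\<close>.\<close>

lemma finite_log_energy:
  assumes M: "finite_measure M" "sets M = sets borel" and K: "compact K" "emeasure M (- K) = 0"
    and energy: "log_energy M \<noteq> - \<infinity>"
  shows "(\<integral>\<^sup>+z. \<integral>\<^sup>+w. log_pole (z - w) \<partial>M \<partial>M) \<noteq> \<infinity>"
proof
  assume inf: "(\<integral>\<^sup>+z. \<integral>\<^sup>+w. log_pole (z - w) \<partial>M \<partial>M) = \<infinity>"
  interpret finite_measure M by fact
  have [measurable_cong]: "sets M = sets borel" by fact
  obtain r where r: "\<forall>x\<in>K. cmod x \<le> r" using compact_imp_bounded[OF K(1)] unfolding bounded_iff by blast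
  have AEK: "AE z in M. z \<in> K"
    by (rule AE_I[of _ _ "- K"]) (use K M in \<open>auto simp: compact_imp_closed\<close>)
  have "(\<integral>\<^sup>+z. \<integral>\<^sup>+w. ennreal (ln (cmod (z - w))) \<partial>M \<partial>M) \<le> (\<integral>\<^sup>+z. \<integral>\<^sup>+w. ennreal (2 * r) \<partial>M \<partial>M)"
  proof (rule nn_integral_mono_AE)
    show "AE z in M. (\<integral>\<^sup>+w. ennreal (ln (cmod (z - w))) \<partial>M) \<le> (\<integral>\<^sup>+w. ennreal (2 * r) \<partial>M)"
      using AEK
    proof eventually_elim
      case (elim z)
      show ?case
      proof (rule nn_integral_mono_AE)
        show "AE w in M. ennreal (ln (cmod (z - w))) \<le> ennreal (2 * r)"
          using AEK
        proof eventually_elim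
          case (elim w)
          have "cmod z \<le> r" "cmod w \<le> r" using elim \<open>z \<in> K\<close> r by auto
          then have "cmod (z - w) \<le> 2 * r" using norm_triangle_ineq4[of z w] by simp
          moreover have "ln (cmod (z - w)) \<le> cmod (z - w)" 
            by (cases "z = w") (auto intro: order_trans[OF ln_le_minus_one])
          ultimately show ?case by (intro ennreal_leI) simp
        qed
      qed
    qed
  qed
  also have "\<dots> < \<infinity>" using emeasure_finite[of "space M"] by (simp add: ennreal_mult_eq_top_iff less_top[symmetric])
  finally have fin: "(\<integral>\<^sup>+z. \<integral>\<^sup>+w. ennreal (ln (cmod (z - w))) \<partial>M \<partial>M) < \<infinity>" .
  have eq: "(if z = w then \<infinity> else ennreal (- ln (cmod (z - w)))) = log_pole (z - w)" for z w
    by (simp add: log_pole_def)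
  have "log_energy M = enn2ereal (\<integral>\<^sup>+z. \<integral>\<^sup>+w. ennreal (ln (cmod (z - w))) \<partial>M \<partial>M) - enn2ereal \<infinity>"
    unfolding log_energy_def eq inf ..
  also have "\<dots> = - \<infinity>"
    using fin by (cases "(\<integral>\<^sup>+z. \<integral>\<^sup>+w. ennreal (ln (cmod (z - w))) \<partial>M \<partial>M)") auto
  finally show False using energy by simp
qed

text \<open>A bound for the potential on the compact set \<open>K'\<close> propagates to all points \<open>z\<close> by comparison with
  the point of \<open>K'\<close> closest to \<open>z\<close>, at the cost of \<open>ln 2\<close>.\<close>

lemma bounded_potential_restriction:
  assumes M: "finite_measure M" "sets M = sets borel" "emeasure M UNIV \<noteq> 0"
    and K: "compact K" "emeasure M (- K) = 0" and energy: "log_energy M \<noteq> - \<infinity>"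
  obtains K' C where "compact K'" "K' \<subseteq> K" "emeasure M K' > 0"
    "\<And>z. (\<integral>\<^sup>+w\<in>K'. log_pole (z - w) \<partial>M) \<le> ennreal C"
proof -
  interpret finite_measure M by fact
  have [measurable_cong]: "sets M = sets borel" by fact
  have sp: "space M = UNIV" using M(2) sets_eq_imp_space_eq by fastforce
  define p where "p z = (\<integral>\<^sup>+w. log_pole (z - w) \<partial>M)" for z
  have [measurable]: "p \<in> borel_measurable M" unfolding p_def by measurable
  have [measurable]: "p \<in> borel_measurable borel"
    using \<open>p \<in> borel_measurable M\<close> measurable_cong_sets[OF M(2) refl] by blast
  have "AE z in M. p z \<noteq> \<infinity>"
    using finite_log_energy[OF M(1,2) K energy] unfolding p_def[symmetric] by (intro nn_integral_noteq_infinite) auto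
  \<comment> \<open>A potential that is finite almost everywhere is at most some natural number
    \<open>T\<close> on a set of positive measure, by countable additivity.\<close>
  then have "\<exists>T::nat. \<not> (AE z in M. \<not> p z \<le> of_nat T)"
  proof (rule contrapos_pp)
    assume "\<not> (\<exists>T::nat. \<not> (AE z in M. \<not> p z \<le> of_nat T))"
    then have "AE z in M. \<forall>T::nat. \<not> p z \<le> of_nat T" by (simp add: AE_all_countable)
    then have "AE z in M. p z = \<infinity>"
    proof eventually_elim
      case (elim z)
      show ?case
      proof (rule ccontr)
        assume "p z \<noteq> \<infinity>"
        then have "p z < top" by (simp add: less_top)
        then obtain T where "p z < of_nat T" using ennreal_Ex_less_of_nat by blast
        then show False using elim less_imp_le by blast
      qed
    qed
    show "\<not> (AE z in M. p z \<noteq> \<infinity>)"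
    proof
      assume "AE z in M. p z \<noteq> \<infinity>"
      with \<open>AE z in M. p z = \<infinity>\<close> have "AE z in M. False" by eventually_elim simp
      then have "emeasure M (space M) = 0" using AE_iff_measurable[of "space M" M "\<lambda>_. False"] by auto
      then show False using M(3) sp by simp
    qed
  qed
  then obtain T :: nat where T: "\<not> (AE z in M. \<not> p z \<le> of_nat T)" by blast
  define A where "A = {z \<in> K. p z \<le> of_nat T}"
  have Kb: "K \<in> sets borel" using K(1) by (simp add: compact_imp_closed)
  have A: "A \<in> sets borel" unfolding A_def using Kb by measurable
  have "emeasure M A \<noteq> 0"
  proof
    assume "emeasure M A = 0"
    then have "AE z in M. z \<notin> A" using A M(2) by (intro AE_not_in) (auto simp: null_sets_def)
    moreover have "AE z in M. z \<in> K"
      by (rule AE_I[of _ _ "- K"]) (use K M in \<open>auto simp: compact_imp_closed\<close>)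
    ultimately have "AE z in M. \<not> p z \<le> of_nat T" by eventually_elim (auto simp: A_def)
    then show False using T by simp
  qed
  \<comment> \<open>Inner regularity replaces the sublevel set by a compact one, in which closest
    points exist.\<close>
  then have "(SUP K' \<in> {K'. K' \<subseteq> A \<and> compact K'}. emeasure M K') > 0"
    using inner_regular[OF M(2) _ A] emeasure_finite by (simp add: zero_less_iff_neq_zero)
  then obtain K' where K': "K' \<subseteq> A" "compact K'" "emeasure M K' > 0"
    unfolding less_SUP_iff by blast
  have "K' \<noteq> {}" using K'(3) by auto
  have K'b: "K' \<in> sets M" using K'(2) M(2) by (simp add: compact_imp_closed)
  define C where "C = real T + ln 2 * measure M UNIV"
  have "(\<integral>\<^sup>+w\<in>K'. log_pole (z - w) \<partial>M) \<le> ennreal C" for z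
  proof -
    define z' where "z' = closest_point K' z"
    have z': "z' \<in> K'" using closest_point_in_set[of K' z] K'(2) \<open>K' \<noteq> {}\<close> by (simp add: z'_def compact_imp_closed)
    have near: "cmod (z - z') \<le> cmod (z - w)" if "w \<in> K'" for w
      using closest_point_le[of K' w z] K'(2) that by (simp add: z'_def compact_imp_closed dist_norm)
    have "(\<integral>\<^sup>+w\<in>K'. log_pole (z - w) \<partial>M) \<le> (\<integral>\<^sup>+w. log_pole (z' - w) + ennreal (ln 2) \<partial>M)"
    proof (rule nn_integral_mono)
      fix w
      show "log_pole (z - w) * indicator K' w \<le> log_pole (z' - w) + ennreal (ln 2)"
      proof (cases "w \<in> K'")
        case True
        have "cmod (z' - w) \<le> cmod (z - z') + cmod (z - w)"
          using norm_triangle_ineq[of "z' - z" "z - w"] by (simp add: norm_minus_commute)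
        then have "cmod (z' - w) \<le> 2 * cmod (z - w)" using near[OF True] by simp
        then show ?thesis using True log_pole_half by simp
      qed simp
    qed
    also have "\<dots> = p z' + ennreal (ln 2) * emeasure M UNIV"
      unfolding p_def by (subst nn_integral_add) (auto simp: sp)
    also have "\<dots> \<le> of_nat T + ennreal (ln 2) * ennreal (measure M UNIV)"
      using z' K'(1) by (intro add_mono) (auto simp: A_def emeasure_eq_measure)
    also have "\<dots> = ennreal C"
      by (simp add: C_def ennreal_mult ennreal_of_nat_eq_real_of_nat ennreal_plus del: ennreal_plus_if)
    finally show ?thesis .
  qed
  then show thesis using K' by (intro that[of K' C]) (auto simp: A_def)
qed

text \<open>The sum of pushed-forward potentials is integrable against every measure whose own
  potential is bounded, hence it is finite outside a polar set.\<close>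

lemma polar_divergence_set:
  fixes h :: "nat \<Rightarrow> complex \<Rightarrow> complex" and r :: real
  assumes h: "\<And>n. h n \<in> borel_measurable borel" and r: "0 < r" "r < 1"
    and B: "B \<in> sets lborel" "emeasure lborel B < \<infinity>"
  shows "polar {a. (\<Sum>n. ennreal (r ^ n) * (\<integral>\<^sup>+z\<in>B. log_pole (h n z - a) \<partial>lborel)) = \<infinity>}"
  unfolding polar_def
proof (intro allI impI)
  fix M :: "complex measure" and K
  define U where "U a = (\<Sum>n. ennreal (r ^ n) * (\<integral>\<^sup>+z\<in>B. log_pole (h n z - a) \<partial>lborel))" for a
  assume asm: "finite_measure M \<and> sets M = sets borel \<and> emeasure M UNIV \<noteq> 0 \<and>
        compact K \<and> K \<subseteq> {a. (\<Sum>n. ennreal (r ^ n) * (\<integral>\<^sup>+z\<in>B. log_pole (h n z - a) \<partial>lborel)) = \<infinity>} \<and> emeasure M (- K) = 0"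
  then have M: "finite_measure M" "sets M = sets borel" "emeasure M UNIV \<noteq> 0" and K: "compact K" "emeasure M (- K) = 0"
    and KU: "\<And>a. a \<in> K \<Longrightarrow> U a = \<infinity>" by (auto simp: U_def)
  interpret finite_measure M by fact
  interpret P: pair_sigma_finite lborel M by standard
  have [measurable_cong]: "sets M = sets borel" by fact
  have [measurable]: "h n \<in> borel_measurable borel" for n by (rule h)
  have [measurable]: "B \<in> sets borel" using B by simp
  show "log_energy M = - \<infinity>"
  proof (rule ccontr)
    assume "log_energy M \<noteq> - \<infinity>"
    then obtain K' C where K': "compact K'" "K' \<subseteq> K" "emeasure M K' > 0"
      "\<And>z. (\<integral>\<^sup>+w\<in>K'. log_pole (z - w) \<partial>M) \<le> ennreal C"
      using bounded_potential_restriction[OF M K] by metis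
    have [measurable]: "K' \<in> sets borel" using K'(1) by (simp add: compact_imp_closed)
    have K'M: "K' \<in> sets M" using M(2) by simp
    have meas: "(\<lambda>a. \<integral>\<^sup>+z\<in>B. log_pole (h n z - a) \<partial>lborel) \<in> borel_measurable borel" for n
      by measurable
    \<comment> \<open>\<open>U\<close> is infinite on \<open>K'\<close>, which has positive measure;
      yet by Fubini its integral over \<open>K'\<close> is at most \<open>C\<close> times the area
      of \<open>B\<close> times a geometric series.\<close>
    have "\<infinity> = \<infinity> * emeasure M K'" using K'(3) by (simp add: ennreal_top_mult)
    also have "\<dots> = (\<integral>\<^sup>+a. \<infinity> * indicator K' a \<partial>M)" using K'M by (simp only: nn_integral_cmult_indicator)
    also have "\<dots> \<le> (\<integral>\<^sup>+a. (\<Sum>n. ennreal (r ^ n) * (\<integral>\<^sup>+z\<in>B. log_pole (h n z - a) \<partial>lborel) * indicator K' a) \<partial>M)"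
    proof (rule nn_integral_mono)
      fix a show "\<infinity> * indicator K' a \<le> (\<Sum>n. ennreal (r ^ n) * (\<integral>\<^sup>+z\<in>B. log_pole (h n z - a) \<partial>lborel) * indicator K' a)"
        using KU[of a] K'(2) by (cases "a \<in> K'") (auto simp: U_def)
    qed
    also have "\<dots> = (\<Sum>n. \<integral>\<^sup>+a. ennreal (r ^ n) * (\<integral>\<^sup>+z\<in>B. log_pole (h n z - a) \<partial>lborel) * indicator K' a \<partial>M)"
    proof (rule nn_integral_suminf)
      fix n
      show "(\<lambda>a. ennreal (r ^ n) * (\<integral>\<^sup>+z\<in>B. log_pole (h n z - a) \<partial>lborel) * indicator K' a) \<in> borel_measurable M"
        using meas[of n] measurable_cong_sets[OF M(2) refl] by measurable
    qed
    also have "\<dots> \<le> (\<Sum>n. ennreal (r ^ n) * (ennreal C * emeasure lborel B))"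
    proof (intro suminf_le summableI)
      fix n
      have "(\<integral>\<^sup>+a. ennreal (r ^ n) * (\<integral>\<^sup>+z\<in>B. log_pole (h n z - a) \<partial>lborel) * indicator K' a \<partial>M)
        = ennreal (r ^ n) * (\<integral>\<^sup>+a. (\<integral>\<^sup>+z\<in>B. log_pole (h n z - a) \<partial>lborel) * indicator K' a \<partial>M)"
        using meas[of n] measurable_cong_sets[OF M(2) refl]
        by (subst nn_integral_cmult[symmetric]) (measurable, simp add: mult.assoc)
      also have "(\<integral>\<^sup>+a. (\<integral>\<^sup>+z\<in>B. log_pole (h n z - a) \<partial>lborel) * indicator K' a \<partial>M)
        = (\<integral>\<^sup>+a. (\<integral>\<^sup>+z. log_pole (h n z - a) * indicator B z * indicator K' a \<partial>lborel) \<partial>M)"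
        by (intro nn_integral_cong nn_integral_multc[symmetric]) measurable
      also have "\<dots> = (\<integral>\<^sup>+z. (\<integral>\<^sup>+a. log_pole (h n z - a) * indicator B z * indicator K' a \<partial>M) \<partial>lborel)"
        by (rule P.Fubini') measurable
      also have "\<dots> \<le> (\<integral>\<^sup>+z. ennreal C * indicator B z \<partial>lborel)"
      proof (rule nn_integral_mono)
        fix z
        show "(\<integral>\<^sup>+a. log_pole (h n z - a) * indicator B z * indicator K' a \<partial>M) \<le> ennreal C * indicator B z"
          using K'(4)[of "h n z"] by (cases "z \<in> B") auto
      qed
      also have "\<dots> = ennreal C * emeasure lborel B" using B(1) by (rule nn_integral_cmult_indicator)
      finally show "(\<integral>\<^sup>+a. ennreal (r ^ n) * (\<integral>\<^sup>+z\<in>B. log_pole (h n z - a) \<partial>lborel) * indicator K' a \<partial>M)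
        \<le> ennreal (r ^ n) * (ennreal C * emeasure lborel B)" by (simp add: mult_left_mono)
    qed
    also have "\<dots> = (\<Sum>n. ennreal (r ^ n)) * (ennreal C * emeasure lborel B)"
      by (rule ennreal_suminf_multc)
    also have "(\<Sum>n. ennreal (r ^ n)) = ennreal (\<Sum>n. r ^ n)"
      using r by (intro suminf_ennreal2) (auto intro!: summable_geometric)
    also have "\<dots> * (ennreal C * emeasure lborel B) < \<infinity>"
      using B(2) by (simp add: ennreal_mult_less_top)
    finally show False by simp
  qed
qed

section \<open>The equilibrium measure\<close>

lemma ln_cmod_diff_bound:
  "\<bar>ln (cmod (x - w)) - ln_plus x\<bar> \<le> ln_minus (x - w) + ln (1 + cmod w)"
  using ln_plus_diff[of x w] ln_minus_nonneg[of "x - w"] unfolding ln_cmod_eq[of "x - w"] by linarith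

lemma push_sum_root_avg:
  assumes "degree h > 0"
  shows "push_sum h \<phi> (Fin w) = real (degree h) * root_avg (h - [:w:]) (\<lambda>z. \<phi> (Fin z))"
  using assms by (simp add: push_sum_Fin root_avg_def degree_diff_const)

lemma push_sum_id: "push_sum [:0, 1:] \<phi> = \<phi>"
proof
  fix z show "push_sum [:0, 1:] \<phi> z = \<phi> z"
    by (cases z) (simp_all add: push_sum_Fin push_sum_Infty)
qed

lemma borel_measurable_continuous_sphere:
  fixes u :: "riemann_sphere \<Rightarrow> real"
  assumes "continuous_on UNIV u" "sets \<mu> = sets borel"
  shows "u \<in> borel_measurable \<mu>"
  using borel_measurable_continuous_onI[OF assms(1)] measurable_cong_sets[OF assms(2) refl] by blast

text \<open>A local degree at a finite point is at least 1, being the order of a zero. Hence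
  \<open>\<eta>\<close> exceeds 1, which opens the interval from which \<open>\<theta>\<close> is
  taken.\<close>

lemma superattracting_growth_ge_1:
  assumes "degree f > 1" shows "superattracting_growth f \<ge> 1"
proof (cases "\<exists>z. superattracting_periodic f z")
  case True
  then obtain z where z: "superattracting_periodic f z" by blast
  have "1 \<le> local_degree_growth f z"
    unfolding local_degree_growth_def
  proof (rule le_Limsup)
    show "eventually (\<lambda>n. 1 \<le> ereal (root n (real (local_degree (poly_iterate f n) (Fin z))))) sequentially"
      using eventually_gt_at_top[of 0]
    proof eventually_elim
      case (elim n)
      let ?h = "poly_iterate f n"
      have "degree ?h > 0" using assms by (simp add: degree_poly_iterate)
      then have "?h - [:poly ?h z:] \<noteq> 0" using degree_diff_const[of ?h "poly ?h z"] by auto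
      then have "order z (?h - [:poly ?h z:]) \<noteq> 0" by (simp add: order_root[symmetric] order_eq_0_iff)
      then have "1 \<le> real (local_degree ?h (Fin z))" by simp
      then have "root n 1 \<le> root n (real (local_degree ?h (Fin z)))" using elim by (intro real_root_le_mono) auto
      then show ?case using elim by simp
    qed
  qed simp
  also have "\<dots> \<le> (SUP z\<in>{z. superattracting_periodic f z}. local_degree_growth f z)"
    using z by (intro SUP_upper) simp
  finally show ?thesis using True by (simp add: superattracting_growth_def)
qed (simp add: superattracting_growth_def)

context escaping_poly
begin

text \<open>The invariance of \<open>\<mu>\<close> is applied at each stage to a continuous
  function: \<open>push_sum (F n) \<phi>\<close> is a single push-forward of the C^2 function
  \<open>\<phi>\<close> under an iterate, so \<open>push_sum_continuous\<close> covers it.\<close>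

lemma equilibrium_iterate:
  assumes eq: "is_equilibrium_measure f \<mu>" and \<phi>: "C2_sphere \<phi>"
  shows "(\<integral>z. push_sum (F n) \<phi> z \<partial>\<mu>) = real (degree f) ^ n * (\<integral>z. \<phi> z \<partial>\<mu>)"
proof (induction n)
  case (Suc n)
  have "continuous_on UNIV (push_sum (F n) \<phi>)" by (rule push_sum_continuous[OF degree_F(2) \<phi>])
  then have "pullback f \<mu> (push_sum (F n) \<phi>) = real (degree f) * (\<integral>z. push_sum (F n) \<phi> z \<partial>\<mu>)"
    using eq unfolding is_equilibrium_measure_def by blast
  moreover have "push_sum f (push_sum (F n) \<phi>) = push_sum (F (Suc n)) \<phi>"
    unfolding poly_iterate_Suc using deg by (intro push_sum_compose degree_F) simp
  ultimately show ?case using Suc by (simp add: pullback_eq_push_sum)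
qed (simp add: push_sum_id)

lemma F_roots_bounded:
  assumes "cmod w < 2 ^ n * R" "poly (F n) y = w" shows "cmod y \<le> R"
proof (rule ccontr)
  assume "\<not> cmod y \<le> R"
  then have y: "R \<le> cmod y" by simp
  have "2 ^ n * R \<le> 2 ^ n * cmod y" using y by (intro mult_left_mono) auto
  also have "\<dots> \<le> cmod w" using F_growth[OF y, of n] assms(2) by simp
  finally show False using assms(1) by simp
qed

text \<open>By invariance the integral of \<open>\<phi>\<close> is the \<open>\<mu>\<close>-mean of
  its averages over the fibres of \<open>f^(2 m)\<close>. These depend less and less on the finite
  base point, and infinity carries no mass, so the averages over the fibre of 0 converge to that
  integral.\<close>

lemma equilibrium_limit:
  assumes eq: "is_equilibrium_measure f \<mu>" and exc: "exceptional_set f = {Infty}" and \<phi>: "C2_sphere \<phi>"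
  shows "(\<lambda>m. root_avg (F (2 * m) - [:0:]) (\<lambda>z. \<phi> (Fin z))) \<longlonglongrightarrow> (\<integral>z. \<phi> z \<partial>\<mu>)"
proof -
  let ?g = "\<lambda>z. \<phi> (Fin z)"
  let ?d = "real (degree f)"
  have g: "C2 ?g" using \<phi> by (simp add: C2_sphere_def)
  interpret prob_space \<mu> using eq by (simp add: is_equilibrium_measure_def)
  have sets: "sets \<mu> = sets borel" using eq by (simp add: is_equilibrium_measure_def)
  obtain b where b: "b \<longlonglongrightarrow> 0" "\<And>m. b m \<ge> 0"
    "\<And>m w. (\<integral>\<^sup>+z\<in>cball 0 (R + 2). ennreal (ln_minus (poly (F (2 * m)) z - w)) \<partial>lborel)
      \<le> ennreal (real (degree f) ^ (2 * m) * b m)"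
    by (rule even_iterate_integral[OF exc]) (rule that)
  have R0: "R \<ge> 0" using R by simp
  obtain C where C: "C > 0" "\<And>p q. degree p > 0 \<Longrightarrow> degree q > 0 \<Longrightarrow> (\<forall>y. poly p y = 0 \<longrightarrow> cmod y \<le> R) \<Longrightarrow>
    (\<forall>y. poly q y = 0 \<longrightarrow> cmod y \<le> R) \<Longrightarrow>
    ennreal \<bar>root_avg p ?g - root_avg q ?g\<bar> \<le> ennreal C * (\<integral>\<^sup>+z\<in>cball 0 (R + 2).
      ennreal \<bar>ln (cmod (poly p z)) / degree p - ln (cmod (poly q z)) / degree q\<bar> \<partial>lborel)"
    by (rule root_avg_comparison[OF g R0]) (rule that)
  define V where "V = pi * (R + 2)\<^sup>2"
  define A where "A w m = root_avg (F (2 * m) - [:w:]) ?g" for w m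
  have d: "?d \<ge> 2" using deg by simp
  have Adiff: "(\<lambda>m. A w m - A 0 m) \<longlonglongrightarrow> 0" for w
  proof -
    define e where "e m = C * (2 * b m + ln (1 + cmod w) * V / ?d ^ (2 * m))" for m
    have "eventually (\<lambda>m. cmod w < 2 ^ (2 * m) * R) sequentially"
    proof -
      have "filterlim (\<lambda>m. 2 ^ (2 * m) * R) at_top sequentially" using R by real_asymp
      then show ?thesis by (simp add: filterlim_at_top_dense)
    qed
    then have "eventually (\<lambda>m. norm (A w m - A 0 m) \<le> e m) sequentially"
    proof eventually_elim
      case (elim m)
      let ?Q = "\<lambda>v. F (2 * m) - [:v:]"
      have dQ: "real (degree (?Q v)) = ?d ^ (2 * m)" for v by (simp add: degree_F_minus)
      have dQ0: "degree (?Q v) > 0" for v using deg by (simp add: degree_F_minus)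
      have roots: "\<forall>y. poly (?Q v) y = 0 \<longrightarrow> cmod y \<le> R" if "cmod v < 2 ^ (2 * m) * R" for v
        using F_roots_bounded[OF that] by simp
      have dm: "?d ^ (2 * m) > 0" using d by simp
      have lw: "ln (1 + cmod w) \<ge> 0" by simp
      have "(\<integral>\<^sup>+z\<in>cball 0 (R + 2). ennreal \<bar>ln (cmod (poly (?Q w) z)) / degree (?Q w) - ln (cmod (poly (?Q 0) z)) / degree (?Q 0)\<bar> \<partial>lborel)
        \<le> (\<integral>\<^sup>+z. ennreal (1 / ?d ^ (2 * m)) * (ennreal (ln_minus (poly (F (2 * m)) z - w)) * indicator (cball 0 (R + 2)) z
           + (ennreal (ln_minus (poly (F (2 * m)) z - 0)) * indicator (cball 0 (R + 2)) z
           + ennreal (ln (1 + cmod w)) * indicator (cball 0 (R + 2)) z)) \<partial>lborel)"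
      proof (rule nn_integral_mono)
        fix z
        define x where "x = poly (F (2 * m)) z"
        \<comment> \<open>Both logarithms are compared with \<open>ln_plus x\<close>, which cancels;
          two negative parts and a constant remain, to be divided by the degree.\<close>
        have "\<bar>ln (cmod (x - w)) - ln (cmod (x - 0))\<bar> \<le> ln_minus (x - w) + (ln_minus (x - 0) + ln (1 + cmod w))"
          using ln_cmod_diff_bound[of x w] ln_cmod_diff_bound[of x 0] by (simp only: norm_zero add_0_right ln_one)
        then have "\<bar>ln (cmod (x - w)) - ln (cmod (x - 0))\<bar> / ?d ^ (2 * m) \<le> 1 / ?d ^ (2 * m) * (ln_minus (x - w) + (ln_minus (x - 0) + ln (1 + cmod w)))"
          using dm by (simp add: divide_right_mono)
        moreover have "\<bar>ln (cmod (poly (?Q w) z)) / degree (?Q w) - ln (cmod (poly (?Q 0) z)) / degree (?Q 0)\<bar>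
          = \<bar>ln (cmod (x - w)) - ln (cmod (x - 0))\<bar> / ?d ^ (2 * m)"
          unfolding dQ using dm by (simp add: x_def diff_divide_distrib[symmetric] abs_divide)
        ultimately have "ennreal \<bar>ln (cmod (poly (?Q w) z)) / degree (?Q w) - ln (cmod (poly (?Q 0) z)) / degree (?Q 0)\<bar>
          \<le> ennreal (1 / ?d ^ (2 * m) * (ln_minus (x - w) + (ln_minus (x - 0) + ln (1 + cmod w))))"
          by (intro ennreal_leI) simp
        also have "\<dots> = ennreal (1 / ?d ^ (2 * m)) * (ennreal (ln_minus (x - w)) + (ennreal (ln_minus (x - 0)) + ennreal (ln (1 + cmod w))))"
        proof -
          have "ennreal (1 / ?d ^ (2 * m) * (ln_minus (x - w) + (ln_minus (x - 0) + ln (1 + cmod w))))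
            = ennreal (1 / ?d ^ (2 * m)) * ennreal (ln_minus (x - w) + (ln_minus (x - 0) + ln (1 + cmod w)))"
            using dm lw by (intro ennreal_mult add_nonneg_nonneg) auto
          also have "ennreal (ln_minus (x - w) + (ln_minus (x - 0) + ln (1 + cmod w)))
            = ennreal (ln_minus (x - w)) + ennreal (ln_minus (x - 0) + ln (1 + cmod w))"
            using lw by (intro ennreal_plus add_nonneg_nonneg) auto
          also have "ennreal (ln_minus (x - 0) + ln (1 + cmod w)) = ennreal (ln_minus (x - 0)) + ennreal (ln (1 + cmod w))"
            using lw by (intro ennreal_plus) auto
          finally show ?thesis .
        qed
        finally show "ennreal \<bar>ln (cmod (poly (?Q w) z)) / degree (?Q w) - ln (cmod (poly (?Q 0) z)) / degree (?Q 0)\<bar> * indicator (cball 0 (R + 2)) z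
          \<le> ennreal (1 / ?d ^ (2 * m)) * (ennreal (ln_minus (poly (F (2 * m)) z - w)) * indicator (cball 0 (R + 2)) z
           + (ennreal (ln_minus (poly (F (2 * m)) z - 0)) * indicator (cball 0 (R + 2)) z
           + ennreal (ln (1 + cmod w)) * indicator (cball 0 (R + 2)) z))"
          by (simp add: indicator_def x_def)
      qed
      also have "\<dots> = ennreal (1 / ?d ^ (2 * m)) * ((\<integral>\<^sup>+z\<in>cball 0 (R + 2). ennreal (ln_minus (poly (F (2 * m)) z - w)) \<partial>lborel)
          + ((\<integral>\<^sup>+z\<in>cball 0 (R + 2). ennreal (ln_minus (poly (F (2 * m)) z - 0)) \<partial>lborel)
          + ennreal (ln (1 + cmod w)) * emeasure lborel (cball (0::complex) (R + 2))))"
      proof -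
        have m0: "poly (F (2 * m)) \<in> borel_measurable borel" by (intro borel_measurable_continuous_onI continuous_intros)
        have m1: "(\<lambda>z. ennreal (ln_minus (poly (F (2 * m)) z - v)) * indicator (cball 0 (R + 2)) z) \<in> borel_measurable lborel"
          "(\<lambda>z::complex. ennreal (ln (1 + cmod w)) * indicator (cball 0 (R + 2)) z) \<in> borel_measurable lborel" for v
          using m0 by (auto intro!: borel_measurable_times_ennreal borel_measurable_indicator)
        show ?thesis
          by (simp only: nn_integral_cmult nn_integral_add m1 borel_measurable_add
            nn_integral_cmult_indicator[of "cball (0::complex) (R + 2)" lborel] sets_lborel borel_closed closed_cball)
      qed
      also have "\<dots> \<le> ennreal (1 / ?d ^ (2 * m)) * (ennreal (?d ^ (2 * m) * b m) + (ennreal (?d ^ (2 * m) * b m) + ennreal (ln (1 + cmod w)) * ennreal V))"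
        using R by (intro mult_left_mono add_mono b(3)) (auto simp: V_def emeasure_cball_complex)
      also have "\<dots> = ennreal (1 / ?d ^ (2 * m) * (?d ^ (2 * m) * b m + (?d ^ (2 * m) * b m + ln (1 + cmod w) * V)))"
        using dm b(2)[of m] lw by (simp add: ennreal_mult[symmetric] ennreal_plus[symmetric] V_def del: ennreal_plus)
      also have "1 / ?d ^ (2 * m) * (?d ^ (2 * m) * b m + (?d ^ (2 * m) * b m + ln (1 + cmod w) * V)) = 2 * b m + ln (1 + cmod w) * V / ?d ^ (2 * m)"
        using dm by (simp add: field_simps)
      finally have "ennreal \<bar>A w m - A 0 m\<bar> \<le> ennreal C * ennreal (2 * b m + ln (1 + cmod w) * V / ?d ^ (2 * m))"
        unfolding A_def using elim R by (intro order_trans[OF C(2)[OF dQ0 dQ0 roots roots] mult_left_mono]) auto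
      also have "\<dots> = ennreal (e m)"
        unfolding e_def using C(1) b(2)[of m] lw dm by (intro ennreal_mult[symmetric]) (auto simp: V_def)
      finally show ?case
        using C(1) b(2)[of m] lw dm by (subst (asm) ennreal_le_iff) (auto simp: e_def V_def)
    qed
    moreover have "e \<longlonglongrightarrow> 0"
    proof -
      have "(\<lambda>m. ln (1 + cmod w) * V / ?d ^ (2 * m)) \<longlonglongrightarrow> 0" using d by real_asymp
      then have "e \<longlonglongrightarrow> C * (2 * 0 + 0)" unfolding e_def by (intro tendsto_intros b(1))
      then show ?thesis by simp
    qed
    ultimately show ?thesis by (rule Lim_null_comparison)
  qed
  obtain B\<phi> where B: "B\<phi> \<ge> 0" "\<And>z. \<bar>\<phi> z\<bar> \<le> B\<phi>" by (rule C2_sphere_bounded[OF \<phi>]) (rule that)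
  define \<Psi> where "\<Psi> m z = push_sum (F (2 * m)) \<phi> z / ?d ^ (2 * m)" for m z
  have \<Psi>F: "\<Psi> m (Fin w) = A w m" for m w
    using d by (simp add: \<Psi>_def A_def push_sum_root_avg degree_F)
  have \<Psi>B: "\<bar>\<Psi> m z\<bar> \<le> B\<phi>" for m z
  proof -
    have "\<bar>push_sum (F (2 * m)) \<phi> z\<bar> \<le> ?d ^ (2 * m) * B\<phi>"
      using push_sum_bounded[where h = "F (2 * m)" and \<phi> = \<phi> and B = B\<phi> and z = z, OF degree_F(2) B(2)] by (simp add: degree_F(1))
    then show ?thesis using d by (simp add: \<Psi>_def abs_divide field_simps)
  qed
  have meas: "\<Psi> m \<in> borel_measurable \<mu>" for m
    unfolding \<Psi>_def by (intro borel_measurable_divide borel_measurable_const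
        borel_measurable_continuous_sphere sets push_sum_continuous degree_F(2) \<phi>)
  have int\<Psi>: "integrable \<mu> (\<Psi> m)" for m
    by (rule integrable_const_bound[of _ B\<phi>]) (use meas \<Psi>B in auto)
  have I\<Psi>: "(\<integral>z. \<Psi> m z \<partial>\<mu>) = (\<integral>z. \<phi> z \<partial>\<mu>)" for m
    unfolding \<Psi>_def using equilibrium_iterate[OF eq \<phi>, of "2 * m"] d by simp
  have inf0: "AE z in \<mu>. z \<noteq> Infty"
  proof -
    have "{Infty} \<in> sets \<mu>"
    proof -
      have "open (- {Infty :: riemann_sphere})" by (auto simp: open_riemann_sphere_def vimage_def)
      then show ?thesis unfolding sets by (metis borel_closed closed_def)
    qed
    moreover have "measure \<mu> {Infty} = 0" using eq exc by (simp add: is_equilibrium_measure_def)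
    ultimately have "{Infty} \<in> null_sets \<mu>" by (simp add: null_sets_def emeasure_eq_measure)
    then show ?thesis using AE_not_in by force
  qed
  have "(\<lambda>m. \<integral>z. \<Psi> m z - A 0 m \<partial>\<mu>) \<longlonglongrightarrow> (\<integral>z. 0 \<partial>\<mu>)"
  \<comment> \<open>Convergence is only pointwise in the base point, but all averages are bounded by
    \<open>B\<phi>\<close> and \<open>\<mu>\<close> is a probability measure.\<close>
  proof (rule integral_dominated_convergence[where w = "\<lambda>_. 2 * B\<phi>"])
    show "AE z in \<mu>. (\<lambda>m. \<Psi> m z - A 0 m) \<longlonglongrightarrow> 0"
      using inf0
    proof eventually_elim
      case (elim z)
      then obtain w where "z = Fin w" by (cases z) auto
      then show ?case using Adiff[of w] by (simp add: \<Psi>F)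
    qed
    show "AE z in \<mu>. norm (\<Psi> m z - A 0 m) \<le> 2 * B\<phi>" for m
    proof (rule AE_I2)
      fix z
      show "norm (\<Psi> m z - A 0 m) \<le> 2 * B\<phi>" using \<Psi>B[of m z] \<Psi>B[of m "Fin 0"] unfolding \<Psi>F real_norm_def by linarith
    qed
  qed (use meas in auto)
  moreover have "(\<integral>z. \<Psi> m z - A 0 m \<partial>\<mu>) = (\<integral>z. \<phi> z \<partial>\<mu>) - A 0 m" for m
    using int\<Psi>[of m] I\<Psi>[of m] prob_space by simp
  ultimately have "(\<lambda>m. (\<integral>z. \<phi> z \<partial>\<mu>) - A 0 m) \<longlonglongrightarrow> 0" by simp
  then have "(\<lambda>m. (\<integral>z. \<phi> z \<partial>\<mu>) - ((\<integral>z. \<phi> z \<partial>\<mu>) - A 0 m)) \<longlonglongrightarrow> (\<integral>z. \<phi> z \<partial>\<mu>) - 0" by (intro tendsto_intros)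
  then show ?thesis by (simp add: A_def)
qed

end

section \<open>The rate of convergence\<close>

context escaping_poly
begin

lemma deriv_F_degree: "degree (pderiv (F n)) = degree f ^ n - 1"
  by (simp add: degree_pderiv degree_F(1))

lemma deriv_F_roots_bounded:
  assumes "cmod a < 2 ^ n" "poly (pderiv (F n)) y = a" shows "cmod y \<le> R"
proof (rule ccontr)
  assume "\<not> cmod y \<le> R"
  then show False using F_deriv_growth[of y n] assms by simp
qed

text \<open>Five replacements in a row: the shift by \<open>a\<close> and the negative part are
  removed, the derivative becomes the iterate, the normalisation \<open>d^n - 1\<close> becomes
  \<open>d^n\<close>, time \<open>n\<close> becomes time \<open>2 m\<close>, and
  \<open>ln_plus\<close> returns to \<open>ln\<close>. The factor 2 is
  \<open>1 / (D - 1) \<le> 2 / D\<close>.\<close>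

lemma deriv_potential_pointwise:
  assumes n: "n \<ge> 1" "n \<le> 2 * m" and z: "z \<in> cball 0 (R + 2)"
  shows "\<bar>ln (cmod (poly (pderiv (F n)) z - a)) / (real (degree f) ^ n - 1) - ln (cmod (poly (F (2 * m)) z)) / real (degree f) ^ (2 * m)\<bar>
    \<le> 2 / real (degree f) ^ n * (ln_minus (poly (pderiv (F n)) z - a)
        + (\<bar>ln_plus (poly (pderiv (F n)) z) - ln_plus (poly (F n) z)\<bar>
        + (ln (1 + cmod a) + (ln (R + 2) + 2 * green_const))))
      + 1 / real (degree f) ^ (2 * m) * ln_minus (poly (F (2 * m)) z)"
proof -
  define D where "D = real (degree f) ^ n"
  define D2 where "D2 = real (degree f) ^ (2 * m)"
  have d: "real (degree f) \<ge> 2" using deg by simp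
  have "real (degree f) ^ 1 \<le> D" unfolding D_def using n d by (intro power_increasing) auto
  then have D: "D \<ge> 2" using d by simp
  have D2: "D2 > 0" unfolding D2_def using d by simp
  define x y u where "x = poly (pderiv (F n)) z" and "y = poly (F n) z" and "u = poly (F (2 * m)) z"
  have inv: "1 / (D - 1) \<le> 2 / D" using D by (simp add: field_simps)
  have t1: "\<bar>ln (cmod (x - a)) / (D - 1) - ln_plus x / (D - 1)\<bar> \<le> 2 / D * (ln_minus (x - a) + ln (1 + cmod a))"
  proof -
    have "\<bar>ln (cmod (x - a)) / (D - 1) - ln_plus x / (D - 1)\<bar> = 1 / (D - 1) * \<bar>ln (cmod (x - a)) - ln_plus x\<bar>"
      using D by (simp add: diff_divide_distrib[symmetric] abs_divide)
    also have "\<dots> \<le> 2 / D * (ln_minus (x - a) + ln (1 + cmod a))"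
      using D inv by (intro mult_mono ln_cmod_diff_bound) auto
    finally show ?thesis .
  qed
  have t2: "\<bar>ln_plus x / (D - 1) - ln_plus y / (D - 1)\<bar> \<le> 2 / D * \<bar>ln_plus x - ln_plus y\<bar>"
  proof -
    have "\<bar>ln_plus x / (D - 1) - ln_plus y / (D - 1)\<bar> = 1 / (D - 1) * \<bar>ln_plus x - ln_plus y\<bar>"
      using D by (simp add: diff_divide_distrib[symmetric] abs_divide)
    also have "\<dots> \<le> 2 / D * \<bar>ln_plus x - ln_plus y\<bar>" using inv by (intro mult_right_mono) auto
    finally show ?thesis .
  qed
  have lz: "ln_plus z \<le> ln (R + 2)"
    unfolding ln_plus_altdef using z R by (subst ln_le_cancel_iff) auto
  \<comment> \<open>The change of normalisation costs \<open>ln_plus y / (D (D - 1))\<close>, and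
    \<open>ln_plus y\<close> is at most of order \<open>D\<close>.\<close>
  have t3: "\<bar>ln_plus y / (D - 1) - ln_plus y / D\<bar> \<le> 2 / D * (ln (R + 2) + green_const)"
  proof -
    have yD: "ln_plus y \<le> D * (ln (R + 2) + green_const)"
    proof -
      have "ln_plus y \<le> D * (ln_plus z + green_const)" unfolding y_def D_def by (rule ln_plus_F_le)
      also have "\<dots> \<le> D * (ln (R + 2) + green_const)" using lz D by (intro mult_left_mono) auto
      finally show ?thesis .
    qed
    have e1: "ln_plus y / (D - 1) - ln_plus y / D = 1 / (D - 1) * (ln_plus y / D)" using D by (simp add: field_simps)
    have e2: "\<bar>1 / (D - 1) * (ln_plus y / D)\<bar> = 1 / (D - 1) * (ln_plus y / D)" using D by simp
    have "1 / (D - 1) * (ln_plus y / D) \<le> 2 / D * (ln (R + 2) + green_const)"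
      using inv D yD by (intro mult_mono) (auto simp: field_simps)
    then show ?thesis unfolding e1 e2 .
  qed
  have t4: "\<bar>ln_plus y / D - ln_plus u / D2\<bar> \<le> 2 / D * green_const"
  proof -
    obtain k where k: "2 * m = n + k" using n(2) le_Suc_ex by blast
    have "\<bar>ln_plus u / D2 - ln_plus y / D\<bar> \<le> green_const / D"
      using green_cauchy'[of n k z] unfolding u_def y_def D_def D2_def k .
    also have "\<dots> \<le> 2 / D * green_const" using green_const(1) D by (simp add: field_simps)
    finally show ?thesis by (simp add: abs_minus_commute)
  qed
  have t5: "\<bar>ln_plus u / D2 - ln (cmod u) / D2\<bar> = 1 / D2 * ln_minus u"
    using D2 by (simp add: ln_cmod_eq[of u] diff_divide_distrib[symmetric])
  have "\<bar>ln (cmod (x - a)) / (D - 1) - ln (cmod u) / D2\<bar>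
    \<le> 2 / D * (ln_minus (x - a) + ln (1 + cmod a)) + 2 / D * \<bar>ln_plus x - ln_plus y\<bar>
      + 2 / D * (ln (R + 2) + green_const) + 2 / D * green_const + 1 / D2 * ln_minus u"
    using t1 t2 t3 t4 t5 by linarith
  also have "\<dots> = 2 / D * (ln_minus (x - a) + (\<bar>ln_plus x - ln_plus y\<bar> + (ln (1 + cmod a) + (ln (R + 2) + 2 * green_const))))
      + 1 / D2 * ln_minus u" by (simp add: distrib_left)
  finally show ?thesis by (simp only: x_def y_def u_def D_def D2_def)
qed

text \<open>For fixed \<open>n\<close> the comparison polynomial is \<open>F (2 m)\<close> with
  \<open>m\<close> tending to infinity. The averages over its zeros tend to the integral against
  \<open>\<mu>\<close> and the error \<open>b m\<close> disappears, so its speed does not enter the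
  rate in \<open>n\<close>.\<close>

lemma deriv_root_avg_rate:
  assumes eq: "is_equilibrium_measure f \<mu>" and exc: "exceptional_set f = {Infty}" and \<phi>: "C2_sphere \<phi>"
    and \<theta>: "\<theta> \<ge> 1" "K \<ge> 0"
    and a: "\<And>n. (\<integral>\<^sup>+z\<in>cball 0 (R + 2). ennreal (ln_minus (poly (pderiv (F n)) z - a)) \<partial>lborel) \<le> ennreal (K * \<theta> ^ n)"
  obtains C where "eventually (\<lambda>n. \<bar>root_avg (pderiv (F n) - [:a:]) (\<lambda>z. \<phi> (Fin z)) - (\<integral>z. \<phi> z \<partial>\<mu>)\<bar>
    \<le> C * ((\<theta> ^ n + real n ^ 4) / real (degree f) ^ n)) sequentially"
proof -
  let ?g = "\<lambda>z. \<phi> (Fin z)"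
  let ?d = "real (degree f)"
  have g: "C2 ?g" using \<phi> by (simp add: C2_sphere_def)
  have d: "?d \<ge> 2" using deg by simp
  obtain b where b: "b \<longlonglongrightarrow> 0" "\<And>m. b m \<ge> 0"
    "\<And>m w. (\<integral>\<^sup>+z\<in>cball 0 (R + 2). ennreal (ln_minus (poly (F (2 * m)) z - w)) \<partial>lborel)
      \<le> ennreal (real (degree f) ^ (2 * m) * b m)"
    by (rule even_iterate_integral[OF exc]) (rule that)
  have R0: "R \<ge> 0" using R by simp
  obtain C where C: "C > 0" "\<And>p q. degree p > 0 \<Longrightarrow> degree q > 0 \<Longrightarrow> (\<forall>y. poly p y = 0 \<longrightarrow> cmod y \<le> R) \<Longrightarrow>
    (\<forall>y. poly q y = 0 \<longrightarrow> cmod y \<le> R) \<Longrightarrow>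
    ennreal \<bar>root_avg p ?g - root_avg q ?g\<bar> \<le> ennreal C * (\<integral>\<^sup>+z\<in>cball 0 (R + 2).
      ennreal \<bar>ln (cmod (poly p z)) / degree p - ln (cmod (poly q z)) / degree q\<bar> \<partial>lborel)"
    by (rule root_avg_comparison[OF g R0]) (rule that)
  obtain C3 where C3: "C3 \<ge> 0" "eventually (\<lambda>n. (\<integral>\<^sup>+z\<in>cball 0 (R + 2). ennreal
    \<bar>ln_plus (poly (pderiv (F n)) z) - ln_plus (poly (F n) z)\<bar> \<partial>lborel) \<le> ennreal (C3 * real n ^ 4)) sequentially"
    by (rule deriv_iterate_integral) (rule that)
  define V where "V = pi * (R + 2)\<^sup>2"
  define c where "c = ln (1 + cmod a) + (ln (R + 2) + 2 * green_const)"
  have c: "c \<ge> 0" using R green_const(1) by (auto simp: c_def intro!: add_nonneg_nonneg)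
  have V: "V \<ge> 0" by (simp add: V_def)
  define A where "A m = root_avg (F (2 * m) - [:0:]) ?g" for m
  define q where "q n = 2 / ?d ^ n * (K * \<theta> ^ n + (C3 * real n ^ 4 + c * V))" for n
  have q0: "q n \<ge> 0" for n using \<theta> C3(1) c V d by (auto simp: q_def intro!: mult_nonneg_nonneg add_nonneg_nonneg)
  have cb: "cball (0::complex) (R + 2) \<in> sets lborel" by simp
  have mF: "poly p \<in> borel_measurable borel" for p :: "complex poly"
    by (intro borel_measurable_continuous_onI continuous_intros)
  \<comment> \<open>\<open>cmod a < 2^n\<close> confines the zeros of
    \<open>pderiv (F n) - a\<close> to the disc of radius \<open>R\<close>, as the comparison of
    averages demands, and \<open>n \<ge> 1\<close> makes their number positive.\<close>
  have pair: "\<bar>root_avg (pderiv (F n) - [:a:]) ?g - A m\<bar> \<le> C * (q n + b m)"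
    if n: "n \<ge> 1" "n \<le> 2 * m" "cmod a < 2 ^ n" and I3: "(\<integral>\<^sup>+z\<in>cball 0 (R + 2). ennreal
      \<bar>ln_plus (poly (pderiv (F n)) z) - ln_plus (poly (F n) z)\<bar> \<partial>lborel) \<le> ennreal (C3 * real n ^ 4)" for n m
  proof -
    have "2 ^ 1 \<le> degree f ^ n"
    proof -
      have "2 ^ 1 \<le> degree f ^ (1::nat)" using deg by simp
      also have "\<dots> \<le> degree f ^ n" using n deg by (intro power_increasing) auto
      finally show ?thesis .
    qed
    then have degD: "degree (pderiv (F n)) > 0" "real (degree (pderiv (F n))) = ?d ^ n - 1"
      by (auto simp: deriv_F_degree of_nat_diff)
    let ?P = "pderiv (F n) - [:a:]" and ?Q = "F (2 * m) - [:0:]"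
    have dP: "degree ?P > 0" "real (degree ?P) = ?d ^ n - 1" using degD by (simp_all add: degree_diff_const)
    have dQ: "degree ?Q > 0" "real (degree ?Q) = ?d ^ (2 * m)" using deg by (simp_all add: degree_F)
    have rP: "\<forall>y. poly ?P y = 0 \<longrightarrow> cmod y \<le> R" using deriv_F_roots_bounded[OF n(3)] by simp
    have rQ: "\<forall>y. poly ?Q y = 0 \<longrightarrow> cmod y \<le> R" using F_roots_bounded[of 0 "2 * m"] R by simp
    have dn: "2 / ?d ^ n \<ge> 0" "1 / ?d ^ (2 * m) \<ge> 0" using d by auto
    let ?f1 = "\<lambda>z. ln_minus (poly (pderiv (F n)) z - a)"
    let ?f2 = "\<lambda>z. \<bar>ln_plus (poly (pderiv (F n)) z) - ln_plus (poly (F n) z)\<bar>"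
    let ?f3 = "\<lambda>z. ln_minus (poly (F (2 * m)) z - 0)"
    have "(\<integral>\<^sup>+z\<in>cball 0 (R + 2). ennreal \<bar>ln (cmod (poly ?P z)) / degree ?P - ln (cmod (poly ?Q z)) / degree ?Q\<bar> \<partial>lborel)
      \<le> (\<integral>\<^sup>+z. ennreal (2 / ?d ^ n) * (ennreal (?f1 z) * indicator (cball 0 (R + 2)) z
           + (ennreal (?f2 z) * indicator (cball 0 (R + 2)) z + ennreal c * indicator (cball 0 (R + 2)) z))
         + ennreal (1 / ?d ^ (2 * m)) * (ennreal (?f3 z) * indicator (cball 0 (R + 2)) z) \<partial>lborel)"
    proof (rule nn_integral_mono)
      fix z
      show "ennreal \<bar>ln (cmod (poly ?P z)) / degree ?P - ln (cmod (poly ?Q z)) / degree ?Q\<bar> * indicator (cball 0 (R + 2)) z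
        \<le> ennreal (2 / ?d ^ n) * (ennreal (?f1 z) * indicator (cball 0 (R + 2)) z
           + (ennreal (?f2 z) * indicator (cball 0 (R + 2)) z + ennreal c * indicator (cball 0 (R + 2)) z))
         + ennreal (1 / ?d ^ (2 * m)) * (ennreal (?f3 z) * indicator (cball 0 (R + 2)) z)"
      proof (cases "z \<in> cball 0 (R + 2)")
        case True
        have "\<bar>ln (cmod (poly ?P z)) / degree ?P - ln (cmod (poly ?Q z)) / degree ?Q\<bar>
          \<le> 2 / ?d ^ n * (?f1 z + (?f2 z + c)) + 1 / ?d ^ (2 * m) * ?f3 z"
          using deriv_potential_pointwise[OF n(1,2) True, of a] unfolding dP(2) dQ(2) c_def by simp
        then have "ennreal \<bar>ln (cmod (poly ?P z)) / degree ?P - ln (cmod (poly ?Q z)) / degree ?Q\<bar>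
          \<le> ennreal (2 / ?d ^ n * (?f1 z + (?f2 z + c)) + 1 / ?d ^ (2 * m) * ?f3 z)" by (rule ennreal_leI)
        also have "\<dots> = ennreal (2 / ?d ^ n) * (ennreal (?f1 z) + (ennreal (?f2 z) + ennreal c)) + ennreal (1 / ?d ^ (2 * m)) * ennreal (?f3 z)"
        proof -
          have "ennreal (2 / ?d ^ n * (?f1 z + (?f2 z + c)) + 1 / ?d ^ (2 * m) * ?f3 z)
            = ennreal (2 / ?d ^ n * (?f1 z + (?f2 z + c))) + ennreal (1 / ?d ^ (2 * m) * ?f3 z)"
            using dn c by (intro ennreal_plus mult_nonneg_nonneg add_nonneg_nonneg) auto
          also have "ennreal (2 / ?d ^ n * (?f1 z + (?f2 z + c))) = ennreal (2 / ?d ^ n) * ennreal (?f1 z + (?f2 z + c))"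
            using dn c by (intro ennreal_mult) auto
          also have "ennreal (?f1 z + (?f2 z + c)) = ennreal (?f1 z) + ennreal (?f2 z + c)"
            using c by (intro ennreal_plus) auto
          also have "ennreal (?f2 z + c) = ennreal (?f2 z) + ennreal c" using c by (intro ennreal_plus) auto
          also have "ennreal (1 / ?d ^ (2 * m) * ?f3 z) = ennreal (1 / ?d ^ (2 * m)) * ennreal (?f3 z)"
            using dn by (intro ennreal_mult) auto
          finally show ?thesis .
        qed
        finally show ?thesis using True by simp
      qed simp
    qed
    also have "\<dots> = ennreal (2 / ?d ^ n) * ((\<integral>\<^sup>+z\<in>cball 0 (R + 2). ennreal (?f1 z) \<partial>lborel)
          + ((\<integral>\<^sup>+z\<in>cball 0 (R + 2). ennreal (?f2 z) \<partial>lborel) + ennreal c * emeasure lborel (cball (0::complex) (R + 2))))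
        + ennreal (1 / ?d ^ (2 * m)) * (\<integral>\<^sup>+z\<in>cball 0 (R + 2). ennreal (?f3 z) \<partial>lborel)"
    proof -
      have m1: "(\<lambda>z. ennreal (?f1 z) * indicator (cball 0 (R + 2)) z) \<in> borel_measurable lborel"
        "(\<lambda>z. ennreal (?f2 z) * indicator (cball 0 (R + 2)) z) \<in> borel_measurable lborel"
        "(\<lambda>z. ennreal (?f3 z) * indicator (cball 0 (R + 2)) z) \<in> borel_measurable lborel"
        "(\<lambda>z::complex. ennreal c * indicator (cball 0 (R + 2)) z) \<in> borel_measurable lborel"
        using mF by (auto intro!: borel_measurable_times_ennreal borel_measurable_indicator)
      show ?thesis
        by (simp only: nn_integral_cmult nn_integral_add m1 borel_measurable_add borel_measurable_times_ennreal borel_measurable_const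
            nn_integral_cmult_indicator[OF cb])
    qed
    also have "\<dots> \<le> ennreal (2 / ?d ^ n) * (ennreal (K * \<theta> ^ n) + (ennreal (C3 * real n ^ 4) + ennreal c * ennreal V))
        + ennreal (1 / ?d ^ (2 * m)) * ennreal (?d ^ (2 * m) * b m)"
      using R by (intro add_mono mult_left_mono a I3 b(3)) (auto simp: V_def emeasure_cball_complex)
    also have "\<dots> = ennreal (q n + b m)"
    proof -
      have "1 / ?d ^ (2 * m) * (?d ^ (2 * m) * b m) = b m" using d by simp
      then have "ennreal (1 / ?d ^ (2 * m)) * ennreal (?d ^ (2 * m) * b m) = ennreal (b m)"
        using dn(2) b(2)[of m] by (subst ennreal_mult[symmetric]) auto
      moreover have "ennreal (2 / ?d ^ n) * (ennreal (K * \<theta> ^ n) + (ennreal (C3 * real n ^ 4) + ennreal c * ennreal V)) = ennreal (q n)"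
        unfolding q_def using dn(1) \<theta> C3(1) c V
        by (simp add: ennreal_mult[symmetric] ennreal_plus[symmetric] del: ennreal_plus)
      ultimately show ?thesis using q0[of n] b(2)[of m] by (simp add: ennreal_plus[symmetric] del: ennreal_plus)
    qed
    finally have "ennreal \<bar>root_avg ?P ?g - A m\<bar> \<le> ennreal C * ennreal (q n + b m)"
      unfolding A_def by (intro order_trans[OF C(2)[OF dP(1) dQ(1) rP rQ] mult_left_mono]) auto
    also have "\<dots> = ennreal (C * (q n + b m))" using C(1) q0[of n] b(2)[of m] by (intro ennreal_mult[symmetric]) auto
    finally show ?thesis using C(1) q0[of n] b(2)[of m] by (subst (asm) ennreal_le_iff) auto
  qed
  have Alim: "A \<longlonglongrightarrow> (\<integral>z. \<phi> z \<partial>\<mu>)" unfolding A_def by (rule equilibrium_limit[OF eq exc \<phi>])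
  define Cf where "Cf = C * (2 * (K + C3 + c * V))"
  have "eventually (\<lambda>n. cmod a < 2 ^ n) sequentially"
  proof -
    have "filterlim (\<lambda>n. 2 ^ n :: real) at_top sequentially" by real_asymp
    then show ?thesis by (simp add: filterlim_at_top_dense)
  qed
  then have "eventually (\<lambda>n. \<bar>root_avg (pderiv (F n) - [:a:]) ?g - (\<integral>z. \<phi> z \<partial>\<mu>)\<bar>
    \<le> Cf * ((\<theta> ^ n + real n ^ 4) / ?d ^ n)) sequentially"
    using C3(2) eventually_ge_at_top[of 1]
  proof eventually_elim
    case (elim n)
    have "(\<lambda>m. \<bar>root_avg (pderiv (F n) - [:a:]) ?g - A m\<bar>) \<longlonglongrightarrow> \<bar>root_avg (pderiv (F n) - [:a:]) ?g - (\<integral>z. \<phi> z \<partial>\<mu>)\<bar>"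
      by (intro tendsto_intros Alim)
    moreover have "(\<lambda>m. C * (q n + b m)) \<longlonglongrightarrow> C * (q n + 0)" by (intro tendsto_intros b(1))
    moreover have "\<exists>N. \<forall>m\<ge>N. \<bar>root_avg (pderiv (F n) - [:a:]) ?g - A m\<bar> \<le> C * (q n + b m)"
      using pair[of n] elim by (intro exI[of _ n]) auto
    ultimately have "\<bar>root_avg (pderiv (F n) - [:a:]) ?g - (\<integral>z. \<phi> z \<partial>\<mu>)\<bar> \<le> C * (q n + 0)" by (rule LIMSEQ_le)
    also have "\<dots> \<le> Cf * ((\<theta> ^ n + real n ^ 4) / ?d ^ n)"
    proof -
      have \<theta>n: "1 \<le> \<theta> ^ n" using \<theta>(1) by (rule one_le_power)
      have n4: "0 \<le> real n ^ 4" by simp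
      have "K * \<theta> ^ n + (C3 * real n ^ 4 + c * V) \<le> (K + C3 + c * V) * (\<theta> ^ n + real n ^ 4)"
      proof -
        have "c * V * 1 \<le> c * V * \<theta> ^ n" using c V \<theta>n by (intro mult_left_mono) auto
        moreover have "0 \<le> K * real n ^ 4" "0 \<le> C3 * \<theta> ^ n" "0 \<le> c * V * real n ^ 4"
          using \<theta>(2) C3(1) c V \<theta>n by auto
        ultimately show ?thesis by (simp add: algebra_simps)
      qed
      then have "2 / ?d ^ n * (K * \<theta> ^ n + (C3 * real n ^ 4 + c * V)) \<le> 2 / ?d ^ n * ((K + C3 + c * V) * (\<theta> ^ n + real n ^ 4))"
        using d by (intro mult_left_mono) auto
      then have m1: "C * q n \<le> C * (2 / ?d ^ n * ((K + C3 + c * V) * (\<theta> ^ n + real n ^ 4)))"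
        unfolding q_def by (rule mult_left_mono) (use C(1) in simp)
      have m2: "C * (2 / ?d ^ n * ((K + C3 + c * V) * (\<theta> ^ n + real n ^ 4))) = Cf * ((\<theta> ^ n + real n ^ 4) / ?d ^ n)"
        unfolding Cf_def by (simp only: times_divide_eq_left times_divide_eq_right mult_ac)
      show ?thesis using m1 unfolding m2 add_0_right .
    qed
    finally show ?case .
  qed
  then show thesis by (rule that)
qed

end

theorem theorem2:
  fixes f :: "complex poly" and \<mu> :: "riemann_sphere measure" and \<eta> :: real
  assumes "degree f > 1"
    and "exceptional_set f = {Infty}"
    and "is_equilibrium_measure f \<mu>"
    and "ereal \<eta> > superattracting_growth f"
  shows "\<exists>E :: complex set. polar E \<and>
    (\<forall>a. a \<notin> E \<longrightarrow> (\<forall>\<phi>. C2_sphere \<phi> \<longrightarrow>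
      (\<lambda>n. pullback (pderiv (poly_iterate f n)) (return borel (Fin a)) \<phi> / (real (degree f) ^ n - 1)
            - (\<integral>z. \<phi> z \<partial>\<mu>))
        \<in> o(\<lambda>n. (\<eta> / real (degree f)) ^ n)))"
proof -
  obtain R where "escaping_poly f R" using escaping_poly_exists[OF assms(1)] by blast
  then interpret escaping_poly f R .
  have "1 < ereal \<eta>" using superattracting_growth_ge_1[OF assms(1)] assms(4) by (rule order_le_less_trans)
  then have \<eta>: "\<eta> > 1" by (simp add: one_ereal_def)
  \<comment> \<open>Any number strictly between 1 and \<open>\<eta>\<close> serves:
    \<open>\<theta> > 1\<close> makes the weights summable, and \<open>\<theta> < \<eta>\<close>
    makes \<open>\<theta>^n\<close> negligible against \<open>\<eta>^n\<close>, as
    \<open>n^4\<close> is.\<close>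
  define \<theta> where "\<theta> = (1 + \<eta>) / 2"
  have \<theta>: "1 < \<theta>" "\<theta> < \<eta>" using \<eta> by (auto simp: \<theta>_def)
  define r where "r = 1 / \<theta>"
  have r: "0 < r" "r < 1" using \<theta> by (auto simp: r_def)
  define U where "U a = (\<Sum>n. ennreal (r ^ n) * (\<integral>\<^sup>+z\<in>cball 0 (R + 2). log_pole (poly (pderiv (F n)) z - a) \<partial>lborel))" for a
  have "polar {a. U a = \<infinity>}"
    unfolding U_def
  proof (rule polar_divergence_set[OF _ r])
    show "poly (pderiv (F n)) \<in> borel_measurable borel" for n
      by (intro borel_measurable_continuous_onI continuous_intros)
    show "emeasure lborel (cball (0::complex) (R + 2)) < \<infinity>" using R by (simp add: emeasure_cball_complex)
  qed simp
  moreover have "(\<lambda>n. pullback (pderiv (F n)) (return borel (Fin a)) \<phi> / (real (degree f) ^ n - 1) - (\<integral>z. \<phi> z \<partial>\<mu>))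
        \<in> o(\<lambda>n. (\<eta> / real (degree f)) ^ n)"
    if a: "a \<notin> {a. U a = \<infinity>}" and \<phi>: "C2_sphere \<phi>" for a \<phi>
  proof -
    define K where "K = enn2real (U a)"
    have K: "K \<ge> 0" "U a = ennreal K" using a by (auto simp: K_def less_top)
    have int: "(\<integral>\<^sup>+z\<in>cball 0 (R + 2). ennreal (ln_minus (poly (pderiv (F n)) z - a)) \<partial>lborel) \<le> ennreal (K * \<theta> ^ n)" for n
    proof -
      let ?I = "\<integral>\<^sup>+z\<in>cball 0 (R + 2). log_pole (poly (pderiv (F n)) z - a) \<partial>lborel"
      \<comment> \<open>A single term of the series is at most its sum, which bounds the
        \<open>n\<close>-th integral by \<open>K \<theta>^n\<close>.\<close>
      have "(\<Sum>k\<in>{n}. ennreal (r ^ k) * (\<integral>\<^sup>+z\<in>cball 0 (R + 2). log_pole (poly (pderiv (F k)) z - a) \<partial>lborel)) \<le> U a"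
        unfolding U_def by (rule sum_le_suminf) auto
      then have "ennreal (r ^ n) * ?I \<le> ennreal K" by (simp add: K(2))
      then have "ennreal (\<theta> ^ n) * (ennreal (r ^ n) * ?I) \<le> ennreal (\<theta> ^ n) * ennreal K" by (intro mult_left_mono) auto
      moreover have "ennreal (\<theta> ^ n) * (ennreal (r ^ n) * ?I) = ?I"
      proof -
        have "\<theta> ^ n * r ^ n = 1" using \<theta>(1) by (simp add: r_def power_mult_distrib[symmetric])
        then have "ennreal (\<theta> ^ n) * ennreal (r ^ n) = 1" using \<theta>(1) r by (simp add: ennreal_mult[symmetric])
        then show ?thesis by (simp add: mult.assoc[symmetric])
      qed
      ultimately have "?I \<le> ennreal (\<theta> ^ n * K)" using \<theta>(1) K(1) by (simp add: ennreal_mult)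
      moreover have "(\<integral>\<^sup>+z\<in>cball 0 (R + 2). ennreal (ln_minus (poly (pderiv (F n)) z - a)) \<partial>lborel) \<le> ?I"
        by (intro nn_integral_mono mult_right_mono ln_minus_le_log_pole) auto
      ultimately show ?thesis by (simp add: mult.commute)
    qed
    obtain C where C: "eventually (\<lambda>n. \<bar>root_avg (pderiv (F n) - [:a:]) (\<lambda>z. \<phi> (Fin z)) - (\<integral>z. \<phi> z \<partial>\<mu>)\<bar>
      \<le> C * ((\<theta> ^ n + real n ^ 4) / real (degree f) ^ n)) sequentially"
      by (rule deriv_root_avg_rate[OF assms(3,2) \<phi> less_imp_le[OF \<theta>(1)] K(1) int]) (rule that)
    have d: "real (degree f) \<ge> 2" using assms(1) by simp
    \<comment> \<open>For \<open>n = 0\<close> the derivative is the constant 1 and the denominator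
      is 0, so the identity starts at 1.\<close>
    have eq: "pullback (pderiv (F n)) (return borel (Fin a)) \<phi> / (real (degree f) ^ n - 1)
      = root_avg (pderiv (F n) - [:a:]) (\<lambda>z. \<phi> (Fin z))" if "n \<ge> 1" for n
    proof -
      have "degree f ^ 1 \<le> degree f ^ n" using that assms(1) by (intro power_increasing) auto
      then have dg: "degree (pderiv (F n)) > 0" "real (degree (pderiv (F n))) = real (degree f) ^ n - 1"
        using assms(1) by (auto simp: deriv_F_degree of_nat_diff)
      have "pullback (pderiv (F n)) (return borel (Fin a)) \<phi> = push_sum (pderiv (F n)) \<phi> (Fin a)"
        unfolding pullback_eq_push_sum
        by (rule integral_return) (auto intro: borel_measurable_continuous_onI push_sum_continuous dg(1) \<phi>)
      also have "\<dots> = (real (degree f) ^ n - 1) * root_avg (pderiv (F n) - [:a:]) (\<lambda>z. \<phi> (Fin z))"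
        using push_sum_root_avg[OF dg(1)] by (simp add: dg(2))
      finally show ?thesis using dg by simp
    qed
    have "(\<lambda>n. pullback (pderiv (F n)) (return borel (Fin a)) \<phi> / (real (degree f) ^ n - 1) - (\<integral>z. \<phi> z \<partial>\<mu>))
        \<in> O(\<lambda>n. (\<theta> ^ n + real n ^ 4) / real (degree f) ^ n)"
    proof (rule bigoI)
      show "eventually (\<lambda>n. norm (pullback (pderiv (F n)) (return borel (Fin a)) \<phi> / (real (degree f) ^ n - 1) - (\<integral>z. \<phi> z \<partial>\<mu>))
        \<le> C * norm ((\<theta> ^ n + real n ^ 4) / real (degree f) ^ n)) sequentially"
        using C eventually_ge_at_top[of 1]
      proof eventually_elim
        case (elim n)
        have "0 \<le> (\<theta> ^ n + real n ^ 4) / real (degree f) ^ n" using \<theta>(1) by simp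
        then have "norm ((\<theta> ^ n + real n ^ 4) / real (degree f) ^ n) = (\<theta> ^ n + real n ^ 4) / real (degree f) ^ n"
          by (simp only: real_norm_def abs_of_nonneg)
        then show ?case using elim(1) unfolding eq[OF elim(2)] by (simp only: real_norm_def)
      qed
    qed
    also have "(\<lambda>n. (\<theta> ^ n + real n ^ 4) / real (degree f) ^ n) \<in> o(\<lambda>n. (\<eta> / real (degree f)) ^ n)"
    proof -
      define e where "e = real (degree f)"
      have e: "e \<ge> 2" using d by (simp add: e_def)
      have "(\<lambda>n. ((\<theta> ^ n + real n ^ 4) / e ^ n) / (\<eta> / e) ^ n) \<longlonglongrightarrow> 0"
      proof -
        have "((\<theta> ^ n + real n ^ 4) / e ^ n) / (\<eta> / e) ^ n = (\<theta> / \<eta>) ^ n + real n ^ 4 / \<eta> ^ n" for n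
        proof -
          have "((\<theta> ^ n + real n ^ 4) / e ^ n) / (\<eta> ^ n / e ^ n) = (\<theta> ^ n + real n ^ 4) / \<eta> ^ n"
            using e by simp
          then show ?thesis by (simp only: power_divide add_divide_distrib)
        qed
        moreover have "(\<lambda>n. real n ^ 4 / \<eta> ^ n) \<longlonglongrightarrow> 0" using \<eta> by real_asymp
        moreover have "(\<lambda>n. (\<theta> / \<eta>) ^ n) \<longlonglongrightarrow> 0" using \<theta> \<eta> by (intro LIMSEQ_realpow_zero) auto
        ultimately show ?thesis using tendsto_add[of "\<lambda>n. (\<theta> / \<eta>) ^ n" 0 sequentially "\<lambda>n. real n ^ 4 / \<eta> ^ n" 0] by simp
      qed
      then show ?thesis unfolding e_def using \<eta> d by (intro smalloI_tendsto) (auto simp: eventually_sequentially)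
    qed
    finally show ?thesis .
  qed
  ultimately show ?thesis by blast
qed

end
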